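(* Let $G$ be a finite group of odd order and $\mathcal K$ a field of characteristic $0$. Then $\mathcal C_\Theta(\rho)=1$ for every $G$-relation $\Theta$ and every self-dual $\mathcal KG$-representation $\rho$.
   Context: A $G$-relation is a formal $\mathbb Z$-combination $\Theta=\sum_in_iH_i$ of conjugacy classes of subgroups of $G$ with $\bigoplus_i\mathbb C[G/H_i]^{\oplus n_i}=0$ as virtual representation. The regulator constant is $\mathcal C_\Theta(\rho)=\prod_i\det(\frac1{|H_i|}\langle,\rangle\mid\rho^{H_i})^{n_i}\in\mathcal K^\times/\mathcal K^{\times2}$, where $\langle,\rangle$ is any nondegenerate $G$-invariant $\mathcal K$-bilinear pairing on $\rho$ and the determinants are Gram determinants on $\mathcal K$-bases of invariants. *)

theory Defs
  imports "HOL-Analysis.Analysis" "HOL-Algebra.Group" "HOL-Algebra.Coset"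
begin

definition is_rep :: "('g, 'b) monoid_scheme \<Rightarrow> ('g \<Rightarrow> 'k::field ^'n^'n) \<Rightarrow> bool" where
  "is_rep G \<rho> \<longleftrightarrow> \<rho> \<one>\<^bsub>G\<^esub> = mat 1 \<and>
     (\<forall>x\<in>carrier G. \<forall>y\<in>carrier G. \<rho> (x \<otimes>\<^bsub>G\<^esub> y) = \<rho> x ** \<rho> y)"

definition self_dual :: "('g, 'b) monoid_scheme \<Rightarrow> ('g \<Rightarrow> 'k::field ^'n^'n) \<Rightarrow> bool" where
  "self_dual G \<rho> \<longleftrightarrow> (\<exists>P. invertible P \<and>
     (\<forall>g\<in>carrier G. P ** \<rho> g = transpose (\<rho> (inv\<^bsub>G\<^esub> g)) ** P))"

definition invariants :: "('g \<Rightarrow> 'k::field ^'n^'n) \<Rightarrow> 'g set \<Rightarrow> ('k^'n) set" where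
  "invariants \<rho> H = {v. \<forall>h\<in>H. \<rho> h *v v = v}"

definition bilinear_pairing :: "('k::field ^'n \<Rightarrow> 'k^'n \<Rightarrow> 'k) \<Rightarrow> bool" where
  "bilinear_pairing \<beta> \<longleftrightarrow>
     (\<forall>a b u v w. \<beta> (a *s u + b *s v) w = a * \<beta> u w + b * \<beta> v w) \<and>
     (\<forall>a b u v w. \<beta> w (a *s u + b *s v) = a * \<beta> w u + b * \<beta> w v)"

definition nondegenerate :: "('k::field ^'n \<Rightarrow> 'k^'n \<Rightarrow> 'k) \<Rightarrow> bool" where
  "nondegenerate \<beta> \<longleftrightarrow> (\<forall>v. (\<forall>w. \<beta> v w = 0) \<longrightarrow> v = 0)"

definition G_invariant_pairing ::
  "('g, 'b) monoid_scheme \<Rightarrow> ('g \<Rightarrow> 'k::field ^'n^'n) \<Rightarrow> ('k^'n \<Rightarrow> 'k^'n \<Rightarrow> 'k) \<Rightarrow> bool" where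
  "G_invariant_pairing G \<rho> \<beta> \<longleftrightarrow>
     (\<forall>g\<in>carrier G. \<forall>v w. \<beta> (\<rho> g *v v) (\<rho> g *v w) = \<beta> v w)"

definition is_basis_list :: "('k::field ^'n) set \<Rightarrow> ('k^'n) list \<Rightarrow> bool" where
  "is_basis_list V bs \<longleftrightarrow> distinct bs \<and> vec.independent (set bs) \<and> vec.span (set bs) = V"

text \<open>Determinant of a k x k matrix (Leibniz formula); the 0 x 0 determinant is 1.\<close>
definition det_fun :: "nat \<Rightarrow> (nat \<Rightarrow> nat \<Rightarrow> 'k::comm_ring_1) \<Rightarrow> 'k" where
  "det_fun k A = (\<Sum>p\<in>{p. p permutes {..<k}}. of_int (sign p) * (\<Prod>i<k. A i (p i)))"

definition gram_det :: "('v \<Rightarrow> 'v \<Rightarrow> 'k::comm_ring_1) \<Rightarrow> 'v list \<Rightarrow> 'k" where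
  "gram_det \<beta> bs = det_fun (length bs) (\<lambda>i j. \<beta> (bs ! i) (bs ! j))"

definition left_cosets :: "('g, 'b) monoid_scheme \<Rightarrow> 'g set \<Rightarrow> 'g set set" where
  "left_cosets G H = {(\<lambda>x. a \<otimes>\<^bsub>G\<^esub> x) ` H | a. a \<in> carrier G}"

definition coset_act :: "('g, 'b) monoid_scheme \<Rightarrow> 'g \<Rightarrow> 'g set \<Rightarrow> 'g set" where
  "coset_act G g C = (\<lambda>x. g \<otimes>\<^bsub>G\<^esub> x) ` C"

text \<open>A formal combination sum n_i H_i is represented as a list of pairs (H_i, n_i).
  The G-set underlying the permutation module of the part with positive
  coefficients (sign s = 1), resp. negative coefficients (s = -1):
  the disjoint union over i of |n_i| copies of G/H_i.\<close>
definition perm_gset :: "('g, 'b) monoid_scheme \<Rightarrow> ('g set \<times> int) list \<Rightarrow> int \<Rightarrow> ((nat \<times> nat) \<times> 'g set) set" where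
  "perm_gset G \<Theta> s = {((i, j), C). i < length \<Theta> \<and> j < nat (s * snd (\<Theta> ! i)) \<and>
                                   C \<in> left_cosets G (fst (\<Theta> ! i))}"

definition gset_act :: "('g, 'b) monoid_scheme \<Rightarrow> 'g \<Rightarrow> (nat \<times> nat) \<times> 'g set \<Rightarrow> (nat \<times> nat) \<times> 'g set" where
  "gset_act G g x = (fst x, coset_act G g (snd x))"

text \<open>C[X] and C[Y] are isomorphic as CG-modules: there is an invertible
  G-equivariant linear map C^X -> C^Y, given by its matrix M (with inverse N).\<close>
definition perm_modules_iso :: "('g, 'b) monoid_scheme \<Rightarrow> ('x set) \<Rightarrow> ('g \<Rightarrow> 'x \<Rightarrow> 'x) \<Rightarrow> ('y set) \<Rightarrow> ('g \<Rightarrow> 'y \<Rightarrow> 'y) \<Rightarrow> bool" where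
  "perm_modules_iso G X actX Y actY \<longleftrightarrow>
    (\<exists>(M :: 'y \<Rightarrow> 'x \<Rightarrow> complex) (N :: 'x \<Rightarrow> 'y \<Rightarrow> complex).
       (\<forall>y\<in>Y. \<forall>y'\<in>Y. (\<Sum>x\<in>X. M y x * N x y') = (if y = y' then 1 else 0)) \<and>
       (\<forall>x\<in>X. \<forall>x'\<in>X. (\<Sum>y\<in>Y. N x y * M y x') = (if x = x' then 1 else 0)) \<and>
       (\<forall>g\<in>carrier G. \<forall>y\<in>Y. \<forall>x\<in>X. M (actY g y) (actX g x) = M y x))"

definition G_relation :: "('g, 'b) monoid_scheme \<Rightarrow> ('g set \<times> int) list \<Rightarrow> bool" where
  "G_relation G \<Theta> \<longleftrightarrow> (\<forall>i<length \<Theta>. subgroup (fst (\<Theta> ! i)) G) \<and>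
     perm_modules_iso G (perm_gset G \<Theta> 1) (gset_act G) (perm_gset G \<Theta> (-1)) (gset_act G)"

text \<open>prod_i det( (1/|H_i|) <,> | rho^{H_i} )^{n_i}, computed on the chosen bases bs i of rho^{H_i}.\<close>
definition reg_product ::
  "('k::field ^'n \<Rightarrow> 'k^'n \<Rightarrow> 'k) \<Rightarrow> ('g set \<times> int) list \<Rightarrow> (nat \<Rightarrow> ('k^'n) list) \<Rightarrow> 'k" where
  "reg_product \<beta> \<Theta> bs =
     (\<Prod>i<length \<Theta>. gram_det (\<lambda>v w. \<beta> v w / of_nat (card (fst (\<Theta> ! i)))) (bs i)
                        powi snd (\<Theta> ! i))"

text \<open>Equality to 1 in K^x / K^x2.\<close>
definition trivial_square_class :: "'k::field \<Rightarrow> bool" where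
  "trivial_square_class x \<longleftrightarrow> (\<exists>c. c \<noteq> 0 \<and> x = c ^ 2)"

end

theory Submission
  imports "Jordan_Normal_Form.Determinant" "HOL-Algebra.Multiplicative_Group" Defs
begin

text \<open>A relation makes the permutation characters of its positive and negative parts agree. So for an
  operator \<open>A\<close> commuting with \<open>G\<close> the traces of each power of \<open>A\<close> on the spaces of
  \<open>H\<^sub>i\<close>-invariants, weighted by the \<open>n\<^sub>i\<close>, sum to 0, and in characteristic 0 the weighted product of
  the determinants of \<open>A\<close> is 1; hence the regulator constant does not depend on the pairing.
  Split off the \<open>G\<close>-invariants of \<open>\<rho>\<close>. As a group of odd order has no nontrivial self-dual
  irreducible representation, the complement carries a nondegenerate invariant alternating form,
  whose Gram determinants on the spaces of \<open>H\<^sub>i\<close>-invariants are squares. Only the trivial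
  constituents remain, and they contribute a power of the product of the \<open>|H\<^sub>i| ^ n\<^sub>i\<close>. That product
  is a square, because the regular representation contains the trivial one exactly once and has
  regulator constant 1.\<close>

section \<open>Matrices of finite support\<close>

text \<open>The relation lives over the complex numbers and the representation over an arbitrary
  field of characteristic 0. Only integers pass from one to the other, namely numbers of fixed
  points, and for that reason everything is phrased by traces. Nothing is split into irreducibles
  and no scalars are extended: subrepresentations are idempotent matrices, dimensions are their
  traces, and the absence of self-dual irreducibles is replaced by an averaging argument that
  enlarges an alternating form until it fills the complement of the \<open>G\<close>-invariants. Two
  invariant forms \<open>P\<close> and \<open>Q\<close> are compared through the operator P^(-1) Q,
  which commutes with \<open>G\<close> and whose determinant on a space of invariants is the
  quotient of the Gram determinants. The factors 1/|H| enter with the dimension of the H-invariants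
  as exponent. These dimensions share one parity, so modulo squares only the product of the
  |H_i|^(n_i) can survive. For the regular representation the general formula is read backwards: the
  regulator is known there, and the formula yields the product.\<close>

typedef (overloaded) 'a fmat =
  "{f :: nat \<Rightarrow> nat \<Rightarrow> 'a::zero. \<exists>n. \<forall>i j. n \<le> i \<or> n \<le> j \<longrightarrow> f i j = 0}"
  morphisms entry Abs_fmat
  by (rule exI[of _ "\<lambda>i j. 0"]) auto

text \<open>Sizes are a predicate, and only upper bounds. All matrices, square or not, share one
  ring without unit, in which \<open>fidm n\<close> acts as unit on the matrices of size
  \<open>n\<close>; products of rectangular matrices then need no change of type.\<close>

definition fshape :: "nat \<Rightarrow> nat \<Rightarrow> 'a::zero fmat \<Rightarrow> bool" where
  "fshape m n A \<longleftrightarrow> (\<forall>i j. m \<le> i \<or> n \<le> j \<longrightarrow> entry A i j = 0)"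

definition fmat_of :: "nat \<Rightarrow> nat \<Rightarrow> (nat \<Rightarrow> nat \<Rightarrow> 'a::zero) \<Rightarrow> 'a fmat" where
  "fmat_of m n f = Abs_fmat (\<lambda>i j. if i < m \<and> j < n then f i j else 0)"

lemma fmat_eqI: "(\<And>i j. entry A i j = entry B i j) \<Longrightarrow> A = B"
  by (metis entry_inject ext)

lemma fmat_eq_iff: "A = B \<longleftrightarrow> (\<forall>i j. entry A i j = entry B i j)"
  using fmat_eqI by blast

lemma entry_Abs:
  assumes "\<And>i j. n \<le> i \<or> n \<le> j \<Longrightarrow> f i j = 0"
  shows "entry (Abs_fmat f) = f"
  using assms by (intro Abs_fmat_inverse) blast

lemma entry_fmat_of [simp]:
  "entry (fmat_of m n f) i j = (if i < m \<and> j < n then f i j else 0)"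
  unfolding fmat_of_def by (subst entry_Abs[of "max m n"]) auto

lemma fshape_fmat_of [simp]: "fshape m n (fmat_of m n f)"
  by (auto simp: fshape_def)

lemma fshape_ex2: "\<exists>N. fshape N N A \<and> fshape N N B"
proof -
  obtain a where "\<forall>i j. a \<le> i \<or> a \<le> j \<longrightarrow> entry A i j = 0" using entry[of A] by auto
  moreover obtain b where "\<forall>i j. b \<le> i \<or> b \<le> j \<longrightarrow> entry B i j = 0" using entry[of B] by auto
  ultimately show ?thesis by (intro exI[of _ "max a b"]) (auto simp: fshape_def)
qed

lemma fshape_ex: "\<exists>N. fshape N N A"
  using fshape_ex2 by blast

lemma fshape_mono: "fshape m n A \<Longrightarrow> m \<le> m' \<Longrightarrow> n \<le> n' \<Longrightarrow> fshape m' n' A"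
  by (auto simp: fshape_def)

lemma fshape_ex3: "\<exists>N. fshape N N A \<and> fshape N N B \<and> fshape N N C"
proof -
  obtain a where a: "fshape a a A" "fshape a a B" using fshape_ex2 by blast
  obtain b where "fshape b b C" using fshape_ex by blast
  then show ?thesis using a by (intro exI[of _ "max a b"]) (auto intro: fshape_mono)
qed

instantiation fmat :: (comm_ring_1) ring
begin

definition zero_fmat :: "'a fmat" where "zero_fmat = Abs_fmat (\<lambda>i j. 0)"
definition plus_fmat :: "'a fmat \<Rightarrow> 'a fmat \<Rightarrow> 'a fmat"
  where "plus_fmat A B = Abs_fmat (\<lambda>i j. entry A i j + entry B i j)"
definition uminus_fmat :: "'a fmat \<Rightarrow> 'a fmat"
  where "uminus_fmat A = Abs_fmat (\<lambda>i j. - entry A i j)"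
definition minus_fmat :: "'a fmat \<Rightarrow> 'a fmat \<Rightarrow> 'a fmat"
  where "minus_fmat A B = Abs_fmat (\<lambda>i j. entry A i j - entry B i j)"
text \<open>The sum runs over the support of row \<open>i\<close> of \<open>A\<close>, so that no
  size has to be chosen; by \<open>entry_times_le\<close> it may be replaced by any range that
  covers the columns of \<open>A\<close>.\<close>

definition times_fmat :: "'a fmat \<Rightarrow> 'a fmat \<Rightarrow> 'a fmat"
  where "times_fmat A B = Abs_fmat (\<lambda>i j. \<Sum>k | entry A i k \<noteq> 0. entry A i k * entry B k j)"

lemma entry_zero: "entry (0::'a fmat) i j = 0"
  unfolding zero_fmat_def by (subst entry_Abs) auto

lemma entry_plus: "entry (A + B :: 'a fmat) i j = entry A i j + entry B i j"
proof -
  obtain N where "fshape N N A" "fshape N N B" using fshape_ex2 by blast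
  then show ?thesis unfolding plus_fmat_def by (subst entry_Abs[of N]) (auto simp: fshape_def)
qed

lemma entry_uminus: "entry (- A :: 'a fmat) i j = - entry A i j"
proof -
  obtain N where "fshape N N A" using fshape_ex by blast
  then show ?thesis unfolding uminus_fmat_def by (subst entry_Abs[of N]) (auto simp: fshape_def)
qed

lemma entry_minus: "entry (A - B :: 'a fmat) i j = entry A i j - entry B i j"
proof -
  obtain N where "fshape N N A" "fshape N N B" using fshape_ex2 by blast
  then show ?thesis unfolding minus_fmat_def by (subst entry_Abs[of N]) (auto simp: fshape_def)
qed

lemma entry_times_raw:
  "entry (A * B :: 'a fmat) i j = (\<Sum>k | entry A i k \<noteq> 0. entry A i k * entry B k j)"
proof -
  obtain N where "fshape N N A" "fshape N N B" using fshape_ex2 by blast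
  then show ?thesis unfolding times_fmat_def by (subst entry_Abs[of N]) (auto simp: fshape_def)
qed

lemma entry_times_le:
  assumes "fshape m n (A :: 'a fmat)" "n \<le> N"
  shows "entry (A * B) i j = (\<Sum>k<N. entry A i k * entry B k j)"
  unfolding entry_times_raw using assms
  by (intro sum.mono_neutral_left) (auto simp: fshape_def, meson leD le_trans linorder_le_less_linear)

instance
proof
  fix A B C :: "'a fmat"
  obtain N where N: "fshape N N A" "fshape N N B" "fshape N N C" using fshape_ex3 by blast
  have eA: "entry (A * X) i j = (\<Sum>k<N. entry A i k * entry X k j)" for X i j
    using N(1) by (rule entry_times_le) simp
  have eB: "entry (B * X) i j = (\<Sum>k<N. entry B i k * entry X k j)" for X i j
    using N(2) by (rule entry_times_le) simp
  have eAB: "entry (A * B * X) i j = (\<Sum>k<N. entry (A * B) i k * entry X k j)" for X i j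
    by (rule entry_times_le[of N N]) (use N in \<open>auto simp: fshape_def eA\<close>)
  have eS: "entry ((A + B) * X) i j = (\<Sum>k<N. entry (A + B) i k * entry X k j)" for X i j
    by (rule entry_times_le[of N N]) (use N in \<open>auto simp: fshape_def entry_plus\<close>)
  show "A * B * C = A * (B * C)"
  proof (rule fmat_eqI)
    fix i j
    have "entry (A * B * C) i j = (\<Sum>k<N. \<Sum>l<N. entry A i l * entry B l k * entry C k j)"
      by (simp add: eAB eA sum_distrib_right)
    also have "\<dots> = (\<Sum>l<N. \<Sum>k<N. entry A i l * entry B l k * entry C k j)"
      by (rule sum.swap)
    also have "\<dots> = entry (A * (B * C)) i j"
      by (simp add: eA eB sum_distrib_left mult.assoc)
    finally show "entry (A * B * C) i j = entry (A * (B * C)) i j" .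
  qed
  show "(A + B) * C = A * C + B * C"
    by (rule fmat_eqI) (simp add: eS eA eB entry_plus sum.distrib distrib_right)
  show "A * (B + C) = A * B + A * C"
    by (rule fmat_eqI) (simp add: eA entry_plus sum.distrib distrib_left)
qed (auto intro!: fmat_eqI simp: entry_plus entry_zero entry_uminus entry_minus)

end

lemmas entry_arith [simp] = entry_zero entry_plus entry_uminus entry_minus

lemma entry_sum [simp]: "entry (sum f S) i j = (\<Sum>x\<in>S. entry (f x) i j)"
  for f :: "'b \<Rightarrow> 'a::comm_ring_1 fmat"
  by (induction S rule: infinite_finite_induct) auto

definition fidm :: "nat \<Rightarrow> 'a::comm_ring_1 fmat" where
  "fidm n = fmat_of n n (\<lambda>i j. if i = j then 1 else 0)"

definition ftr :: "'a::comm_ring_1 fmat \<Rightarrow> 'a fmat" where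
  "ftr A = Abs_fmat (\<lambda>i j. entry A j i)"

definition fscale :: "'a \<Rightarrow> 'a::comm_ring_1 fmat \<Rightarrow> 'a fmat" where
  "fscale c A = Abs_fmat (\<lambda>i j. c * entry A i j)"

definition funit :: "nat \<Rightarrow> nat \<Rightarrow> 'a::comm_ring_1 fmat" where
  "funit a b = fmat_of (Suc a) (Suc b) (\<lambda>i j. if i = a \<and> j = b then 1 else 0)"

definition ftrace :: "'a::comm_ring_1 fmat \<Rightarrow> 'a" where
  "ftrace A = (\<Sum>i | entry A i i \<noteq> 0. entry A i i)"

definition fdet :: "nat \<Rightarrow> 'a::comm_ring_1 fmat \<Rightarrow> 'a" where
  "fdet n A = det_fun n (entry A)"

lemma entry_fidm [simp]: "entry (fidm n) i j = (if i = j \<and> i < n then 1 else 0)"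
  unfolding fidm_def by auto

lemma entry_funit [simp]: "entry (funit a b) i j = (if i = a \<and> j = b then 1 else 0)"
  unfolding funit_def by auto

lemma entry_ftr [simp]: "entry (ftr A) i j = entry A j i"
proof -
  obtain N where "fshape N N A" using fshape_ex by blast
  then show ?thesis unfolding ftr_def by (subst entry_Abs[of N]) (auto simp: fshape_def)
qed

lemma entry_fscale [simp]: "entry (fscale c A) i j = c * entry A i j"
proof -
  obtain N where "fshape N N A" using fshape_ex by blast
  then show ?thesis unfolding fscale_def by (subst entry_Abs[of N]) (auto simp: fshape_def)
qed

lemma entry_times_le2:
  assumes "fshape m n B" "m \<le> N"
  shows "entry (A * B) i j = (\<Sum>k<N. entry A i k * entry B k j)"
proof -
  obtain M where M: "fshape M M A" using fshape_ex by blast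
  have "entry (A * B) i j = (\<Sum>k<max M N. entry A i k * entry B k j)"
    by (rule entry_times_le[OF M]) simp
  also have "\<dots> = (\<Sum>k<N. entry A i k * entry B k j)"
    using assms by (intro sum.mono_neutral_right) (auto simp: fshape_def)
  finally show ?thesis .
qed

lemma entry_times: "fshape m n A \<Longrightarrow> entry (A * B) i j = (\<Sum>k<n. entry A i k * entry B k j)"
  by (rule entry_times_le[OF _ order_refl])

lemma entry_times2: "fshape m n B \<Longrightarrow> entry (A * B) i j = (\<Sum>k<m. entry A i k * entry B k j)"
  by (rule entry_times_le2[OF _ order_refl])

lemma fshape_fidm [simp]: "fshape n n (fidm n)"
  by (auto simp: fshape_def)

lemma entry_fidm_times: "entry (fidm n * A) i j = (if i < n then entry A i j else 0)"
  by (subst entry_times[OF fshape_fidm]) (auto simp: if_distrib[of "\<lambda>x. x * _"] cong: if_cong)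

lemma entry_times_fidm: "entry (A * fidm n) i j = (if j < n then entry A i j else 0)"
  by (subst entry_times2[OF fshape_fidm]) (auto simp: if_distrib[of "\<lambda>x. _ * x"] cong: if_cong)

text \<open>Expresses sizes by ring equations, so that they follow from associativity and serve as
  rewrite rules that remove identity matrices.\<close>

lemma fshape_iff: "fshape m n A \<longleftrightarrow> fidm m * A = A \<and> A * fidm n = A"
  unfolding fshape_def fmat_eq_iff entry_fidm_times entry_times_fidm
  by (metis linorder_not_le)

lemma fshapeD: "fshape m n A \<Longrightarrow> fidm m * A = A" "fshape m n A \<Longrightarrow> A * fidm n = A"
  by (auto simp: fshape_iff)

lemma fshape_times: "fshape m n A \<Longrightarrow> fshape n' p B \<Longrightarrow> fshape m p (A * B)"
  unfolding fshape_iff by (metis mult.assoc)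

lemma fshape_intros:
  "fshape m n 0"
  "fshape m n A \<Longrightarrow> fshape m n B \<Longrightarrow> fshape m n (A + B)"
  "fshape m n A \<Longrightarrow> fshape m n B \<Longrightarrow> fshape m n (A - B)"
  "fshape m n A \<Longrightarrow> fshape m n (- A)"
  "fshape m n A \<Longrightarrow> fshape m n (fscale c A)"
  "fshape n m A \<Longrightarrow> fshape m n (ftr A)"
  "a < m \<Longrightarrow> b < n \<Longrightarrow> fshape m n (funit a b)"
  "(\<And>x. x \<in> S \<Longrightarrow> fshape m n (f x)) \<Longrightarrow> fshape m n (sum f S)"
  by (auto simp: fshape_def intro!: sum.neutral)

lemma ftr_simps [simp]:
  "ftr (ftr A) = A" "ftr 0 = 0" "ftr (A + B) = ftr A + ftr B" "ftr (A - B) = ftr A - ftr B"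
  "ftr (- A) = - ftr A" "ftr (fidm n) = fidm n" "ftr (fscale c A) = fscale c (ftr A)"
  "ftr (sum f S) = (\<Sum>x\<in>S. ftr (f x))" "ftr (funit a b) = funit b a"
  by (auto intro!: fmat_eqI)

lemma ftr_times [simp]: "ftr (A * B) = ftr B * ftr A"
proof (rule fmat_eqI)
  fix i j
  obtain N where N: "fshape N N A" "fshape N N B" using fshape_ex2 by blast
  have "fshape N N (ftr B)" using N by (intro fshape_intros)
  then show "entry (ftr (A * B)) i j = entry (ftr B * ftr A) i j"
    using N by (simp add: entry_times[of N N] mult.commute)
qed

lemma fscale_simps [simp]:
  "fscale c 0 = 0" "fscale 0 A = 0" "fscale 1 A = A" "fscale c (fscale d A) = fscale (c * d) A"
  "fscale c (- A) = - fscale c A"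
  by (auto intro!: fmat_eqI)

lemma fscale_distribs:
  "fscale c (A + B) = fscale c A + fscale c B" "fscale c (A - B) = fscale c A - fscale c B"
  "fscale (c + d) A = fscale c A + fscale d A" "fscale (- c) A = - fscale c A"
  "fscale c (sum f S) = (\<Sum>x\<in>S. fscale c (f x))"
  by (auto intro!: fmat_eqI simp: algebra_simps sum_distrib_left)

lemma fscale_times [simp]:
  "fscale c A * B = fscale c (A * B)" "A * fscale c B = fscale c (A * B)"
proof -
  obtain N where N: "fshape N N A" "fshape N N B" using fshape_ex2 by blast
  have "fshape N N (fscale c A)" using N by (intro fshape_intros)
  then show "fscale c A * B = fscale c (A * B)" "A * fscale c B = fscale c (A * B)"
    using N by (auto intro!: fmat_eqI simp: entry_times[of N N] sum_distrib_left ac_simps)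
qed

section \<open>Traces and their cyclic invariance\<close>

lemma ftrace_le:
  assumes "fshape m n A" "m \<le> N \<or> n \<le> N"
  shows "ftrace A = (\<Sum>i<N. entry A i i)"
  unfolding ftrace_def using assms
  by (intro sum.mono_neutral_left) (auto simp: fshape_def, (meson le_trans linorder_le_less_linear)+)

lemma ftrace_eq: "fshape n n A \<Longrightarrow> ftrace A = (\<Sum>i<n. entry A i i)"
  by (rule ftrace_le) auto

lemma ftrace_add [simp]: "ftrace (A + B) = ftrace A + ftrace B"
proof -
  obtain N where N: "fshape N N A" "fshape N N B" using fshape_ex2 by blast
  then have "fshape N N (A + B)" by (intro fshape_intros)
  with N show ?thesis by (simp add: ftrace_eq[of N] sum.distrib)
qed

lemma ftrace_fscale [simp]: "ftrace (fscale c A) = c * ftrace A"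
proof -
  obtain N where N: "fshape N N A" using fshape_ex by blast
  then have "fshape N N (fscale c A)" by (intro fshape_intros)
  with N show ?thesis by (simp add: ftrace_eq[of N] sum_distrib_left)
qed

lemma ftrace_zero [simp]: "ftrace 0 = 0"
  by (simp add: ftrace_def)

lemma ftrace_uminus [simp]: "ftrace (- A) = - ftrace A"
  by (simp add: ftrace_def sum_negf)

lemma ftrace_diff [simp]: "ftrace (A - B) = ftrace A - ftrace B"
  using ftrace_add[of A "- B"] by simp

lemma ftrace_sum [simp]: "ftrace (sum f S) = (\<Sum>x\<in>S. ftrace (f x))"
  by (induction S rule: infinite_finite_induct) auto

lemma ftrace_ftr [simp]: "ftrace (ftr A) = ftrace A"
  by (simp add: ftrace_def)

lemma ftrace_fidm [simp]: "ftrace (fidm n) = of_nat n"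
  by (simp add: ftrace_eq[of n])

lemma ftrace_mult_entries:
  assumes "fshape n m A"
  shows "ftrace (A * B) = (\<Sum>i<n. \<Sum>j<m. entry A i j * entry B j i)"
proof -
  obtain N where N: "fshape N N B" using fshape_ex by blast
  have "fshape n N (A * B)" using assms N by (rule fshape_times)
  then have "ftrace (A * B) = (\<Sum>i<n. entry (A * B) i i)" by (rule ftrace_le) simp
  then show ?thesis by (simp add: entry_times[OF assms])
qed

lemma ftrace_comm: "ftrace (A * B) = ftrace (B * A)"
proof -
  obtain N where N: "fshape N N A" "fshape N N B" using fshape_ex2 by blast
  then show ?thesis
    unfolding ftrace_mult_entries[OF N(1)] ftrace_mult_entries[OF N(2)]
    by (subst sum.swap) (simp add: mult.commute)
qed

section \<open>Determinants\<close>

lemma det_fun_det: "det_fun n f = Determinant.det (Matrix.mat n n (\<lambda>(i, j). f i j))"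
proof -
  have "p permutes {..<n} \<Longrightarrow> i < n \<Longrightarrow> p i < n" for p i
    using permutes_in_image[of p "{..<n}" i] by simp
  then show ?thesis
    unfolding det_fun_def Determinant.det_def by (auto simp: lessThan_atLeast0 intro!: sum.cong prod.cong)
qed

lemma det_fun_cong:
  assumes "\<And>i j. i < n \<Longrightarrow> j < n \<Longrightarrow> f i j = g i j"
  shows "det_fun n f = det_fun n g"
  unfolding det_fun_det using assms by (intro arg_cong[of _ _ Determinant.det] eq_matI) auto

lemma det_fun_mult:
  "det_fun n (\<lambda>i j. \<Sum>k<n. f i k * g k j) = det_fun n f * det_fun n g"
proof -
  have "Matrix.mat n n (\<lambda>(i, j). \<Sum>k<n. f i k * g k j)
      = Matrix.mat n n (\<lambda>(i, j). f i j) * Matrix.mat n n (\<lambda>(i, j). g i j)"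
    by (rule eq_matI) (auto simp: scalar_prod_def lessThan_atLeast0 intro!: sum.cong)
  then show ?thesis unfolding det_fun_det by (simp add: det_mult[of _ n])
qed

lemma det_fun_scale: "det_fun n (\<lambda>i j. c * f i j) = c ^ n * det_fun n f"
  unfolding det_fun_def by (simp add: prod.distrib sum_distrib_left ac_simps)

lemma fdet_mult:
  assumes "fshape n n A \<or> fshape n n B"
  shows "fdet n (A * B) = fdet n A * fdet n B"
proof -
  have "entry (A * B) = (\<lambda>i j. \<Sum>k<n. entry A i k * entry B k j)"
    using assms entry_times[of n n A] entry_times2[of n n B] by (intro ext) blast
  then show ?thesis by (simp add: fdet_def det_fun_mult)
qed

lemma fdet_ftr: "fdet n (ftr A) = fdet n A"
proof -
  have "Matrix.mat n n (\<lambda>(i, j). entry A j i) = transpose_mat (Matrix.mat n n (\<lambda>(i, j). entry A i j))"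
    by (rule eq_matI) auto
  moreover have "Determinant.det (transpose_mat (Matrix.mat n n (\<lambda>(i, j). entry A i j)))
      = Determinant.det (Matrix.mat n n (\<lambda>(i, j). entry A i j))"
    by (rule Determinant.det_transpose[of _ n]) simp
  ultimately show ?thesis by (simp add: fdet_def det_fun_det)
qed

lemma fdet_lower_unitriangular:
  assumes "\<And>i. i < n \<Longrightarrow> entry A i i = 1" "\<And>i j. i < j \<Longrightarrow> j < n \<Longrightarrow> entry A i j = 0"
  shows "fdet n A = 1"
proof -
  have "Determinant.det (Matrix.mat n n (\<lambda>(i, j). entry A i j)) = prod_list (diag_mat (Matrix.mat n n (\<lambda>(i, j). entry A i j)))"
    by (rule Determinant.det_lower_triangular[of n]) (use assms in auto)
  also have "\<dots> = 1" using assms by (simp add: prod_list_diag_prod)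
  finally show ?thesis by (simp add: fdet_def det_fun_det)
qed

lemma fdet_fidm [simp]: "fdet n (fidm n) = 1"
  by (rule fdet_lower_unitriangular) auto

lemma fdet_fidm_less:
  assumes "m < n"
  shows "fdet n (fidm m :: 'a::comm_ring_1 fmat) = 0"
proof -
  have "(\<Prod>i<n. entry (fidm m :: 'a fmat) i (p i)) = 0" for p
    using assms
    by (intro prod_zero) (auto intro!: bexI[of _ m])
  then show ?thesis unfolding fdet_def det_fun_def by (simp del: entry_fidm)
qed

lemma fdet_fscale: "fdet n (fscale c A) = c ^ n * fdet n A"
  using det_fun_scale[of n c "entry A"] by (simp add: fdet_def cong: det_fun_cong)

text \<open>If \<open>m < k\<close>, then \<open>X\<close>, seen as a square matrix of size
  \<open>k\<close>, absorbs the singular matrix \<open>fidm m\<close> and has determinant 0, against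
  \<open>X * Y = fidm k\<close>. This is the invariance of dimension; it bounds every maximality
  argument on ranks and identifies dimensions below.\<close>

lemma fidm_factor_le:
  assumes "X * Y = fidm k" "fshape k m X"
  shows "k \<le> m"
proof (rule ccontr)
  assume *: "\<not> k \<le> m"
  then have "X = X * fidm m" "fshape k k X" using assms fshape_mono[of k m X k k] by (auto simp: fshape_iff)
  then have "fdet k X = fdet k X * fdet k (fidm m)" using fdet_mult by metis
  then have "fdet k X = 0" using * fdet_fidm_less[of m k] by (metis mult_zero_right not_le)
  moreover have "fdet k X * fdet k Y = 1" using \<open>fshape k k X\<close> assms(1) fdet_mult fdet_fidm by metis
  ultimately show False by simp
qed

text \<open>The block row (0 | 1) with \<open>a\<close> zero columns. Sandwiching a matrix of size
  \<open>b\<close> between its transpose and itself places that matrix as the lower right block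
  behind the first \<open>a\<close> coordinates.\<close>

definition fshift :: "nat \<Rightarrow> nat \<Rightarrow> 'a::comm_ring_1 fmat" where
  "fshift a b = fmat_of b (a + b) (\<lambda>i j. if j = a + i then 1 else 0)"

lemma entry_fshift: "entry (fshift a b) i j = (if i < b \<and> j = a + i then 1 else 0)"
  by (auto simp: fshift_def)

lemma fshape_fshift: "fshape b (a + b) (fshift a b)"
  by (simp add: fshift_def)

lemma entry_times_fshift:
  "entry (X * fshift a b) i j = (if a \<le> j \<and> j < a + b then entry X i (j - a) else 0)"
proof -
  have S: "entry (fshift a b) i j = (if i = j - a then if a \<le> j \<and> j < a + b then 1 else 0 else 0)" for i j
    unfolding fshift_def by auto
  show ?thesis
    unfolding entry_times2[OF fshape_fshift] S
    by (auto simp: if_distrib[of "\<lambda>x. _ * x"] cong: if_cong)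
qed

lemma entry_ftr_fshift_times:
  "entry (ftr (fshift a b) * X) i j = (if a \<le> i \<and> i < a + b then entry X (i - a) j else 0)"
  using entry_times_fshift[of "ftr X" a b j i] by (metis entry_ftr ftr_simps(1) ftr_times)

lemma fshift_simps:
  "fshift a b * ftr (fshift a b) = fidm b" "ftr (fshift a b) * fshift a b = fidm (a + b) - fidm a"
  "fshift a b * fidm a = 0" "fidm a * ftr (fshift a b) = 0"
proof -
  have "entry (fshift a b * ftr (fshift a b)) i j = entry (fidm b) i j" for i j
    unfolding entry_times[OF fshape_fshift]
    by (simp add: fshift_def if_distrib[of "\<lambda>x. x * _"] if_distrib[of "\<lambda>x. _ * x"] cong: if_cong)
  then show "fshift a b * ftr (fshift a b) = fidm b" by (rule fmat_eqI)
  show "ftr (fshift a b) * fshift a b = fidm (a + b) - fidm a"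
    by (rule fmat_eqI) (auto simp: entry_times_fshift entry_fshift)
  show "fshift a b * fidm a = 0" "fidm a * ftr (fshift a b) = 0"
    by (rule fmat_eqI, simp add: entry_times_fidm entry_fidm_times fshift_def)+
qed

lemma fdet_block_diag:
  fixes A B :: "'a::idom fmat"
  assumes "fshape a a A"
  shows "fdet (a + b) (A + ftr (fshift a b) * B * fshift a b) = fdet a A * fdet b B"
proof -
  have "Matrix.mat (a + b) (a + b) (\<lambda>(i, j). entry (A + ftr (fshift a b) * B * fshift a b) i j)
      = four_block_mat (Matrix.mat a a (\<lambda>(i, j). entry A i j)) (0\<^sub>m a b) (0\<^sub>m b a)
          (Matrix.mat b b (\<lambda>(i, j). entry B i j))"
    using assms by (intro eq_matI) (auto simp: entry_times_fshift entry_ftr_fshift_times fshape_def)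
  then show ?thesis
    unfolding fdet_def det_fun_det
    by (simp add: det_four_block_mat_lower_left_zero[of _ a _ b] del: entry_plus)
qed

section \<open>Rank factorization and symplectic bases\<close>

lemma fidm_0 [simp]: "fidm 0 = 0"
  by (rule fmat_eqI) simp

lemma fidm_idem [simp]: "fidm n * fidm n = fidm n"
  by (rule fshapeD(1)[OF fshape_fidm])

lemma funit_times: "entry (funit a b * M) i j = (if i = a then entry M b j else 0)"
  for M :: "'a::comm_ring_1 fmat"
proof -
  have "fshape (Suc a) (Suc b) (funit a b :: 'a fmat)" by (rule fshape_intros) auto
  from entry_times[OF this, of M i j] show ?thesis
    by (simp add: if_distrib[of "\<lambda>x. x * _"] cong: if_cong)
qed

lemma times_funit: "entry (M * funit a b) i j = (if j = b then entry M i a else 0)"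
  using funit_times[of b a "ftr M" j i] by (metis entry_ftr ftr_simps(1,9) ftr_times)

lemma funit_times_funit: "funit a b * M * funit c d = fscale (entry M b c) (funit a d)"
  by (rule fmat_eqI) (simp add: funit_times times_funit)

lemma fidm_Suc: "fidm (Suc k) = fidm k + funit k k"
  by (rule fmat_eqI) auto

lemma fmat_nonzeroE:
  assumes "A \<noteq> 0"
  obtains a b where "entry A a b \<noteq> 0"
  using assms by (auto simp: fmat_eq_iff)

text \<open>Choose \<open>X\<close>, \<open>Y\<close> with \<open>X * A * Y = fidm k\<close> and
  \<open>k\<close> maximal. A remainder \<open>A - A * Y * X * A\<close> with a nonzero entry would
  allow one more row and column, so it vanishes. In particular \<open>Y * X\<close> is a generalized
  inverse of \<open>A\<close>.\<close>

lemma rank_factorization: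
  fixes A :: "'a::field fmat"
  assumes A: "fshape m n A"
  obtains k X Y where "fshape k m X" "fshape n k Y" "X * A * Y = fidm k" "A * Y * X * A = A" "k \<le> m"
proof -
  define P where "P k \<longleftrightarrow> (\<exists>X Y. fshape k m X \<and> fshape n k Y \<and> X * A * Y = fidm k)" for k
  have P0: "P 0" unfolding P_def by (rule exI[of _ 0], rule exI[of _ 0]) (simp add: fshape_intros)
  have bound: "k \<le> m" if "P k" for k
    using that unfolding P_def by (metis fidm_factor_le mult.assoc)
  define k where "k = (GREATEST k. P k)"
  have "P k" unfolding k_def using P0 bound by (rule GreatestI_nat)
  have not: "\<not> P (Suc k)"
    using Greatest_le_nat[of P "Suc k" m] bound unfolding k_def by fastforce
  obtain X Y where X: "fshape k m X" and Y: "fshape n k Y" and XAY: "X * A * Y = fidm k"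
    using \<open>P k\<close> unfolding P_def by blast
  have sX: "fidm k * X = X" and sY: "Y * fidm k = Y" using X Y by (auto simp: fshape_iff)
  define B where "B = A - A * Y * X * A"
  have XB: "X * B = 0" using XAY sX by (simp add: B_def algebra_simps flip: mult.assoc)
  have BY: "B * Y = 0" using XAY sY by (simp add: B_def algebra_simps)
  have "B = 0"
  proof (rule ccontr)
    assume "B \<noteq> 0"
    then obtain a b where ab: "entry B a b \<noteq> 0" by (rule fmat_nonzeroE)
    have "fshape m n B"
      unfolding B_def by (rule A X Y fshape_times fshape_intros)+
    then have "a < m" "b < n" using ab by (auto simp: fshape_def not_le[symmetric])
    \<comment> \<open>The unit vectors at \<open>a\<close> and \<open>b\<close>, placed at the new
      index \<open>k\<close> and corrected by the projections 1 - A Y X and 1 - Y X A, so that they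
      do not interact with \<open>Y\<close> and \<open>X\<close>. The scalar normalizes the new
      pivot to 1.\<close>
    define x where "x = funit k a - funit k a * A * Y * X"
    define y where "y = fscale (1 / entry B a b) (funit b k - Y * X * A * funit b k)"
    have xA: "x * A = funit k a * B" by (simp add: x_def B_def algebra_simps)
    have Ay: "A * y = fscale (1 / entry B a b) (B * funit b k)"
      by (simp add: y_def B_def algebra_simps fscale_distribs)
    have "x * A * y = fscale (1 / entry B a b) (funit k a * B * funit b k)"
      unfolding xA by (simp add: y_def algebra_simps fscale_distribs) (simp add: BY flip: mult.assoc)
    also have "\<dots> = funit k k" using ab by (simp add: funit_times_funit)
    finally have 1: "x * A * y = funit k k" .
    have 2: "x * A * Y = 0" unfolding xA by (simp add: mult.assoc BY)
    have 3: "X * A * y = 0" unfolding mult.assoc Ay by (simp add: XB flip: mult.assoc)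
    have "(X + x) * A * (Y + y) = fidm (Suc k)"
      using 1 2 3 XAY by (simp add: distrib_left distrib_right fidm_Suc)
    moreover have X': "fshape (Suc k) m X" using X by (rule fshape_mono) auto
    have "fshape (Suc k) m (X + x)"
      unfolding x_def by (rule A X X' Y fshape_times fshape_intros lessI \<open>a < m\<close>)+
    moreover have Y': "fshape n (Suc k) Y" using Y by (rule fshape_mono) auto
    have "fshape n (Suc k) (Y + y)"
      unfolding y_def by (rule A X Y Y' fshape_times fshape_intros lessI \<open>b < n\<close>)+
    ultimately have "P (Suc k)" unfolding P_def by blast
    with not show False ..
  qed
  then show ?thesis using that[of k X Y] X Y XAY bound[OF \<open>P k\<close>] by (simp add: B_def)
qed

text \<open>The columns of \<open>U\<close> form a basis of the image of \<open>E\<close>, and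
  \<open>W\<close> gives the coordinates with respect to it. Both come from a rank factorization,
  compressed by \<open>E\<close>.\<close>

lemma idempotent_factorization:
  fixes E :: "'a::field fmat"
  assumes "fshape n n E" "E * E = E"
  obtains r U W where "fshape n r U" "fshape r n W" "U * W = E" "W * U = fidm r" "r \<le> n"
proof -
  obtain k X Y where *: "fshape k n X" "fshape n k Y" "X * E * Y = fidm k" "E * Y * X * E = E" "k \<le> n"
    using rank_factorization[OF assms(1)] by blast
  show ?thesis
  proof (rule that[of k "E * Y" "X * E"])
    show "fshape n k (E * Y)" "fshape k n (X * E)"
      by (rule * assms fshape_times)+
    show "X * E * (E * Y) = fidm k" using *(3) assms(2) by (metis mult.assoc)
    show "E * Y * (X * E) = E" using *(4) by (simp add: mult.assoc)
  qed (rule *)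
qed

text \<open>Cyclicity gives tr(U W) = tr(W U) = r. In characteristic 0 this number determines the
  rank, so an idempotent of trace 0 vanishes; dimension counts below take this form.\<close>

lemma trace_idempotent:
  fixes E :: "'a::field_char_0 fmat"
  assumes "fshape n n E" "E * E = E"
  obtains r where "r \<le> n" "ftrace E = of_nat r" "r = 0 \<longleftrightarrow> E = 0"
proof -
  obtain r U W where *: "fshape n r U" "fshape r n W" "U * W = E" "W * U = fidm r" "r \<le> n"
    using idempotent_factorization[OF assms] .
  have tr: "ftrace E = of_nat r" using *(3,4) ftrace_comm[of U W] by simp
  have "r = 0 \<longleftrightarrow> E = 0"
  proof
    assume "r = 0"
    then have "U = 0" using *(1) by (auto simp: fshape_def intro: fmat_eqI)
    then show "E = 0" using *(3) by simp
  next
    assume "E = 0"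
    then show "r = 0" using tr by simp
  qed
  with that tr *(5) show ?thesis by blast
qed

text \<open>The defect \<open>fidm n - A * B\<close> is idempotent, and its trace is 0 by
  cyclicity.\<close>

lemma left_inverse_imp_right_inverse:
  fixes A B :: "'a::field_char_0 fmat"
  assumes "fshape n n A" "fshape n n B" "B * A = fidm n"
  shows "A * B = fidm n"
proof -
  define E where "E = fidm n - A * B"
  have "A * B * (A * B) = A * B" using assms by (metis mult.assoc fshapeD(2))
  then have "E * E = E" using assms unfolding E_def
    by (simp add: algebra_simps) (metis fshapeD mult.assoc fshape_fidm diff_self)
  moreover have "fshape n n E" unfolding E_def by (rule assms fshape_fidm fshape_times fshape_intros)+
  ultimately obtain r where "ftrace E = of_nat r" "r = 0 \<longleftrightarrow> E = 0"
    using trace_idempotent by metis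
  moreover have "ftrace E = 0" using assms(3) by (simp add: E_def ftrace_comm[of A B])
  ultimately show ?thesis by (simp add: E_def)
qed

text \<open>The standard symplectic form is the sum of the hyperbolic planes spanned by the basis vectors
  \<open>2 i\<close> and \<open>2 i + 1\<close>; written as \<open>b - a\<close> with \<open>a = ftr b\<close>, it equals \<open>(1 - a) (1 + b) (1 - a)\<close>.\<close>

definition symp_upper :: "nat \<Rightarrow> 'a::comm_ring_1 fmat" where
  "symp_upper k = (\<Sum>i<k. funit (2 * i) (2 * i + 1))"

definition symp_form :: "nat \<Rightarrow> 'a::comm_ring_1 fmat" where
  "symp_form k = symp_upper k - ftr (symp_upper k)"

lemma entry_symp_upper:
  "entry (symp_upper k) i j = (if even i \<and> j = i + 1 \<and> i < 2 * k then 1 else 0)"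
proof -
  have "entry (symp_upper k :: 'a fmat) i j
      = (\<Sum>l<k. if l = i div 2 then if even i \<and> j = i + 1 then 1 else 0 else 0)"
    unfolding symp_upper_def entry_sum entry_funit by (intro sum.cong refl) (auto elim: evenE)
  then show ?thesis by auto
qed

lemma fshape_symp_upper: "fshape (2 * k) (2 * k) (symp_upper k)"
  unfolding fshape_def entry_symp_upper by (auto; presburger)

lemma fshape_symp_form: "fshape (2 * k) (2 * k) (symp_form k)"
  unfolding symp_form_def by (intro fshape_intros fshape_symp_upper)

lemma entry_symp_upper_times:
  "entry (symp_upper k * A) i j = (if even i \<and> i < 2 * k then entry A (i + 1) j else 0)"
proof -
  have "entry (symp_upper k * A) i j
      = (\<Sum>l<2 * k. if l = i + 1 then if even i \<and> i < 2 * k then entry A (i + 1) j else 0 else 0)"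
    unfolding entry_times[OF fshape_symp_upper] entry_symp_upper by (intro sum.cong refl) auto
  moreover have "even i \<Longrightarrow> i < 2 * k \<Longrightarrow> i + 1 < 2 * k" by presburger
  ultimately show ?thesis by auto
qed

lemma entry_ftr_symp_upper_times:
  "entry (ftr (symp_upper k) * A) i j = (if odd i \<and> i < 2 * k then entry A (i - 1) j else 0)"
  for A :: "'a::comm_ring_1 fmat"
proof -
  have s: "fshape (2 * k) (2 * k) (ftr (symp_upper k) :: 'a fmat)"
    by (intro fshape_intros fshape_symp_upper)
  have eq: "(even l \<and> i = l + 1 \<and> l < 2 * k) = (l = i - 1 \<and> odd i \<and> i < 2 * k)" for l by presburger
  have "entry (ftr (symp_upper k) * A) i j
      = (\<Sum>l<2 * k. if l = i - 1 then if odd i \<and> i < 2 * k then entry A (i - 1) j else 0 else 0)"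
    unfolding entry_times[OF s] entry_ftr entry_symp_upper eq by (intro sum.cong refl) simp
  then show ?thesis by auto
qed

lemma symp_form_square: "symp_form k * symp_form k = - fidm (2 * k)"
proof (rule fmat_eqI)
  fix i j
  show "entry (symp_form k * symp_form k) i j = entry (- fidm (2 * k)) i j"
    by (auto simp: symp_form_def algebra_simps entry_symp_upper_times entry_ftr_symp_upper_times
         entry_symp_upper; presburger)
qed

lemma fdet_symp_form: "fdet (2 * k) (symp_form k) = 1"
proof -
  define b :: "'a fmat" where "b = symp_upper k"
  define I :: "'a fmat" where "I = fidm (2 * k)"
  have s: "fshape (2 * k) (2 * k) b" "fshape (2 * k) (2 * k) (ftr b)"
    unfolding b_def by (intro fshape_intros fshape_symp_upper)+
  then have I: "I * b = b" "b * I = b" "I * ftr b = ftr b" "ftr b * I = ftr b" "I * I = I"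
    unfolding I_def by (auto simp: fshapeD)
  have bb: "b * b = 0" "ftr b * ftr b = 0" "b * ftr b + ftr b * b = I"
    unfolding b_def I_def
    by (rule fmat_eqI; auto simp: entry_symp_upper_times entry_ftr_symp_upper_times
        entry_symp_upper; presburger)+
  have aba: "ftr b * b * ftr b = ftr b"
    using arg_cong[OF bb(3), of "\<lambda>x. ftr b * x"] bb(2) I by (simp add: distrib_left mult.assoc[symmetric])
  have "(I - ftr b) * (I + b) * (I - ftr b) = I - (b * ftr b + ftr b * b) + b - ftr b"
  proof -
    have "I * (b * x) = b * x" "I * (ftr b * x) = ftr b * x" for x
      using I by (simp_all flip: mult.assoc)
    then show ?thesis using aba bb(1,2) I by (simp add: algebra_simps)
  qed
  then have J: "symp_form k = (I - ftr b) * (I + b) * (I - ftr b)"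
    using bb(3) by (simp add: symp_form_def b_def)
  \<comment> \<open>\<open>b\<close> is strictly upper and \<open>ftr b\<close> strictly lower
    triangular, so all three factors have determinant 1.\<close>
  have "fdet (2 * k) (I - ftr b) = 1"
    unfolding I_def b_def by (rule fdet_lower_unitriangular) (auto simp: entry_symp_upper)
  moreover have "fdet (2 * k) (ftr (I + b)) = 1"
    unfolding I_def b_def by (rule fdet_lower_unitriangular) (auto simp: entry_symp_upper)
  moreover have "fshape (2 * k) (2 * k) (I - ftr b)" "fshape (2 * k) (2 * k) (I + b)"
    unfolding I_def by (intro fshape_intros fshape_fidm s)+
  ultimately show ?thesis unfolding J by (simp add: fdet_mult fdet_ftr del: ftr_simps)
qed

lemma ftr_symp_form: "ftr (symp_form k) = - symp_form k"
  by (simp add: symp_form_def)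

lemma symp_form_Suc:
  "symp_form (Suc k) = symp_form k + (funit (2 * k) (2 * k + 1) - funit (2 * k + 1) (2 * k))"
  by (simp add: symp_form_def symp_upper_def)

text \<open>Take a partial symplectic basis \<open>V\<close> with as many hyperbolic planes as
  possible. If the form did not vanish on the orthogonal complement, another plane could be split
  off; so \<open>V\<close> spans the whole space, and its determinant is, up to inversion, the
  required square root (a Pfaffian).\<close>

lemma fdet_antisymmetric:
  fixes A :: "'a::field_char_0 fmat"
  assumes A: "fshape r r A" and anti: "ftr A = - A" and inv: "B * A = fidm r"
  obtains c where "even r" "c \<noteq> 0" "fdet r A = c\<^sup>2"
proof -
  define P where "P k \<longleftrightarrow> (\<exists>V. fshape r (2 * k) V \<and> ftr V * A * V = symp_form k)" for k
  have P0: "P 0"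
    unfolding P_def by (rule exI[of _ 0]) (simp add: symp_form_def symp_upper_def fshape_intros)
  have bound: "2 * k \<le> r" if P: "P k" for k
  proof -
    obtain V where V: "fshape r (2 * k) V" "ftr V * A * V = symp_form k"
      using P unfolding P_def by blast
    have "ftr V * (A * V * (- symp_form k)) = ftr V * A * V * (- symp_form k)"
      by (simp add: mult.assoc)
    also have "\<dots> = fidm (2 * k)" by (simp add: V(2) symp_form_square)
    finally show ?thesis by (rule fidm_factor_le) (rule fshape_intros V)+
  qed
  define k where "k = (GREATEST k. P k)"
  have bound': "P l \<Longrightarrow> l \<le> r" for l using bound[of l] by simp
  have "P k" unfolding k_def using P0 bound' by (rule GreatestI_nat)
  have not: "\<not> P (Suc k)"
    using Greatest_le_nat[of P "Suc k" r] bound' unfolding k_def by fastforce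
  obtain V where V: "fshape r (2 * k) V" and VAV: "ftr V * A * V = symp_form k"
    using \<open>P k\<close> unfolding P_def by blast
  define J :: "'a fmat" where "J = symp_form k"
  have J: "fshape (2 * k) (2 * k) J" "ftr J = - J" "J * J = - fidm (2 * k)"
    unfolding J_def by (rule fshape_symp_form ftr_symp_form symp_form_square)+
  have VI: "fidm (2 * k) * ftr V = ftr V" "fidm (2 * k) * (ftr V * x) = ftr V * x" for x
  proof -
    have "fshape (2 * k) r (ftr V)" using V by (rule fshape_intros)
    then show "fidm (2 * k) * ftr V = ftr V" by (rule fshapeD)
    then show "fidm (2 * k) * (ftr V * x) = ftr V * x" by (simp flip: mult.assoc)
  qed
  \<comment> \<open>Since J^2 = -1, the operator 1 + V J V^T A projects onto the orthogonal
    complement of the columns of \<open>V\<close>. \<open>C\<close> is the form composed with this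
    projection.\<close>
  define C where "C = A + A * V * J * ftr V * A"
  have anti_C: "ftr C = - C" by (simp add: C_def anti J(2) mult.assoc)
  have VC: "ftr V * C = 0"
  proof -
    have "ftr V * C = ftr V * A + (ftr V * A * V) * J * (ftr V * A)"
      by (simp add: C_def algebra_simps)
    also have "\<dots> = ftr V * A + J * J * (ftr V * A)" by (simp only: VAV J_def)
    also have "\<dots> = 0" by (simp add: J(3) VI)
    finally show ?thesis .
  qed
  have "C = 0"
  proof (rule ccontr)
    assume "C \<noteq> 0"
    then obtain a b where ab: "entry C a b \<noteq> 0" by (rule fmat_nonzeroE)
    have eC: "entry C j i = - entry C i j" for i j
      using anti_C by (metis entry_ftr entry_uminus)
    \<comment> \<open>Antisymmetric implies alternating, because 2 is invertible.\<close>
    have eC0: "entry C i i = 0" for i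
    proof -
      have "2 * entry C i i = 0" using eC[of i i] by (metis add.right_inverse mult_2)
      then show ?thesis by simp
    qed
    have "fshape r r C"
      unfolding C_def by (rule A V J fshape_times fshape_intros)+
    then have "a < r" "b < r" using ab by (auto simp: fshape_def not_le[symmetric])
    \<comment> \<open>A hyperbolic pair for \<open>C\<close>: the unit vectors at \<open>a\<close>
      and \<open>b\<close>, the second scaled to give pairing 1, in the two new columns
      \<open>2 * k\<close> and \<open>2 * k + 1\<close>. The matrix \<open>v\<close> is their
      projection to the orthogonal complement of \<open>V\<close>.\<close>
    define z where "z = funit a (2 * k) + fscale (1 / entry C a b) (funit b (2 * k + 1))"
    define v where "v = z + V * J * ftr V * A * z"
    have Av: "A * v = C * z" by (simp add: v_def C_def algebra_simps)
    have VAv: "ftr V * A * v = 0" unfolding mult.assoc Av by (simp add: VC flip: mult.assoc)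
    have vAV: "ftr v * A * V = 0"
      using arg_cong[OF VAv, of ftr] by (simp add: anti mult.assoc)
    have "ftr v * A * v = ftr z * C * z + ftr z * A * V * J * (ftr V * C) * z"
      unfolding mult.assoc Av by (simp add: v_def algebra_simps anti J(2))
    also have "\<dots> = ftr z * C * z" by (simp add: VC)
    also have "\<dots> = funit (2 * k) (2 * k + 1) - funit (2 * k + 1) (2 * k)"
      using ab by (simp add: z_def distrib_left distrib_right left_diff_distrib right_diff_distrib
          funit_times_funit eC0 eC[of b a] fscale_distribs)
    finally have "ftr (V + v) * A * (V + v) = symp_form (Suc k)"
      using VAV VAv vAV by (simp add: distrib_left distrib_right symp_form_Suc)
    moreover have V': "fshape r (2 * Suc k) V" using V by (rule fshape_mono) auto
    have z: "fshape r (2 * Suc k) z"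
      unfolding z_def by (intro fshape_intros \<open>a < r\<close> \<open>b < r\<close>) auto
    have "fshape r (2 * Suc k) (V + v)"
      unfolding v_def by (rule A V V' J z fshape_times fshape_intros)+
    ultimately have "P (Suc k)" unfolding P_def by blast
    with not show False ..
  qed
  \<comment> \<open>With \<open>C = 0\<close>, cancelling \<open>A\<close> by its left inverse
    writes the identity of size \<open>r\<close> as a product through \<open>2 * k\<close> columns;
    hence \<open>r \<le> 2 * k\<close>.\<close>
  then have "B * C = 0" by simp
  then have "B * A + B * A * V * J * ftr V * A = 0"
    by (simp only: C_def distrib_left mult.assoc)
  then have "fidm r + fidm r * V * J * ftr V * A = 0" by (simp only: inv)
  then have "fidm r = V * (- J * ftr V * A)"
    by (simp add: fshapeD(1)[OF V] eq_neg_iff_add_eq_0 mult.assoc)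
  from this[symmetric] have "r \<le> 2 * k" using V by (rule fidm_factor_le)
  then have r: "r = 2 * k" using bound[OF \<open>P k\<close>] by simp
  have V': "fshape r r V" using V r by simp
  have "fdet r V * fdet r A * fdet r V = fdet r (ftr V * A * V)"
    using V' A by (simp add: fdet_mult fdet_ftr mult.commute)
  also have "\<dots> = 1" by (simp add: VAV r fdet_symp_form)
  finally have *: "fdet r V * fdet r A * fdet r V = 1" .
  then have "fdet r V \<noteq> 0" by auto
  then have "fdet r A = (1 / fdet r V)\<^sup>2" using * by (simp add: field_simps power2_eq_square)
  with that[of "1 / fdet r V"] \<open>fdet r V \<noteq> 0\<close> r show ?thesis by simp
qed

text \<open>A version of \<open>trace_idempotent\<close> for kernels on an arbitrary finite index
  set. It is applied to a projection acting on a space of matrices, where the indices are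
  pairs.\<close>

lemma trace_idempotent_kernel:
  fixes T :: "'i \<Rightarrow> 'i \<Rightarrow> 'a::field_char_0"
  assumes fin: "finite S"
    and idem: "\<And>x z. x \<in> S \<Longrightarrow> z \<in> S \<Longrightarrow> (\<Sum>y\<in>S. T x y * T y z) = T x z"
    and tr: "(\<Sum>x\<in>S. T x x) = 0"
    and "x \<in> S" "y \<in> S"
  shows "T x y = 0"
proof -
  obtain h where h: "bij_betw h {..<card S} S"
    using ex_bij_betw_nat_finite[OF fin] by (auto simp: lessThan_atLeast0)
  define E where "E = fmat_of (card S) (card S) (\<lambda>i j. T (h i) (h j))"
  have E: "fshape (card S) (card S) E" unfolding E_def by simp
  have hS: "i < card S \<Longrightarrow> h i \<in> S" for i using h by (auto simp: bij_betw_def)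
  have "E * E = E"
  proof (rule fmat_eqI)
    fix i j
    have "(\<Sum>k<card S. T (h i) (h k) * T (h k) (h j)) = T (h i) (h j)"
      if "i < card S" "j < card S"
      using sum.reindex_bij_betw[OF h, of "\<lambda>y. T (h i) y * T y (h j)"] idem hS that by simp
    then show "entry (E * E) i j = entry E i j"
      unfolding entry_times[OF E] by (auto simp: E_def)
  qed
  moreover have "ftrace E = 0"
    unfolding ftrace_eq[OF E] using sum.reindex_bij_betw[OF h, of "\<lambda>x. T x x"] tr
    by (simp add: E_def)
  ultimately have "E = 0" using trace_idempotent[OF E] by (metis of_nat_eq_0_iff)
  obtain i j where ij: "i < card S" "h i = x" "j < card S" "h j = y"
    using h assms(4,5) unfolding bij_betw_def by (metis imageE lessThan_iff)
  then have "entry E i j = T x y" by (simp add: E_def)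
  with \<open>E = 0\<close> show ?thesis by simp
qed

section \<open>Power sums determine determinants\<close>

lemma fps_deriv_prod:
  fixes f :: "'b \<Rightarrow> 'a::comm_ring_1 fps"
  assumes "finite S"
  shows "fps_deriv (\<Prod>i\<in>S. f i) = (\<Sum>a\<in>S. \<Prod>i\<in>S. if i = a then fps_deriv (f i) else f i)"
  using assms
proof (induction S)
  case (insert x S)
  have "(\<Sum>a\<in>S. \<Prod>i\<in>insert x S. if i = a then fps_deriv (f i) else f i)
      = f x * (\<Sum>a\<in>S. \<Prod>i\<in>S. if i = a then fps_deriv (f i) else f i)"
    unfolding sum_distrib_left using insert by (intro sum.cong refl) auto
  moreover have "(\<Prod>i\<in>S. if i = x then fps_deriv (f i) else f i) = (\<Prod>i\<in>S. f i)"
    using insert by (intro prod.cong) auto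
  ultimately show ?case using insert by (simp add: add.commute)
qed simp

lemma fps_deriv_det_fun:
  fixes M :: "nat \<Rightarrow> nat \<Rightarrow> 'a::comm_ring_1 fps"
  shows "fps_deriv (det_fun n M)
       = (\<Sum>a<n. det_fun n (\<lambda>i j. if i = a then fps_deriv (M i j) else M i j))"
proof -
  have "fps_deriv (of_int c * f) = of_int c * fps_deriv f" for c and f :: "'a fps"
    by (simp add: fps_deriv_of_int)
  then show ?thesis
    unfolding det_fun_def
    by (simp add: fps_deriv_sum fps_deriv_prod sum_distrib_left)
       (subst sum.swap, simp add: if_distrib cong: if_cong)
qed

text \<open>A permutation other than the identity moves some index other than \<open>a\<close>,
  where the row is a unit vector and the factor is 0.\<close>

lemma det_fun_identity_row:
  assumes "a < n"
  shows "det_fun n (\<lambda>i l. if i = a then d l else if i = l then 1 else 0) = d a"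
proof -
  let ?f = "\<lambda>i l. if i = a then d l else if i = l then 1 else 0"
  let ?t = "\<lambda>p. of_int (sign p) * (\<Prod>i<n. ?f i (p i))"
  have "?t p = 0" if p: "p permutes {..<n}" "p \<noteq> id" for p
  proof -
    have "\<exists>i<n. i \<noteq> a \<and> p i \<noteq> i"
    proof (rule ccontr)
      assume "\<not> ?thesis"
      then have *: "p i = i" if "i \<noteq> a" for i using that p(1) by (cases "i < n") (auto simp: permutes_def)
      have "p (p a) = p a" if "p a \<noteq> a" using * that by blast
      then have "p a = a" using permutes_inj[OF p(1)] by (auto dest: injD)
      with * have "p = id" by (metis eq_id_iff)
      with p show False by simp
    qed
    then obtain i where "i < n" "i \<noteq> a" "p i \<noteq> i" by blast
    then have "(\<Prod>i<n. ?f i (p i)) = 0" by (intro prod_zero) (auto intro!: bexI[of _ i])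
    then show ?thesis by simp
  qed
  then have "det_fun n ?f = (\<Sum>p\<in>{id}. ?t p)"
    unfolding det_fun_def
    by (intro sum.mono_neutral_right) (auto simp: finite_permutations permutes_id)
  also have "\<dots> = (\<Prod>i<n. ?f i i)" by (simp, intro prod.cong) auto
  also have "\<dots> = (\<Prod>i<n. if i = a then d a else 1)" by (intro prod.cong) auto
  also have "\<dots> = d a" using assms by simp
  finally show ?thesis .
qed

text \<open>The replacement is multiplication from the left by the matrix that is the identity
  outside row \<open>a\<close> and has \<open>d\<close> as row \<open>a\<close>.\<close>

lemma det_fun_replace_row:
  assumes "a < n"
  shows "det_fun n (\<lambda>i j. if i = a then \<Sum>l<n. d l * M l j else M i j) = d a * det_fun n M"
proof -
  have "det_fun n (\<lambda>i j. if i = a then \<Sum>l<n. d l * M l j else M i j)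
      = det_fun n (\<lambda>i j. \<Sum>l<n. (if i = a then d l else if i = l then 1 else 0) * M l j)"
    by (rule det_fun_cong) (auto simp: if_distrib[of "\<lambda>x. x * _"] cong: if_cong)
  then show ?thesis using assms by (simp add: det_fun_mult det_fun_identity_row)
qed

section \<open>The logarithmic derivative of det(1 + x C)\<close>

context comm_ring_hom
begin

lemma hom_det_fun: "hom (det_fun n f) = det_fun n (\<lambda>i j. hom (f i j))"
  unfolding det_fun_def by (simp add: hom_distribs)

end

primrec fpow :: "nat \<Rightarrow> 'a::comm_ring_1 fmat \<Rightarrow> nat \<Rightarrow> 'a fmat" where
  "fpow n A 0 = fidm n"
| "fpow n A (Suc k) = A * fpow n A k"

lemma fpow_Suc_right: "fshape n n A \<Longrightarrow> fpow n A (Suc k) = fpow n A k * A"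
  by (induction k) (auto simp: fshape_iff, metis mult.assoc)

lemma fshape_fpow: "fshape n n A \<Longrightarrow> fshape n n (fpow n A k)"
  by (induction k) (auto intro: fshape_times)

definition det_poly :: "nat \<Rightarrow> 'a::comm_ring_1 fmat \<Rightarrow> 'a poly" where
  "det_poly n C = det_fun n (\<lambda>i j. [:entry (fidm n) i j, entry C i j:])"

text \<open>The expansion of tr(C (1 + x C)^(-1)).\<close>

definition log_deriv :: "nat \<Rightarrow> 'a::comm_ring_1 fmat \<Rightarrow> 'a fps" where
  "log_deriv n C = Abs_fps (\<lambda>k. (- 1) ^ k * ftrace (fpow n C (Suc k)))"

lemma poly_det_poly: "poly (det_poly n C) x = fdet n (fidm n + fscale x C)"
proof -
  interpret comm_ring_hom "\<lambda>p. poly p x" by unfold_locales auto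
  show ?thesis unfolding det_poly_def hom_det_fun fdet_def
    by (intro det_fun_cong) simp
qed

lemma fps_of_det_poly:
  "fps_of_poly (det_poly n C)
   = det_fun n (\<lambda>i j. fps_const (entry (fidm n) i j) + fps_X * fps_const (entry C i j))"
proof -
  interpret comm_ring_hom "fps_of_poly :: 'a poly \<Rightarrow> 'a fps"
    by unfold_locales (auto simp: fps_of_poly_add fps_of_poly_mult)
  show ?thesis unfolding det_poly_def hom_det_fun
    by (intro det_fun_cong) (simp add: fps_of_poly_pCons mult.commute)
qed

text \<open>Jacobi's formula for M = 1 + x C. With D = C (1 + x C)^(-1) as a matrix of power series,
  M' = D M. Differentiating row \<open>a\<close> therefore replaces it by a combination of the rows
  of M with coefficients from row \<open>a\<close> of D, which multiplies the determinant by the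
  diagonal entry of D; these entries add up to the trace.\<close>

lemma fps_deriv_det_poly:
  assumes C: "fshape n n C"
  shows "fps_deriv (fps_of_poly (det_poly n C)) = fps_of_poly (det_poly n C) * log_deriv n C"
proof -
  define M where "M i j = fps_const (entry (fidm n) i j) + fps_X * fps_const (entry C i j)" for i j
  define D where "D i l = Abs_fps (\<lambda>k. (- 1) ^ k * entry (fpow n C (Suc k)) i l)" for i l
  \<comment> \<open>The coefficients of D (1 + x C) telescope: in degree \<open>k > 0\<close> the
    contributions of C^(k+1) cancel, and in degree 0 only \<open>C\<close> is left.\<close>
  have DM: "fps_deriv (M i j) = (\<Sum>l<n. D i l * M l j)" if "i < n" "j < n" for i j
  proof (rule fps_ext)
    fix k
    have "fps_nth (\<Sum>l<n. D i l * M l j) k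
        = (\<Sum>l<n. fps_nth (D i l) k * entry (fidm n) l j) + (\<Sum>l<n. if k = 0 then 0 else fps_nth (D i l) (k - 1) * entry C l j)"
      unfolding M_def fps_sum_nth sum.distrib[symmetric]
      by (intro sum.cong refl) (simp add: distrib_left mult.left_commute[of _ fps_X])
    also have "(\<Sum>l<n. fps_nth (D i l) k * entry (fidm n) l j) = fps_nth (D i j) k"
      using that by (simp add: if_distrib[of "\<lambda>x. _ * x"] cong: if_cong)
    also have "(\<Sum>l<n. if k = 0 then 0 else fps_nth (D i l) (k - 1) * entry C l j)
        = (if k = 0 then 0 else (- 1) ^ (k - 1) * entry (fpow n C k * C) i j)"
      unfolding entry_times2[OF C] by (cases k) (auto simp: D_def sum_distrib_left mult.assoc)
    also have "fps_nth (D i j) k + \<dots> = fps_nth (fps_deriv (M i j)) k"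
      using fpow_Suc_right[OF C, of k] fshapeD(2)[OF C]
      by (cases k) (auto simp: D_def M_def simp del: entry_fidm)
    finally show "fps_nth (fps_deriv (M i j)) k = fps_nth (\<Sum>l<n. D i l * M l j) k" ..
  qed
  have "fps_deriv (det_fun n M)
      = (\<Sum>a<n. det_fun n (\<lambda>i j. if i = a then \<Sum>l<n. D a l * M l j else M i j))"
    unfolding fps_deriv_det_fun by (intro sum.cong refl det_fun_cong) (auto simp: DM)
  also have "\<dots> = det_fun n M * (\<Sum>a<n. D a a)"
    by (simp add: det_fun_replace_row sum_distrib_left mult.commute)
  also have "(\<Sum>a<n. D a a) = log_deriv n C"
    by (rule fps_ext)
       (simp only: D_def log_deriv_def fps_sum_nth fps_nth_Abs_fps ftrace_eq[OF fshape_fpow[OF C]]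
          sum_distrib_left)
  finally show ?thesis unfolding fps_of_det_poly M_def .
qed

text \<open>In y' = y s the coefficient of degree m + 1 is determined by the lower ones, as m + 1 is
  invertible in characteristic 0.\<close>

lemma fps_log_deriv_unique:
  fixes y z :: "'a::field_char_0 fps"
  assumes "fps_deriv y = y * s" "fps_deriv z = z * s" "fps_nth y 0 = fps_nth z 0"
  shows "y = z"
proof (rule fps_ext)
  fix n
  show "fps_nth y n = fps_nth z n"
  proof (induction n rule: less_induct)
    case (less n)
    show ?case
    proof (cases n)
      case (Suc m)
      have "of_nat (Suc m) * fps_nth y (Suc m) = fps_nth (y * s) m" using arg_cong[OF assms(1), of "\<lambda>f. fps_nth f m"] by simp
      also have "\<dots> = fps_nth (z * s) m" unfolding fps_mult_nth using less Suc by (intro sum.cong) auto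
      also have "\<dots> = of_nat (Suc m) * fps_nth z (Suc m)"
        using arg_cong[OF assms(2), of "\<lambda>f. fps_nth f m"] by simp
      finally show ?thesis using Suc by (simp del: of_nat_Suc)
    qed (use assms(3) in simp)
  qed
qed

lemma fps_log_deriv_prod_power:
  fixes q s :: "'b \<Rightarrow> 'a::comm_ring_1 fps" and e :: "'b \<Rightarrow> nat"
  assumes "finite S" "\<And>i. i \<in> S \<Longrightarrow> fps_deriv (q i) = q i * s i"
  shows "fps_deriv (\<Prod>i\<in>S. q i ^ e i) = (\<Prod>i\<in>S. q i ^ e i) * (\<Sum>i\<in>S. of_nat (e i) * s i)"
  using assms
proof (induction S)
  case (insert x S)
  have "fps_deriv (q x ^ m) = q x ^ m * (of_nat m * s x)" for m
    using insert.prems[of x] by (induction m) (auto simp: algebra_simps)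
  then show ?case using insert by (simp add: algebra_simps)
qed simp

lemma power_int_nat_diff:
  fixes x :: "'a::field"
  shows "x powi m = x ^ nat m / x ^ nat (- m)"
  by (cases "m \<ge> 0") (auto simp: power_int_def field_simps)

text \<open>Positive and negative exponents are collected into two products of the polynomials det(1
  + x C_i). By \<open>tr\<close> these have the same logarithmic derivative, and both have constant
  term 1, so they agree; \<open>nz\<close> allows division after setting x = 1.\<close>

lemma prod_fdet_powi_eq_1:
  fixes C :: "'b \<Rightarrow> 'a::field_char_0 fmat" and m :: "'b \<Rightarrow> int"
  assumes fin: "finite S" and C: "\<And>i. i \<in> S \<Longrightarrow> fshape (r i) (r i) (C i)"
    and tr: "\<And>k. (\<Sum>i\<in>S. of_int (m i) * ftrace (fpow (r i) (C i) (Suc k))) = 0"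
    and nz: "\<And>i. i \<in> S \<Longrightarrow> fdet (r i) (fidm (r i) + C i) \<noteq> 0"
  shows "(\<Prod>i\<in>S. fdet (r i) (fidm (r i) + C i) powi m i) = 1"
proof -
  define p where "p i = det_poly (r i) (C i)" for i
  define s where "s i = log_deriv (r i) (C i)" for i
  have d: "fps_deriv (fps_of_poly (p i)) = fps_of_poly (p i) * s i" if "i \<in> S" for i
    unfolding p_def s_def using C[OF that] by (rule fps_deriv_det_poly)
  have "(\<Sum>i\<in>S. of_nat (nat (m i)) * s i) = (\<Sum>i\<in>S. of_nat (nat (- m i)) * s i)"
  proof (rule fps_ext)
    fix k
    have *: "fps_nth (\<Sum>i\<in>S. of_nat (e i) * s i) k
        = (- 1) ^ k * (\<Sum>i\<in>S. of_nat (e i) * ftrace (fpow (r i) (C i) (Suc k)))" for e :: "'b \<Rightarrow> nat"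
      by (simp add: s_def log_deriv_def fps_sum_nth sum_distrib_left ac_simps flip: fps_of_nat)
    have "(\<Sum>i\<in>S. of_nat (nat (m i)) * t i) - (\<Sum>i\<in>S. of_nat (nat (- m i)) * t i)
        = (\<Sum>i\<in>S. of_int (m i) * t i)" for t :: "'b \<Rightarrow> 'a"
    proof -
      have "(of_int (m i) :: 'a) = of_nat (nat (m i)) - of_nat (nat (- m i))" for i
        by (cases "m i \<ge> 0") auto
      then show ?thesis by (simp add: sum_subtractf left_diff_distrib)
    qed
    from this[of "\<lambda>i. ftrace (fpow (r i) (C i) (Suc k))"]
    show "fps_nth (\<Sum>i\<in>S. of_nat (nat (m i)) * s i) k = fps_nth (\<Sum>i\<in>S. of_nat (nat (- m i)) * s i) k"
      unfolding * tr by simp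
  qed
  note logs = this
  have const: "fps_nth (\<Prod>i\<in>S. fps_of_poly (p i) ^ e i) 0 = 1" for e :: "'b \<Rightarrow> nat"
  proof -
    interpret comm_ring_hom "\<lambda>f. fps_nth f 0 :: 'a" by unfold_locales auto
    have "fps_nth (fps_of_poly (p i)) 0 = 1" for i
      unfolding p_def using poly_det_poly[of "r i" "C i" 0] by (simp add: poly_0_coeff_0)
    then show ?thesis by (simp add: hom_distribs)
  qed
  have "(\<Prod>i\<in>S. fps_of_poly (p i) ^ nat (m i)) = (\<Prod>i\<in>S. fps_of_poly (p i) ^ nat (- m i))"
  proof (rule fps_log_deriv_unique)
    show "fps_deriv (\<Prod>i\<in>S. fps_of_poly (p i) ^ nat (m i))
        = (\<Prod>i\<in>S. fps_of_poly (p i) ^ nat (m i)) * (\<Sum>i\<in>S. of_nat (nat (m i)) * s i)"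
      by (rule fps_log_deriv_prod_power[OF fin d])
    show "fps_deriv (\<Prod>i\<in>S. fps_of_poly (p i) ^ nat (- m i))
        = (\<Prod>i\<in>S. fps_of_poly (p i) ^ nat (- m i)) * (\<Sum>i\<in>S. of_nat (nat (m i)) * s i)"
      unfolding logs by (rule fps_log_deriv_prod_power[OF fin d])
    show "fps_nth (\<Prod>i\<in>S. fps_of_poly (p i) ^ nat (m i)) 0
        = fps_nth (\<Prod>i\<in>S. fps_of_poly (p i) ^ nat (- m i)) 0"
      by (simp only: const)
  qed
  \<comment> \<open>The identity goes back to polynomials, which unlike formal power series can be
    evaluated at 1.\<close>
  then have "fps_of_poly (\<Prod>i\<in>S. p i ^ nat (m i)) = fps_of_poly (\<Prod>i\<in>S. p i ^ nat (- m i))"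
    by (simp only: fps_of_poly_power fps_of_poly_prod)
  then have "(\<Prod>i\<in>S. p i ^ nat (m i)) = (\<Prod>i\<in>S. p i ^ nat (- m i))"
    by (simp only: fps_of_poly_eq_iff)
  then have "poly (\<Prod>i\<in>S. p i ^ nat (m i)) 1 = poly (\<Prod>i\<in>S. p i ^ nat (- m i)) 1"
    by simp
  then have eq: "(\<Prod>i\<in>S. poly (p i) 1 ^ nat (m i)) = (\<Prod>i\<in>S. poly (p i) 1 ^ nat (- m i))"
    by (simp only: poly_power poly_prod)
  have "(\<Prod>i\<in>S. poly (p i) 1 ^ nat (- m i)) \<noteq> 0"
    using nz fin by (simp add: p_def poly_det_poly)
  with eq have "(\<Prod>i\<in>S. poly (p i) 1 powi m i) = 1"
    by (simp add: power_int_nat_diff prod_dividef)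
  then show ?thesis by (simp add: p_def poly_det_poly)
qed

section \<open>Permutation modules and class functions\<close>

text \<open>The number of fixed points is the trace of \<open>g\<close> on the permutation module,
  and isomorphic modules have equal traces. The function \<open>b\<close> is the action of the
  inverse of \<open>g\<close> on \<open>X\<close>; equivariance moves \<open>g\<close> from the row
  index of \<open>M\<close> to \<open>b\<close> on the column index.\<close>

lemma perm_modules_iso_fixed_points:
  assumes iso: "perm_modules_iso G X aX Y aY"
    and fin: "finite X" "finite Y" and g: "g \<in> carrier G"
    and X: "\<And>x. x \<in> X \<Longrightarrow> b x \<in> X" "\<And>x. x \<in> X \<Longrightarrow> aX g (b x) = x"
      "\<And>x. x \<in> X \<Longrightarrow> b (aX g x) = x"
    and Y: "\<And>y. y \<in> Y \<Longrightarrow> aY g y \<in> Y"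
  shows "card {x\<in>X. aX g x = x} = card {y\<in>Y. aY g y = y}"
proof -
  obtain M N where MN: "\<forall>y\<in>Y. \<forall>y'\<in>Y. (\<Sum>x\<in>X. M y x * N x y') = (if y = y' then 1 else 0 :: complex)"
    and NM: "\<forall>x\<in>X. \<forall>x'\<in>X. (\<Sum>y\<in>Y. N x y * M y x') = (if x = x' then 1 else 0)"
    and eq: "\<forall>g\<in>carrier G. \<forall>y\<in>Y. \<forall>x\<in>X. M (aY g y) (aX g x) = M y x"
    using iso unfolding perm_modules_iso_def by blast
  have "complex_of_nat (card {y\<in>Y. aY g y = y}) = (\<Sum>y\<in>Y. if aY g y = y then 1 else 0)"
    using fin by (simp add: sum.If_cases Int_def)
  \<comment> \<open>The entry of \<open>M N = 1\<close> at row \<open>aY g y\<close> and column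
    \<open>y\<close> is the indicator of a fixed point.\<close>
  also have "\<dots> = (\<Sum>y\<in>Y. \<Sum>x\<in>X. M (aY g y) x * N x y)"
    using MN[rule_format, OF Y] by (intro sum.cong refl) simp
  also have "\<dots> = (\<Sum>y\<in>Y. \<Sum>x\<in>X. M y (b x) * N x y)"
  proof (intro sum.cong refl)
    fix y x assume "y \<in> Y" "x \<in> X"
    then have "M (aY g y) x = M y (b x)"
      using eq[rule_format, OF g, of y "b x"] X(1,2)[of x] by metis
    then show "M (aY g y) x * N x y = M y (b x) * N x y" by (rule arg_cong)
  qed
  also have "\<dots> = (\<Sum>x\<in>X. \<Sum>y\<in>Y. N x y * M y (b x))"
    by (subst sum.swap) (simp only: mult.commute)
  also have "\<dots> = (\<Sum>x\<in>X. if aX g x = x then 1 else 0)"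
  proof (intro sum.cong refl)
    fix x assume x: "x \<in> X"
    have *: "(x = b x) = (aX g x = x)" using X(2,3)[OF x] by metis
    then show "(\<Sum>y\<in>Y. N x y * M y (b x)) = (if aX g x = x then 1 else 0)"
      using NM[rule_format, OF x X(1)[OF x]] by (simp only: *)
  qed
  also have "\<dots> = of_nat (card {x\<in>X. aX g x = x})"
    using fin by (simp add: sum.If_cases Int_def)
  finally show ?thesis by simp
qed

section \<open>Fixed points on cosets and the effect of a relation on class functions\<close>

context group
begin

lemma coset_act_mult:
  "C \<subseteq> carrier G \<Longrightarrow> g \<in> carrier G \<Longrightarrow> h \<in> carrier G \<Longrightarrow>
   coset_act G g (coset_act G h C) = coset_act G (g \<otimes> h) C"
  unfolding coset_act_def image_image by (intro image_cong) (auto simp: m_assoc)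

lemma coset_act_one: "C \<subseteq> carrier G \<Longrightarrow> coset_act G \<one> C = C"
  by (force simp: coset_act_def)

lemma left_cosets_subset: "subgroup H G \<Longrightarrow> C \<in> left_cosets G H \<Longrightarrow> C \<subseteq> carrier G"
  by (auto simp: left_cosets_def dest: subgroup.mem_carrier)

lemma left_cosets_eq: "left_cosets G H = (\<lambda>a. coset_act G a H) ` carrier G"
  by (auto simp: left_cosets_def coset_act_def)

lemma coset_act_left_cosets:
  assumes "subgroup H G" "C \<in> left_cosets G H" "g \<in> carrier G"
  shows "coset_act G g C \<in> left_cosets G H"
  using assms by (auto simp: left_cosets_eq coset_act_mult subgroup.subset)

lemma coset_act_eq_iff:
  assumes "subgroup H G" "a \<in> carrier G" "b \<in> carrier G"
  shows "coset_act G a H = coset_act G b H \<longleftrightarrow> inv b \<otimes> a \<in> H"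
proof
  have "a \<otimes> \<one> \<in> coset_act G a H"
    unfolding coset_act_def using assms by (intro imageI) (simp add: subgroup.one_closed)
  moreover assume "coset_act G a H = coset_act G b H"
  ultimately obtain h where "h \<in> H" "a = b \<otimes> h" using assms by (auto simp: coset_act_def)
  then show "inv b \<otimes> a \<in> H"
    using assms by (metis subgroup.mem_carrier inv_solve_left')
next
  assume h: "inv b \<otimes> a \<in> H"
  have "coset_act G a H = coset_act G b (coset_act G (inv b \<otimes> a) H)"
    using assms by (simp add: coset_act_mult subgroup.subset flip: m_assoc)
  also have "coset_act G (inv b \<otimes> a) H = H"
  proof
    show "coset_act G (inv b \<otimes> a) H \<subseteq> H"
      using assms h by (auto simp: coset_act_def subgroup.m_closed)
    have "x = (inv b \<otimes> a) \<otimes> (inv (inv b \<otimes> a) \<otimes> x)" if "x \<in> H" for x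
      using assms h that by (simp add: subgroup.mem_carrier flip: m_assoc)
    moreover have "inv (inv b \<otimes> a) \<otimes> x \<in> H" if "x \<in> H" for x
      using assms(1) h that by (simp add: subgroup.m_closed subgroup.m_inv_closed)
    ultimately show "H \<subseteq> coset_act G (inv b \<otimes> a) H"
      unfolding coset_act_def by blast
  qed
  finally show "coset_act G a H = coset_act G b H" .
qed

lemma card_coset_act:
  assumes "C \<subseteq> carrier G" "g \<in> carrier G"
  shows "card (coset_act G g C) = card C"
  unfolding coset_act_def using assms by (intro card_image) (auto simp: inj_on_def subset_iff)

text \<open>Double counting of the pairs of a fixed coset and an element \<open>a\<close> of it: the
  coset of \<open>a\<close> is fixed by \<open>g\<close> exactly if the conjugate of
  \<open>g\<close> by the inverse of \<open>a\<close> lies in \<open>H\<close>, and each coset has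
  \<open>card H\<close> elements.\<close>

lemma card_fixed_cosets:
  assumes H: "subgroup H G" and fin: "finite (carrier G)" and g: "g \<in> carrier G"
  shows "card H * card {C \<in> left_cosets G H. coset_act G g C = C}
       = card {a \<in> carrier G. inv a \<otimes> g \<otimes> a \<in> H}"
proof -
  let ?F = "{C \<in> left_cosets G H. coset_act G g C = C}"
  have finF: "finite ?F" using fin by (simp add: left_cosets_eq)
  have Hc: "H \<subseteq> carrier G" using H by (rule subgroup.subset)
  have a_in: "a \<in> coset_act G b H \<longleftrightarrow> coset_act G b H = coset_act G a H"
    if "a \<in> carrier G" "b \<in> carrier G" for a b
  proof -
    have "a \<in> coset_act G b H \<longleftrightarrow> inv b \<otimes> a \<in> H"
    proof
      assume "a \<in> coset_act G b H"
      then show "inv b \<otimes> a \<in> H" using that Hc by (auto simp: coset_act_def simp flip: m_assoc)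
    next
      assume "inv b \<otimes> a \<in> H"
      moreover have "a = b \<otimes> (inv b \<otimes> a)" using that by (simp flip: m_assoc)
      ultimately show "a \<in> coset_act G b H" unfolding coset_act_def by blast
    qed
    then show ?thesis using coset_act_eq_iff[OF H that] by auto
  qed
  have "card H * card ?F = (\<Sum>C\<in>?F. card C)"
    using H by (subst sum.cong[of _ ?F card "\<lambda>_. card H"])
      (auto simp: left_cosets_eq card_coset_act subgroup.subset)
  also have "\<dots> = (\<Sum>C\<in>?F. \<Sum>a\<in>carrier G. if a \<in> C then 1 else 0)"
  proof (intro sum.cong refl)
    fix C assume "C \<in> ?F"
    then have "C \<subseteq> carrier G" using left_cosets_subset[OF H] by blast
    then show "card C = (\<Sum>a\<in>carrier G. if a \<in> C then 1 else 0)"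
      using fin by (simp add: sum.If_cases Int_absorb1)
  qed
  also have "\<dots> = (\<Sum>a\<in>carrier G. \<Sum>C\<in>?F. if a \<in> C then 1 else 0)" by (rule sum.swap)
  also have "\<dots> = (\<Sum>a\<in>carrier G. if inv a \<otimes> g \<otimes> a \<in> H then 1 else 0)"
  proof (intro sum.cong refl)
    fix a assume a: "a \<in> carrier G"
    have "{C \<in> ?F. a \<in> C} = (if inv a \<otimes> g \<otimes> a \<in> H then {coset_act G a H} else {})"
      using a g coset_act_eq_iff[OF H, of "g \<otimes> a" a] a_in[OF a]
      by (auto simp: left_cosets_eq coset_act_mult[OF Hc] m_assoc)
    then have "card {C \<in> ?F. a \<in> C} = (if inv a \<otimes> g \<otimes> a \<in> H then 1 else 0)" by simp
    then show "(\<Sum>C\<in>?F. if a \<in> C then 1 else 0) = (if inv a \<otimes> g \<otimes> a \<in> H then 1 else 0 :: nat)"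
      using finF by (simp add: sum.If_cases Int_def)
  qed
  also have "\<dots> = card {a \<in> carrier G. inv a \<otimes> g \<otimes> a \<in> H}"
    using fin by (simp add: sum.If_cases Int_def)
  finally show ?thesis .
qed

text \<open>Frobenius reciprocity for the permutation character of G/H: pairing it with a class
  function on \<open>G\<close> averages that function over \<open>H\<close>.\<close>

lemma sum_fixed_cosets_class_function:
  fixes \<psi> :: "'a \<Rightarrow> 'k::field_char_0"
  assumes H: "subgroup H G" and fin: "finite (carrier G)"
    and cls: "\<And>a x. a \<in> carrier G \<Longrightarrow> x \<in> carrier G \<Longrightarrow> \<psi> (a \<otimes> x \<otimes> inv a) = \<psi> x"
  shows "(\<Sum>g\<in>carrier G. of_nat (card {C \<in> left_cosets G H. coset_act G g C = C}) * \<psi> g)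
       = of_nat (order G) * ((\<Sum>h\<in>H. \<psi> h) / of_nat (card H))"
proof -
  let ?F = "\<lambda>g. {C \<in> left_cosets G H. coset_act G g C = C}"
  have Hc: "H \<subseteq> carrier G" using H by (rule subgroup.subset)
  have "of_nat (card H) * (\<Sum>g\<in>carrier G. of_nat (card (?F g)) * \<psi> g)
      = (\<Sum>g\<in>carrier G. of_nat (card H * card (?F g)) * \<psi> g)"
    by (simp add: sum_distrib_left mult.assoc)
  also have "\<dots> = (\<Sum>g\<in>carrier G. \<Sum>a\<in>carrier G. if inv a \<otimes> g \<otimes> a \<in> H then \<psi> g else 0)"
    using fin card_fixed_cosets[OF H fin] by (intro sum.cong refl) (simp add: sum.If_cases Int_def)
  also have "\<dots> = (\<Sum>a\<in>carrier G. \<Sum>g\<in>carrier G. if inv a \<otimes> g \<otimes> a \<in> H then \<psi> g else 0)"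
    by (rule sum.swap)
  also have "\<dots> = (\<Sum>a\<in>carrier G. \<Sum>h\<in>H. \<psi> h)"
  proof (rule sum.cong[OF refl])
    fix a assume a: "a \<in> carrier G"
    have "(\<Sum>g\<in>carrier G. if inv a \<otimes> g \<otimes> a \<in> H then \<psi> g else 0)
        = (\<Sum>g | g \<in> carrier G \<and> inv a \<otimes> g \<otimes> a \<in> H. \<psi> g)"
      using fin by (simp add: sum.inter_filter)
    also have "\<dots> = (\<Sum>h\<in>H. \<psi> h)"
    proof -
      have conj1: "a \<otimes> (inv a \<otimes> g \<otimes> a) \<otimes> inv a = g" if "g \<in> carrier G" for g
      proof -
        have "a \<otimes> (inv a \<otimes> x) = x" if "x \<in> carrier G" for x using a that by (simp flip: m_assoc)
        then show ?thesis using a that by (simp add: m_assoc)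
      qed
      have conj2: "inv a \<otimes> (a \<otimes> g \<otimes> inv a) \<otimes> a = g" if "g \<in> carrier G" for g
      proof -
        have "inv a \<otimes> (a \<otimes> x) = x" if "x \<in> carrier G" for x using a that by (simp flip: m_assoc)
        then show ?thesis using a that by (simp add: m_assoc)
      qed
      have "\<psi> (inv a \<otimes> g \<otimes> a) = \<psi> g" if "g \<in> carrier G" for g
        using cls[OF a, of "inv a \<otimes> g \<otimes> a"] conj1[OF that] a that by simp
      then show ?thesis
        by (intro sum.reindex_bij_witness[of _ "\<lambda>h. a \<otimes> h \<otimes> inv a" "\<lambda>g. inv a \<otimes> g \<otimes> a"])
          (use a Hc conj1 conj2 in \<open>auto simp: subset_iff\<close>)
    qed
    finally show "(\<Sum>g\<in>carrier G. if inv a \<otimes> g \<otimes> a \<in> H then \<psi> g else 0) = (\<Sum>h\<in>H. \<psi> h)" .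
  qed
  finally have "of_nat (card H) * (\<Sum>g\<in>carrier G. of_nat (card (?F g)) * \<psi> g)
      = of_nat (order G) * (\<Sum>h\<in>H. \<psi> h)" by (simp add: order_def)
  moreover have "card H \<noteq> 0"
    using H fin Hc by (metis card_eq_0_iff finite_subset subgroup.one_closed empty_iff)
  ultimately show ?thesis by (simp add: field_simps)
qed

lemma card_fixed_perm_gset:
  assumes sub: "\<And>i. i < length \<Theta> \<Longrightarrow> subgroup (fst (\<Theta> ! i)) G" and fin: "finite (carrier G)"
  shows "card {x \<in> perm_gset G \<Theta> s. gset_act G g x = x}
       = (\<Sum>i<length \<Theta>. nat (s * snd (\<Theta> ! i)) *
            card {C \<in> left_cosets G (fst (\<Theta> ! i)). coset_act G g C = C})"
proof -
  let ?F = "\<lambda>i. {C \<in> left_cosets G (fst (\<Theta> ! i)). coset_act G g C = C}"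
  have "{x \<in> perm_gset G \<Theta> s. gset_act G g x = x}
      = (SIGMA p:(SIGMA i:{..<length \<Theta>}. {..<nat (s * snd (\<Theta> ! i))}). ?F (fst p))"
  proof (rule Set.set_eqI)
    fix x :: "(nat \<times> nat) \<times> 'a set"
    obtain i j C where "x = ((i, j), C)" by (metis surj_pair)
    then show "x \<in> {x \<in> perm_gset G \<Theta> s. gset_act G g x = x}
      \<longleftrightarrow> x \<in> (SIGMA p:(SIGMA i:{..<length \<Theta>}. {..<nat (s * snd (\<Theta> ! i))}). ?F (fst p))"
      by (simp add: perm_gset_def gset_act_def)
  qed
  moreover have "finite (?F i)" for i using fin by (simp add: left_cosets_eq)
  ultimately show ?thesis
    using sum.Sigma[of "{..<length \<Theta>}" "\<lambda>i. {..<nat (s * snd (\<Theta> ! i))}" "\<lambda>i j. card (?F i)"]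
    by (simp add: case_prod_beta)
qed

text \<open>The passage from the complex numbers to \<open>'k\<close>: the isomorphism of complex
  modules is used only through equalities between numbers of fixed points, which can be read in any
  field of characteristic 0. All later use of a relation goes through this lemma.\<close>

lemma G_relation_class_function:
  fixes \<psi> :: "'a \<Rightarrow> 'k::field_char_0"
  assumes rel: "G_relation G \<Theta>" and fin: "finite (carrier G)"
    and cls: "\<And>a x. a \<in> carrier G \<Longrightarrow> x \<in> carrier G \<Longrightarrow> \<psi> (a \<otimes> x \<otimes> inv a) = \<psi> x"
  shows "(\<Sum>i<length \<Theta>. of_int (snd (\<Theta> ! i)) *
      ((\<Sum>h\<in>fst (\<Theta> ! i). \<psi> h) / of_nat (card (fst (\<Theta> ! i))))) = 0"
proof -
  have sub: "subgroup (fst (\<Theta> ! i)) G" if "i < length \<Theta>" for i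
    using rel that by (auto simp: G_relation_def)
  let ?F = "\<lambda>i g. {C \<in> left_cosets G (fst (\<Theta> ! i)). coset_act G g C = C}"
  have finX: "finite (perm_gset G \<Theta> s)" for s
  proof (rule finite_subset)
    show "perm_gset G \<Theta> s \<subseteq> (SIGMA p:(SIGMA i:{..<length \<Theta>}. {..<nat (s * snd (\<Theta> ! i))}).
        left_cosets G (fst (\<Theta> ! fst p)))"
      by (auto simp: perm_gset_def)
    show "finite \<dots>" using fin by (intro finite_SigmaI) (auto simp: left_cosets_eq)
  qed
  have act: "gset_act G g x \<in> perm_gset G \<Theta> s" if "x \<in> perm_gset G \<Theta> s" "g \<in> carrier G" for g x s
    using that sub by (auto simp: perm_gset_def gset_act_def coset_act_left_cosets)
  have inv: "gset_act G g (gset_act G h x) = x"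
    if "x \<in> perm_gset G \<Theta> s" "g \<in> carrier G" "h \<in> carrier G" "g \<otimes> h = \<one>" for g h x s
    using that left_cosets_subset[OF sub]
    by (auto simp: perm_gset_def gset_act_def coset_act_mult coset_act_one)
  have fixed: "(\<Sum>i<length \<Theta>. of_int (snd (\<Theta> ! i)) * of_nat (card (?F i g))) = (0 :: 'k)"
    if g: "g \<in> carrier G" for g
  proof -
    have "card {x \<in> perm_gset G \<Theta> 1. gset_act G g x = x}
        = card {x \<in> perm_gset G \<Theta> (- 1). gset_act G g x = x}"
      using rel g inv[of _ _ "inv g" g] inv[of _ _ g "inv g"]
      by (intro perm_modules_iso_fixed_points[where b = "gset_act G (inv g)"] finX act)
        (auto simp: G_relation_def)
    then have "(\<Sum>i<length \<Theta>. nat (snd (\<Theta> ! i)) * card (?F i g))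
        = (\<Sum>i<length \<Theta>. nat (- snd (\<Theta> ! i)) * card (?F i g))"
      by (simp add: card_fixed_perm_gset[OF sub fin])
    then have "(\<Sum>i<length \<Theta>. of_nat (nat (snd (\<Theta> ! i))) * of_nat (card (?F i g)))
        = (\<Sum>i<length \<Theta>. of_nat (nat (- snd (\<Theta> ! i))) * (of_nat (card (?F i g)) :: 'k))"
      by (metis (no_types, lifting) of_nat_mult of_nat_sum sum.cong)
    moreover have "(of_int m :: 'k) = of_nat (nat m) - of_nat (nat (- m))" for m
      by (cases "m \<ge> 0") auto
    ultimately show ?thesis by (simp add: left_diff_distrib sum_subtractf)
  qed
  have "of_nat (order G) * (\<Sum>i<length \<Theta>. of_int (snd (\<Theta> ! i)) *
      ((\<Sum>h\<in>fst (\<Theta> ! i). \<psi> h) / of_nat (card (fst (\<Theta> ! i)))))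
     = (\<Sum>i<length \<Theta>. of_int (snd (\<Theta> ! i)) * (\<Sum>g\<in>carrier G. of_nat (card (?F i g)) * \<psi> g))"
    by (subst sum_distrib_left, intro sum.cong refl)
      (simp add: sum_fixed_cosets_class_function[OF sub fin cls])
  also have "\<dots> = (\<Sum>g\<in>carrier G. \<Sum>i<length \<Theta>. of_int (snd (\<Theta> ! i)) * of_nat (card (?F i g)) * \<psi> g)"
    unfolding sum_distrib_left by (subst sum.swap) (simp add: mult.assoc)
  also have "\<dots> = 0" using fixed by (simp flip: sum_distrib_right)
  finally have "of_nat (order G) * (\<Sum>i<length \<Theta>. of_int (snd (\<Theta> ! i)) *
      ((\<Sum>h\<in>fst (\<Theta> ! i). \<psi> h) / of_nat (card (fst (\<Theta> ! i))))) = 0" .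
  moreover have "of_nat (order G) \<noteq> (0 :: 'k)" using fin order_gt_0_iff_finite by simp
  ultimately show ?thesis by (simp only: mult_eq_0_iff) blast
qed

end

section \<open>Representations of finite groups\<close>

lemma entry_times_funit_times:
  "entry (A * funit i j * B) k l = entry A k i * entry B j l"
proof -
  obtain N where N: "fshape N N B" using fshape_ex by blast
  have "entry (A * funit i j * B) k l = (\<Sum>m<N. if m = j then entry A k i * entry B j l else 0)"
    unfolding entry_times2[OF N] times_funit by (intro sum.cong) auto
  also have "\<dots> = entry A k i * entry B j l" using N by (auto simp: fshape_def)
  finally show ?thesis .
qed

locale finite_group = group +
  assumes finite_carrier: "finite (carrier G)"
begin

lemma order_nonzero: "of_nat (order G) \<noteq> (0 :: 'k::field_char_0)"
  using finite_carrier order_gt_0_iff_finite by simp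

lemma card_subgroup_nonzero: "subgroup H G \<Longrightarrow> of_nat (card H) \<noteq> (0 :: 'k::field_char_0)"
  using finite_carrier by (metis card_eq_0_iff empty_iff finite_subset of_nat_eq_0_iff
      subgroup.one_closed subgroup.subset)

lemma sum_translate_left:
  assumes "subgroup H G" "h \<in> H"
  shows "(\<Sum>x\<in>H. f (h \<otimes> x)) = (\<Sum>x\<in>H. f x)"
proof -
  interpret H: subgroup H G by fact
  have "inv h \<otimes> (h \<otimes> x) = x" "h \<otimes> (inv h \<otimes> x) = x" if "x \<in> H" for x
    using assms(2) that by (simp_all flip: m_assoc)
  then show ?thesis using assms(2)
    by (intro sum.reindex_bij_witness[of _ "\<lambda>x. inv h \<otimes> x" "\<lambda>x. h \<otimes> x"]) simp_all
qed

lemma sum_translate_right: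
  assumes "subgroup H G" "h \<in> H"
  shows "(\<Sum>x\<in>H. f (x \<otimes> h)) = (\<Sum>x\<in>H. f x)"
proof -
  interpret H: subgroup H G by fact
  have "x \<otimes> h \<otimes> inv h = x" "x \<otimes> inv h \<otimes> h = x" if "x \<in> H" for x
    using assms(2) that by (simp_all add: m_assoc)
  then show ?thesis using assms(2)
    by (intro sum.reindex_bij_witness[of _ "\<lambda>x. x \<otimes> inv h" "\<lambda>x. x \<otimes> h"]) simp_all
qed

lemma sum_inverse:
  assumes "subgroup H G"
  shows "(\<Sum>x\<in>H. f (inv x)) = (\<Sum>x\<in>H. f x)"
proof -
  interpret H: subgroup H G by fact
  show ?thesis by (intro sum.reindex_bij_witness[of _ "\<lambda>x. inv x" "\<lambda>x. inv x"]) simp_all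
qed

text \<open>For order 2 m + 1 each \<open>x\<close> is recovered from its square as (x^2)^(m+1), so
  squaring permutes the group.\<close>

lemma sum_squares_odd:
  assumes "odd (order G)"
  shows "(\<Sum>x\<in>carrier G. f (x \<otimes> x)) = (\<Sum>x\<in>carrier G. f x)"
proof -
  obtain m where m: "order G = 2 * m + 1" using assms by (rule oddE)
  have root: "(x \<otimes> x) [^] (m + 1) = x" if x: "x \<in> carrier G" for x
  proof -
    have "x \<otimes> x = x [^] (2 :: nat)" using x by (simp add: numeral_2_eq_2)
    moreover have "2 * (m + 1) = order G + 1" using m by simp
    ultimately have "(x \<otimes> x) [^] (m + 1) = x [^] (order G + 1)"
      by (simp only: nat_pow_pow[OF x])
    also have "\<dots> = x" using pow_order_eq_1[OF x] x by simp
    finally show ?thesis .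
  qed
  have "inj_on (\<lambda>x. x \<otimes> x) (carrier G)" by (rule inj_onI) (metis root)
  moreover from this have "(\<lambda>x. x \<otimes> x) ` carrier G = carrier G"
    by (intro endo_inj_surj finite_carrier) auto
  ultimately show ?thesis using sum.reindex[of "\<lambda>x. x \<otimes> x" "carrier G" f] by simp
qed

end

section \<open>Averaging idempotents and invariant forms\<close>

locale finite_group_rep = finite_group G for G :: "('a, 'b) monoid_scheme" (structure) +
  fixes n :: nat and \<rho> :: "'a \<Rightarrow> 'k::field_char_0 fmat"
  assumes rho_one: "\<rho> \<one> = fidm n"
    and rho_mult: "x \<in> carrier G \<Longrightarrow> y \<in> carrier G \<Longrightarrow> \<rho> (x \<otimes> y) = \<rho> x * \<rho> y"
begin

lemma fshape_rho: "x \<in> carrier G \<Longrightarrow> fshape n n (\<rho> x)"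
  using rho_mult[of \<one> x] rho_mult[of x \<one>] by (simp add: rho_one fshape_iff)

lemma rho_inv: "x \<in> carrier G \<Longrightarrow> \<rho> x * \<rho> (inv x) = fidm n"
  "x \<in> carrier G \<Longrightarrow> \<rho> (inv x) * \<rho> x = fidm n"
  by (simp_all add: rho_one flip: rho_mult)

text \<open>The equivariant way to reach the \<open>H\<close>-invariants: this matrix is the
  idempotent that projects onto them.\<close>

definition avg :: "'a set \<Rightarrow> 'k fmat" where
  "avg H = fscale (1 / of_nat (card H)) (\<Sum>h\<in>H. \<rho> h)"

definition invariant_form :: "'k fmat \<Rightarrow> bool" where
  "invariant_form Q \<longleftrightarrow> fshape n n Q \<and> (\<forall>x\<in>carrier G. ftr (\<rho> x) * Q * \<rho> x = Q)"

text \<open>An invariant form on the dual space. The inverse of an invertible invariant form is of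
  this kind, and so is the generalized inverse built below for a degenerate one.\<close>

definition invariant_coform :: "'k fmat \<Rightarrow> bool" where
  "invariant_coform Q \<longleftrightarrow> fshape n n Q \<and> (\<forall>x\<in>carrier G. \<rho> x * Q * ftr (\<rho> x) = Q)"

lemma fshape_avg: "subgroup H G \<Longrightarrow> fshape n n (avg H)"
  unfolding avg_def by (intro fshape_intros fshape_rho) (rule subgroup.mem_carrier)

lemma rho_avg:
  assumes "subgroup H G" "h \<in> H"
  shows "\<rho> h * avg H = avg H" "avg H * \<rho> h = avg H"
proof -
  have h: "h \<in> carrier G" "x \<in> H \<Longrightarrow> x \<in> carrier G" for x
    using assms(2) subgroup.mem_carrier[OF assms(1)] by blast+
  have "\<rho> h * (\<Sum>x\<in>H. \<rho> x) = (\<Sum>x\<in>H. \<rho> (h \<otimes> x))"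
    using h by (simp add: sum_distrib_left rho_mult)
  then show "\<rho> h * avg H = avg H" by (simp add: avg_def sum_translate_left[OF assms])
  have "(\<Sum>x\<in>H. \<rho> x) * \<rho> h = (\<Sum>x\<in>H. \<rho> (x \<otimes> h))"
    using h by (simp add: sum_distrib_right rho_mult)
  then show "avg H * \<rho> h = avg H" by (simp add: avg_def sum_translate_right[OF assms])
qed

lemma avg_absorb:
  assumes H: "subgroup H G" and x: "\<And>h. h \<in> H \<Longrightarrow> \<rho> h * X = X"
  shows "avg H * X = X"
proof -
  have "avg H * X = fscale (1 / of_nat (card H)) (\<Sum>h\<in>H. X)"
    using x by (simp add: avg_def sum_distrib_right)
  also have "(\<Sum>h\<in>H. X) = fscale (of_nat (card H)) X"
    by (rule fmat_eqI) simp
  finally show ?thesis using card_subgroup_nonzero[OF H] by simp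
qed

lemma avg_absorb_right:
  assumes H: "subgroup H G" and x: "\<And>h. h \<in> H \<Longrightarrow> X * \<rho> h = X"
  shows "X * avg H = X"
proof -
  have "X * avg H = fscale (1 / of_nat (card H)) (\<Sum>h\<in>H. X)"
    using x by (simp add: avg_def sum_distrib_left)
  also have "(\<Sum>h\<in>H. X) = fscale (of_nat (card H)) X"
    by (rule fmat_eqI) simp
  finally show ?thesis using card_subgroup_nonzero[OF H] by simp
qed

lemma avg_idem: "subgroup H G \<Longrightarrow> avg H * avg H = avg H"
  by (rule avg_absorb) (simp_all add: rho_avg)

abbreviation (input) e0 :: "'k fmat" where "e0 \<equiv> avg (carrier G)"

lemma avg_e0:
  assumes "subgroup H G"
  shows "avg H * e0 = e0" "e0 * avg H = e0"
  by (rule avg_absorb[OF assms] avg_absorb_right[OF assms] rho_avg[OF subgroup_self]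
      subgroup.mem_carrier[OF assms] | assumption)+

lemma avg_commute:
  assumes "subgroup H G" "\<And>x. x \<in> carrier G \<Longrightarrow> X * \<rho> x = \<rho> x * X"
  shows "X * avg H = avg H * X"
proof -
  have "(\<Sum>h\<in>H. X * \<rho> h) = (\<Sum>h\<in>H. \<rho> h * X)"
    by (rule sum.cong[OF refl]) (rule assms subgroup.mem_carrier[OF assms(1)] | assumption)+
  then show ?thesis by (simp add: avg_def sum_distrib_left sum_distrib_right)
qed

lemma form_rho:
  assumes "invariant_form Q" "x \<in> carrier G"
  shows "Q * \<rho> x = ftr (\<rho> (inv x)) * Q"
proof -
  have "ftr (\<rho> (inv x)) * Q = ftr (\<rho> (inv x)) * (ftr (\<rho> x) * Q * \<rho> x)"
    using assms by (simp add: invariant_form_def)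
  also have "\<dots> = ftr (\<rho> x * \<rho> (inv x)) * Q * \<rho> x" by (simp add: mult.assoc)
  also have "\<dots> = Q * \<rho> x"
    using assms fshapeD(1)[of n n Q] by (simp add: rho_inv invariant_form_def)
  finally show ?thesis ..
qed

lemma coform_rho:
  assumes "invariant_coform Q" "x \<in> carrier G"
  shows "\<rho> x * Q = Q * ftr (\<rho> (inv x))"
proof -
  have "Q * ftr (\<rho> (inv x)) = \<rho> x * Q * ftr (\<rho> x) * ftr (\<rho> (inv x))"
    using assms by (simp add: invariant_coform_def)
  also have "\<dots> = \<rho> x * Q * ftr (\<rho> (inv x) * \<rho> x)" by (simp add: mult.assoc)
  also have "\<dots> = \<rho> x * (Q * fidm n)"
    using assms by (simp add: rho_inv mult.assoc)
  also have "\<dots> = \<rho> x * Q"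
    using assms fshapeD(2)[of n n Q] by (simp add: invariant_coform_def)
  finally show ?thesis ..
qed

text \<open>An invariant form turns \<open>\<rho> h\<close> into the transpose of
  \<open>\<rho> (inv h)\<close>, and summing over \<open>H\<close> absorbs the inversion. Thus the
  averages are self-adjoint, and their images are orthogonal to their kernels.\<close>

lemma form_avg:
  assumes Q: "invariant_form Q" and H: "subgroup H G"
  shows "Q * avg H = ftr (avg H) * Q"
proof -
  have "Q * (\<Sum>h\<in>H. \<rho> h) = (\<Sum>h\<in>H. ftr (\<rho> (inv h)) * Q)"
    unfolding sum_distrib_left
    by (rule sum.cong[OF refl]) (rule form_rho[OF Q subgroup.mem_carrier[OF H]])
  also have "\<dots> = (\<Sum>h\<in>H. ftr (\<rho> h) * Q)" by (rule sum_inverse[OF H])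
  finally show ?thesis by (simp add: avg_def sum_distrib_right)
qed

text \<open>\<open>\<omega>\<close> is an equivariant map to the dual space and
  \<open>\<kappa>\<close> one back, so their composite is an endomorphism of the
  representation.\<close>

lemma coform_form_commute:
  assumes "invariant_coform \<kappa>" "invariant_form \<omega>" "x \<in> carrier G"
  shows "\<kappa> * \<omega> * \<rho> x = \<rho> x * (\<kappa> * \<omega>)"
proof -
  have "\<kappa> * \<omega> * \<rho> x = \<kappa> * ftr (\<rho> (inv x)) * \<omega>"
    using form_rho[OF assms(2,3)] by (simp add: mult.assoc)
  also have "\<dots> = \<rho> x * (\<kappa> * \<omega>)"
    using coform_rho[OF assms(1,3)] by (simp flip: mult.assoc)
  finally show ?thesis .
qed

lemma invariant_form_sum:
  assumes Z: "fshape n n Z" and \<pi>: "fshape n n \<pi>"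
    and comm: "\<And>x. x \<in> carrier G \<Longrightarrow> \<pi> * \<rho> x = \<rho> x * \<pi>"
  shows "invariant_form (\<Sum>x\<in>carrier G. ftr (\<rho> x * \<pi>) * Z * (\<rho> x * \<pi>))"
  unfolding invariant_form_def
proof (intro conjI ballI)
  show "fshape n n (\<Sum>x\<in>carrier G. ftr (\<rho> x * \<pi>) * Z * (\<rho> x * \<pi>))"
    by (rule Z \<pi> fshape_intros(6,8) fshape_times fshape_rho | assumption)+
  fix y assume y: "y \<in> carrier G"
  have "ftr (\<rho> y) * (ftr (\<rho> x * \<pi>) * Z * (\<rho> x * \<pi>)) * \<rho> y
      = ftr (\<rho> (x \<otimes> y) * \<pi>) * Z * (\<rho> (x \<otimes> y) * \<pi>)" if "x \<in> carrier G" for x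
  proof -
    have "\<rho> x * \<pi> * \<rho> y = \<rho> (x \<otimes> y) * \<pi>"
      using comm[OF y] rho_mult[OF that y] by (simp add: mult.assoc)
    moreover from arg_cong[OF this, of ftr]
    have "ftr (\<rho> y) * ftr (\<rho> x * \<pi>) = ftr (\<rho> (x \<otimes> y) * \<pi>)" by simp
    moreover have "ftr (\<rho> y) * (ftr (\<rho> x * \<pi>) * Z * (\<rho> x * \<pi>)) * \<rho> y
        = ftr (\<rho> y) * ftr (\<rho> x * \<pi>) * Z * (\<rho> x * \<pi> * \<rho> y)"
      by (simp only: mult.assoc)
    ultimately show ?thesis by (simp only:)
  qed
  then have "ftr (\<rho> y) * (\<Sum>x\<in>carrier G. ftr (\<rho> x * \<pi>) * Z * (\<rho> x * \<pi>)) * \<rho> y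
      = (\<Sum>x\<in>carrier G. ftr (\<rho> (x \<otimes> y) * \<pi>) * Z * (\<rho> (x \<otimes> y) * \<pi>))"
    unfolding sum_distrib_left sum_distrib_right by (rule sum.cong[OF refl])
  also have "\<dots> = (\<Sum>x\<in>carrier G. ftr (\<rho> x * \<pi>) * Z * (\<rho> x * \<pi>))"
    by (rule sum_translate_right[OF subgroup_self y])
  finally show "ftr (\<rho> y) * (\<Sum>x\<in>carrier G. ftr (\<rho> x * \<pi>) * Z * (\<rho> x * \<pi>)) * \<rho> y = \<dots>" .
qed

lemma invariant_coform_sum:
  assumes Z: "fshape n n Z"
  shows "invariant_coform (\<Sum>x\<in>carrier G. \<rho> x * Z * ftr (\<rho> x))"
  unfolding invariant_coform_def
proof (intro conjI ballI)
  show "fshape n n (\<Sum>x\<in>carrier G. \<rho> x * Z * ftr (\<rho> x))"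
    by (rule Z fshape_intros(6,8) fshape_times fshape_rho | assumption)+
  fix y assume y: "y \<in> carrier G"
  have "\<rho> y * (\<rho> x * Z * ftr (\<rho> x)) * ftr (\<rho> y) = \<rho> (y \<otimes> x) * Z * ftr (\<rho> (y \<otimes> x))"
    if "x \<in> carrier G" for x
    using rho_mult[OF y that] by (simp add: mult.assoc)
  then have "\<rho> y * (\<Sum>x\<in>carrier G. \<rho> x * Z * ftr (\<rho> x)) * ftr (\<rho> y)
      = (\<Sum>x\<in>carrier G. \<rho> (y \<otimes> x) * Z * ftr (\<rho> (y \<otimes> x)))"
    unfolding sum_distrib_left sum_distrib_right by (rule sum.cong[OF refl])
  also have "\<dots> = (\<Sum>x\<in>carrier G. \<rho> x * Z * ftr (\<rho> x))"
    by (rule sum_translate_left[OF subgroup_self y])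
  finally show "\<rho> y * (\<Sum>x\<in>carrier G. \<rho> x * Z * ftr (\<rho> x)) * ftr (\<rho> y) = \<dots>" .
qed

text \<open>If all antisymmetric forms on the image of \<open>\<pi>\<close> had average zero, then the sum of
  \<open>\<chi>(x)\<^sup>2\<close> would equal the sum of \<open>\<chi>(x\<^sup>2)\<close>, hence vanish, since squaring permutes a group of odd
  order; but for self-dual \<open>\<chi>\<close> it is a positive multiple of the dimension of the
  endomorphism algebra of the image.\<close>

lemma antisymmetric_form_exists:
  assumes odd: "odd (order G)" and \<pi>: "fshape n n \<pi>" "\<pi> * \<pi> = \<pi>" "\<pi> \<noteq> 0" "e0 * \<pi> = 0"
    and comm: "\<And>x. x \<in> carrier G \<Longrightarrow> \<pi> * \<rho> x = \<rho> x * \<pi>"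
    and self_dual: "\<And>x. x \<in> carrier G \<Longrightarrow> ftrace (\<rho> (inv x) * \<pi>) = ftrace (\<rho> x * \<pi>)"
  obtains Z where "fshape n n Z" "ftr Z = - Z"
    "(\<Sum>x\<in>carrier G. ftr (\<rho> x * \<pi>) * Z * (\<rho> x * \<pi>)) \<noteq> 0"
proof -
  define a where "a x = \<rho> x * \<pi>" for x
  have a: "fshape n n (a x)" if "x \<in> carrier G" for x
    unfolding a_def using fshape_rho[OF that] \<pi>(1) by (rule fshape_times)
  have aa: "a x * a y = a (x \<otimes> y)" if "x \<in> carrier G" "y \<in> carrier G" for x y
  proof -
    have "a x * a y = \<rho> x * (\<pi> * \<rho> y) * \<pi>" by (simp only: a_def mult.assoc)
    also have "\<dots> = \<rho> x * \<rho> y * (\<pi> * \<pi>)" by (simp only: comm[OF that(2)] mult.assoc)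
    finally show ?thesis using that by (simp only: a_def rho_mult \<pi>(2))
  qed
  have "\<exists>Z. fshape n n Z \<and> ftr Z = - Z \<and> (\<Sum>x\<in>carrier G. ftr (a x) * Z * a x) \<noteq> 0"
  proof (rule ccontr)
    assume *: "\<not> ?thesis"
    \<comment> \<open>Vanishing for the elementary antisymmetric matrix at \<open>i\<close>,
      \<open>j\<close> says that the sum of the tensor squares of the \<open>a x\<close> is
      symmetric in the two row indices.\<close>
    have swap: "(\<Sum>x\<in>carrier G. entry (a x) i k * entry (a x) j l)
        = (\<Sum>x\<in>carrier G. entry (a x) j k * entry (a x) i l)" if "i < n" "j < n" for i j k l
    proof -
      define Z :: "'k fmat" where "Z = funit i j - funit j i"
      have "fshape n n Z" unfolding Z_def using that by (intro fshape_intros)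
      moreover have "ftr Z = - Z" by (simp add: Z_def)
      ultimately have "(\<Sum>x\<in>carrier G. ftr (a x) * Z * a x) = 0" using * by blast
      from arg_cong[OF this, of "\<lambda>M. entry M k l"]
      have "(\<Sum>x\<in>carrier G. entry (ftr (a x) * Z * a x) k l) = 0"
        by (simp only: entry_sum entry_zero)
      then show ?thesis
        by (simp add: Z_def left_diff_distrib right_diff_distrib entry_times_funit_times sum_subtractf)
    qed
    have swap3: "(\<Sum>x\<in>carrier G. \<Sum>i<n. \<Sum>j<n. f x i j) = (\<Sum>i<n. \<Sum>j<n. \<Sum>x\<in>carrier G. f x i j)"
      for f :: "'a \<Rightarrow> nat \<Rightarrow> nat \<Rightarrow> 'k"
      by (subst sum.swap) (rule sum.cong[OF refl], rule sum.swap)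
    have "(\<Sum>x\<in>carrier G. ftrace (a x) * ftrace (a x))
        = (\<Sum>x\<in>carrier G. \<Sum>i<n. \<Sum>j<n. entry (a x) i i * entry (a x) j j)"
      using a by (intro sum.cong refl) (simp add: ftrace_eq[of n] sum_product)
    also have "\<dots> = (\<Sum>i<n. \<Sum>j<n. \<Sum>x\<in>carrier G. entry (a x) i i * entry (a x) j j)"
      by (rule swap3)
    also have "\<dots> = (\<Sum>i<n. \<Sum>j<n. \<Sum>x\<in>carrier G. entry (a x) i j * entry (a x) j i)"
    proof (rule sum.cong[OF refl], rule sum.cong[OF refl])
      fix i j assume "i \<in> {..<n}" "j \<in> {..<n}"
      then show "(\<Sum>x\<in>carrier G. entry (a x) i i * entry (a x) j j)
          = (\<Sum>x\<in>carrier G. entry (a x) i j * entry (a x) j i)"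
        using swap[of i j i j] by (simp add: mult.commute)
    qed
    also have "\<dots> = (\<Sum>x\<in>carrier G. \<Sum>i<n. \<Sum>j<n. entry (a x) i j * entry (a x) j i)"
      by (rule swap3[symmetric])
    also have "\<dots> = (\<Sum>x\<in>carrier G. ftrace (a (x \<otimes> x)))"
      using a by (intro sum.cong refl) (simp add: ftrace_mult_entries[of n n] flip: aa)
    also have "\<dots> = (\<Sum>x\<in>carrier G. ftrace (a x))"
      by (rule sum_squares_odd[OF odd])
    also have "\<dots> = ftrace ((\<Sum>x\<in>carrier G. \<rho> x) * \<pi>)"
      by (simp add: a_def sum_distrib_right)
    also have "(\<Sum>x\<in>carrier G. \<rho> x) = fscale (of_nat (order G)) e0"
      using order_nonzero by (simp add: avg_def order_def)
    also have "\<dots> * \<pi> = 0" using \<pi>(4) by simp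
    finally have zero: "(\<Sum>x\<in>carrier G. ftrace (a x) * ftrace (a x)) = 0" by simp
    define S where "S = {..<n} \<times> {..<n}"
    \<comment> \<open>Up to the factor |G|, the matrix of the linear map that sends f to the mean of
      a(x) f a(x^(-1)), with the entries of f indexed by pairs. It is a projection, and self-duality
      makes its trace the mean of the squared character, which was just shown to be 0.\<close>
    define R where "R p q = (\<Sum>x\<in>carrier G.
        entry (a x) (fst p) (fst q) * entry (a (inv x)) (snd q) (snd p))" for p q
    have RR: "(\<Sum>y\<in>S. R p y * R y q) = of_nat (order G) * R p q" for p q
    proof -
      have "(\<Sum>y\<in>S. R p y * R y q)
        = (\<Sum>y\<in>S. \<Sum>x\<in>carrier G. \<Sum>z\<in>carrier G.
            (entry (a x) (fst p) (fst y) * entry (a (inv x)) (snd y) (snd p)) *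
            (entry (a z) (fst y) (fst q) * entry (a (inv z)) (snd q) (snd y)))"
        by (simp only: R_def sum_product)
      also have "\<dots> = (\<Sum>x\<in>carrier G. \<Sum>z\<in>carrier G. \<Sum>y\<in>S.
            (entry (a x) (fst p) (fst y) * entry (a (inv x)) (snd y) (snd p)) *
            (entry (a z) (fst y) (fst q) * entry (a (inv z)) (snd q) (snd y)))"
        by (subst sum.swap) (rule sum.cong[OF refl], rule sum.swap)
      also have "\<dots> = (\<Sum>x\<in>carrier G. \<Sum>z\<in>carrier G.
            entry (a (x \<otimes> z)) (fst p) (fst q) * entry (a (inv (x \<otimes> z))) (snd q) (snd p))"
      proof (rule sum.cong[OF refl], rule sum.cong[OF refl])
        fix x z assume xz: "x \<in> carrier G" "z \<in> carrier G"
        have "(\<Sum>y\<in>S. (entry (a x) (fst p) (fst y) * entry (a (inv x)) (snd y) (snd p)) *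
              (entry (a z) (fst y) (fst q) * entry (a (inv z)) (snd q) (snd y)))
          = (\<Sum>k<n. entry (a x) (fst p) k * entry (a z) k (fst q)) *
            (\<Sum>l<n. entry (a (inv z)) (snd q) l * entry (a (inv x)) l (snd p))"
          unfolding S_def sum_product sum.cartesian_product by (intro sum.cong refl) auto
        also have "\<dots> = entry (a x * a z) (fst p) (fst q) * entry (a (inv z) * a (inv x)) (snd q) (snd p)"
          using xz a by (simp add: entry_times[of n n])
        also have "\<dots> = entry (a (x \<otimes> z)) (fst p) (fst q) * entry (a (inv (x \<otimes> z))) (snd q) (snd p)"
          using xz by (simp add: aa inv_mult_group)
        finally show "(\<Sum>y\<in>S. (entry (a x) (fst p) (fst y) * entry (a (inv x)) (snd y) (snd p)) *
              (entry (a z) (fst y) (fst q) * entry (a (inv z)) (snd q) (snd y))) = \<dots>" .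
      qed
      also have "\<dots> = (\<Sum>x\<in>carrier G. R p q)"
        unfolding R_def by (rule sum.cong[OF refl], rule sum_translate_left[OF subgroup_self])
      also have "\<dots> = of_nat (order G) * R p q" by (simp add: order_def)
      finally show ?thesis .
    qed
    define T where "T p q = R p q / of_nat (order G)" for p q
    have idem: "(\<Sum>y\<in>S. T p y * T y q) = T p q" for p q
      using RR[of p q] order_nonzero[where 'k = 'k]
      by (simp add: T_def flip: sum_divide_distrib)
    have "(\<Sum>p\<in>S. R p p)
        = (\<Sum>x\<in>carrier G. \<Sum>p\<in>S. entry (a x) (fst p) (fst p) * entry (a (inv x)) (snd p) (snd p))"
      unfolding R_def by (rule sum.swap)
    also have "\<dots> = (\<Sum>x\<in>carrier G. ftrace (a x) * ftrace (a x))"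
    proof (rule sum.cong[OF refl])
      fix x assume x: "x \<in> carrier G"
      have "(\<Sum>p\<in>S. entry (a x) (fst p) (fst p) * entry (a (inv x)) (snd p) (snd p))
          = (\<Sum>i<n. entry (a x) i i) * (\<Sum>j<n. entry (a (inv x)) j j)"
        unfolding S_def sum_product sum.cartesian_product by (intro sum.cong refl) auto
      also have "\<dots> = ftrace (a x) * ftrace (a (inv x))"
        using x a by (simp add: ftrace_eq[of n])
      also have "ftrace (a (inv x)) = ftrace (a x)" using self_dual[OF x] by (simp add: a_def)
      finally show "(\<Sum>p\<in>S. entry (a x) (fst p) (fst p) * entry (a (inv x)) (snd p) (snd p))
          = ftrace (a x) * ftrace (a x)" .
    qed
    finally have tr: "(\<Sum>p\<in>S. T p p) = 0" using zero by (simp add: T_def flip: sum_divide_distrib)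
    have finS: "finite S" unfolding S_def by simp
    have T0: "T p q = 0" if pq: "p \<in> S" "q \<in> S" for p q
      by (rule trace_idempotent_kernel[of S T, OF finS _ tr pq]) (rule idem)
    \<comment> \<open>The projection fixes \<open>\<pi>\<close>, because a(x) \<pi> a(x^(-1)) =
      \<pi>. Being 0, it forces \<open>\<pi>\<close> to vanish.\<close>
    have "entry \<pi> i j = 0" if ij: "i < n" "j < n" for i j
    proof -
      have R0: "R (i, j) q = 0" if "q \<in> S" for q
        using T0[OF _ that, of "(i, j)"] ij order_nonzero[where 'k = 'k] by (simp add: S_def T_def)
      have "0 = (\<Sum>q\<in>S. R (i, j) q * entry \<pi> (fst q) (snd q))"
        by (simp add: R0)
      also have "\<dots> = (\<Sum>q\<in>S. \<Sum>x\<in>carrier G.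
          entry (a x) i (fst q) * entry (a (inv x)) (snd q) j * entry \<pi> (fst q) (snd q))"
        by (simp only: R_def sum_distrib_right fst_conv snd_conv)
      also have "\<dots> = (\<Sum>x\<in>carrier G. \<Sum>q\<in>S.
          entry (a x) i (fst q) * entry (a (inv x)) (snd q) j * entry \<pi> (fst q) (snd q))"
        by (rule sum.swap)
      also have "\<dots> = (\<Sum>x\<in>carrier G. entry \<pi> i j)"
      proof (intro sum.cong refl)
        fix x assume x: "x \<in> carrier G"
        have "(\<Sum>q\<in>S. entry (a x) i (fst q) * entry (a (inv x)) (snd q) j * entry \<pi> (fst q) (snd q))
            = (\<Sum>k<n. entry (a x) i k * (\<Sum>l<n. entry \<pi> k l * entry (a (inv x)) l j))"
          unfolding S_def sum_distrib_left sum.cartesian_product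
          by (intro sum.cong refl) (auto simp: ac_simps)
        also have "\<dots> = entry (a x * (\<pi> * a (inv x))) i j"
          using x a \<pi>(1) by (simp add: entry_times[of n n])
        also have "a x * (\<pi> * a (inv x)) = \<pi>"
        proof -
          have "a x * (\<pi> * a (inv x)) = \<rho> x * (\<pi> * \<pi>) * a (inv x)"
            by (simp only: a_def mult.assoc)
          also have "\<dots> = a x * a (inv x)" by (simp only: \<pi>(2) a_def)
          finally have "a x * (\<pi> * a (inv x)) = a x * a (inv x)" .
          then show ?thesis using x \<pi>(1) by (simp add: aa) (simp add: a_def rho_one fshapeD)
        qed
        finally show "(\<Sum>q\<in>S. entry (a x) i (fst q) * entry (a (inv x)) (snd q) j * entry \<pi> (fst q) (snd q))
            = entry \<pi> i j" .
      qed
      finally show ?thesis using order_nonzero[where 'k = 'k] by (simp add: order_def)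
    qed
    then have "entry \<pi> i j = entry 0 i j" for i j
      using \<pi>(1) by (cases "i < n \<and> j < n") (auto simp: fshape_def)
    then have "\<pi> = 0" by (rule fmat_eqI)
    with \<pi>(3) show False ..
  qed
  then obtain Z where Z: "fshape n n Z" "ftr Z = - Z" "(\<Sum>x\<in>carrier G. ftr (a x) * Z * a x) \<noteq> 0"
    by (elim exE conjE)
  from Z(3) have "(\<Sum>x\<in>carrier G. ftr (\<rho> x * \<pi>) * Z * (\<rho> x * \<pi>)) \<noteq> 0"
    unfolding a_def .
  with Z(1,2) show ?thesis by (rule that)
qed

end

section \<open>Invariant alternating forms\<close>

lemma assoc_rule: "a * b = c \<Longrightarrow> a * (b * d) = c * d" for a b c d :: "'a::semigroup_mult"
  by (simp flip: mult.assoc)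

context finite_group_rep
begin

lemma invariant_form_add: "invariant_form A \<Longrightarrow> invariant_form B \<Longrightarrow> invariant_form (A + B)"
  by (simp add: invariant_form_def fshape_intros distrib_left distrib_right)

lemma invariant_coform_add: "invariant_coform A \<Longrightarrow> invariant_coform B \<Longrightarrow> invariant_coform (A + B)"
  by (simp add: invariant_coform_def fshape_intros distrib_left distrib_right)

lemma invariant_coform_scale: "invariant_coform A \<Longrightarrow> invariant_coform (fscale c A)"
  by (simp add: invariant_coform_def fshape_intros)

lemma invariant_coform_ftr:
  assumes "invariant_coform A"
  shows "invariant_coform (ftr A)"
proof -
  have "\<rho> x * ftr A * ftr (\<rho> x) = ftr A" if "x \<in> carrier G" for x
  proof -
    have "\<rho> x * ftr A * ftr (\<rho> x) = ftr (\<rho> x * A * ftr (\<rho> x))" by (simp add: mult.assoc)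
    then show ?thesis using assms that by (simp only: invariant_coform_def)
  qed
  then show ?thesis using assms by (simp add: invariant_coform_def fshape_intros)
qed

lemma fshape_form: "invariant_form A \<Longrightarrow> fshape n n A"
  by (simp add: invariant_form_def)

lemma fshape_coform: "invariant_coform A \<Longrightarrow> fshape n n A"
  by (simp add: invariant_coform_def)

lemma form_rho_left:
  assumes "invariant_form Q" "x \<in> carrier G"
  shows "ftr (\<rho> x) * Q = Q * \<rho> (inv x)"
  using form_rho[OF assms(1), of "inv x"] assms(2) by simp

text \<open>The condition \<eta> \<kappa> \<eta> = \<eta> is affine in \<kappa>, so it survives
  averaging over \<open>G\<close>, which makes \<kappa> invariant, and taking the antisymmetric
  part, as \<eta> is antisymmetric itself. The start is the generalized inverse from a rank
  factorization.\<close>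

lemma antisymmetric_generalized_inverse:
  assumes \<eta>: "invariant_form \<eta>" and anti: "ftr \<eta> = - \<eta>"
  obtains \<kappa> where "invariant_coform \<kappa>" "ftr \<kappa> = - \<kappa>" "\<eta> * \<kappa> * \<eta> = \<eta>" "\<kappa> * \<eta> * \<kappa> = \<kappa>"
proof -
  obtain k X Y where XY: "fshape k n X" "fshape n k Y" "\<eta> * Y * X * \<eta> = \<eta>"
    using rank_factorization[OF fshape_form[OF \<eta>]] .
  define \<kappa>0 where "\<kappa>0 = Y * X"
  have s0: "fshape n n \<kappa>0" unfolding \<kappa>0_def using XY(2,1) by (rule fshape_times)
  have e: "\<eta> * \<kappa>0 * \<eta> = \<eta>" using XY(3) by (simp add: \<kappa>0_def mult.assoc)
  define \<kappa>1 where "\<kappa>1 = fscale (1 / of_nat (order G)) (\<Sum>x\<in>carrier G. \<rho> x * \<kappa>0 * ftr (\<rho> x))"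
  have c1: "invariant_coform \<kappa>1"
    unfolding \<kappa>1_def by (rule invariant_coform_scale[OF invariant_coform_sum[OF s0]])
  have "\<eta> * (\<rho> x * \<kappa>0 * ftr (\<rho> x)) * \<eta> = \<eta>" if x: "x \<in> carrier G" for x
  proof -
    have "\<eta> * (\<rho> x * \<kappa>0 * ftr (\<rho> x)) * \<eta> = (\<eta> * \<rho> x) * \<kappa>0 * (ftr (\<rho> x) * \<eta>)"
      by (simp only: mult.assoc)
    also have "\<dots> = ftr (\<rho> (inv x)) * (\<eta> * \<kappa>0 * \<eta>) * \<rho> (inv x)"
      by (simp only: form_rho[OF \<eta> x] form_rho_left[OF \<eta> x] mult.assoc)
    also have "\<dots> = \<eta>" using \<eta> x by (simp add: e invariant_form_def)
    finally show ?thesis .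
  qed
  then have "\<eta> * (\<Sum>x\<in>carrier G. \<rho> x * \<kappa>0 * ftr (\<rho> x)) * \<eta> = (\<Sum>x\<in>carrier G. \<eta>)"
    unfolding sum_distrib_left sum_distrib_right by (rule sum.cong[OF refl])
  also have "\<dots> = fscale (of_nat (order G)) \<eta>" by (rule fmat_eqI) (simp add: order_def)
  finally have e1: "\<eta> * \<kappa>1 * \<eta> = \<eta>" using order_nonzero[where 'k = 'k] by (simp add: \<kappa>1_def)
  have "ftr (\<eta> * \<kappa>1 * \<eta>) = ftr \<eta>" by (simp only: e1)
  then have e1': "\<eta> * ftr \<kappa>1 * \<eta> = - \<eta>" by (simp add: anti mult.assoc)
  define \<kappa>2 where "\<kappa>2 = fscale (1 / 2) (\<kappa>1 + fscale (- 1) (ftr \<kappa>1))"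
  have c2: "invariant_coform \<kappa>2"
    unfolding \<kappa>2_def
    by (intro invariant_coform_scale invariant_coform_add invariant_coform_ftr c1)
  have a2: "ftr \<kappa>2 = - \<kappa>2" by (rule fmat_eqI) (simp add: \<kappa>2_def algebra_simps)
  have "\<eta> * \<kappa>2 * \<eta> = fscale (1 / 2) (\<eta> * \<kappa>1 * \<eta> + fscale (- 1) (\<eta> * ftr \<kappa>1 * \<eta>))"
    by (simp add: \<kappa>2_def distrib_left distrib_right)
  also have "\<dots> = \<eta>" unfolding e1 e1' by (rule fmat_eqI) simp
  finally have e2: "\<eta> * \<kappa>2 * \<eta> = \<eta>" .
  then have e2': "\<eta> * (\<kappa>2 * \<eta>) = \<eta>" "\<eta> * (\<kappa>2 * (\<eta> * d)) = \<eta> * d" for d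
    by (simp_all flip: mult.assoc)
  \<comment> \<open>The second identity \<kappa> \<eta> \<kappa> = \<kappa> is quadratic and would
    be lost by averaging; the sandwich establishes it at the end and preserves invariance and
    antisymmetry.\<close>
  define \<kappa> where "\<kappa> = \<kappa>2 * \<eta> * \<kappa>2"
  show ?thesis
  proof
    show "invariant_coform \<kappa>" unfolding invariant_coform_def
    proof (intro conjI ballI)
      show "fshape n n \<kappa>" unfolding \<kappa>_def
        by (rule fshape_times fshape_form[OF \<eta>] fshape_coform[OF c2])+
      fix x assume x: "x \<in> carrier G"
      have "\<rho> x * \<kappa> * ftr (\<rho> x) = \<rho> x * \<kappa>2 * \<eta> * \<kappa>2 * ftr (\<rho> x)" by (simp only: \<kappa>_def mult.assoc)
      also have "\<dots> = \<kappa>2 * (ftr (\<rho> (inv x)) * \<eta>) * \<kappa>2 * ftr (\<rho> x)"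
        by (simp only: coform_rho[OF c2 x] mult.assoc)
      also have "\<dots> = \<kappa>2 * \<eta> * (\<rho> x * \<kappa>2 * ftr (\<rho> x))"
        by (simp only: form_rho[OF \<eta> x, symmetric] mult.assoc)
      also have "\<dots> = \<kappa>" using c2 x by (simp add: \<kappa>_def invariant_coform_def)
      finally show "\<rho> x * \<kappa> * ftr (\<rho> x) = \<kappa>" .
    qed
    show "ftr \<kappa> = - \<kappa>" by (simp add: \<kappa>_def a2 anti mult.assoc)
    show "\<eta> * \<kappa> * \<eta> = \<eta>" by (simp add: \<kappa>_def mult.assoc e2')
    show "\<kappa> * \<eta> * \<kappa> = \<kappa>" by (simp add: \<kappa>_def mult.assoc e2')
  qed
qed

text \<open>An alternating form that may be degenerate, with its inverse on the part where it is
  nondegenerate. The product \<open>\<kappa> * \<omega>\<close> is the equivariant projection onto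
  that part, and the last two conditions keep the part in the complement of the
  \<open>G\<close>-invariants.\<close>

definition antisymmetric_pair :: "'k fmat \<Rightarrow> 'k fmat \<Rightarrow> bool" where
  "antisymmetric_pair \<omega> \<kappa> \<longleftrightarrow> invariant_form \<omega> \<and> invariant_coform \<kappa> \<and> ftr \<omega> = - \<omega> \<and> ftr \<kappa> = - \<kappa> \<and>
     \<omega> * \<kappa> * \<omega> = \<omega> \<and> \<kappa> * \<omega> * \<kappa> = \<kappa> \<and> \<omega> * e0 = 0 \<and> e0 * \<kappa> = 0"

lemma antisymmetric_pair_idem:
  assumes "antisymmetric_pair \<omega> \<kappa>"
  shows "fshape n n (\<kappa> * \<omega>)" "\<kappa> * \<omega> * (\<kappa> * \<omega>) = \<kappa> * \<omega>"
proof -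
  have "fshape n n \<kappa>" "fshape n n \<omega>"
    using assms fshape_form fshape_coform by (simp_all add: antisymmetric_pair_def)
  then show "fshape n n (\<kappa> * \<omega>)" by (rule fshape_times)
  have "\<kappa> * \<omega> * (\<kappa> * \<omega>) = (\<kappa> * \<omega> * \<kappa>) * \<omega>" by (simp only: mult.assoc)
  also have "\<kappa> * \<omega> * \<kappa> = \<kappa>" using assms by (simp add: antisymmetric_pair_def)
  finally show "\<kappa> * \<omega> * (\<kappa> * \<omega>) = \<kappa> * \<omega>" .
qed

text \<open>Moving \<rho>(x) across the form and transposing turns it into \<rho>(x^(-1)). The
  hypothesis \<open>tr\<close>, which holds when both matrices are antisymmetric, restores the
  product of the two.\<close>

lemma trace_form_coform:
  assumes \<omega>: "invariant_form \<omega>" and tr: "ftr \<kappa> * ftr \<omega> = \<kappa> * \<omega>" and x: "x \<in> carrier G"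
  shows "ftrace (\<rho> (inv x) * (\<kappa> * \<omega>)) = ftrace (\<rho> x * (\<kappa> * \<omega>))"
proof -
  have "ftrace (\<rho> x * (\<kappa> * \<omega>)) = ftrace (\<kappa> * (\<omega> * \<rho> x))"
    using ftrace_comm[of "\<rho> x" "\<kappa> * \<omega>"] by (simp only: mult.assoc)
  also have "\<dots> = ftrace (ftr (\<rho> (inv x)) * \<omega> * \<kappa>)"
    unfolding form_rho[OF \<omega> x] by (rule ftrace_comm)
  also have "\<dots> = ftrace (ftr (ftr (\<rho> (inv x)) * \<omega> * \<kappa>))" by (rule ftrace_ftr[symmetric])
  also have "\<dots> = ftrace (ftr \<kappa> * ftr \<omega> * \<rho> (inv x))" by (simp add: mult.assoc)
  also have "\<dots> = ftrace (\<rho> (inv x) * (\<kappa> * \<omega>))" unfolding tr by (rule ftrace_comm)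
  finally show ?thesis ..
qed

end

locale odd_self_dual_rep = finite_group_rep G n \<rho>
  for G :: "('a, 'b) monoid_scheme" (structure) and n and \<rho> :: "'a \<Rightarrow> 'k::field_char_0 fmat" +
  fixes P P' :: "'k fmat"
  assumes odd_order: "odd (order G)"
    and P: "invariant_form P" and P': "fshape n n P'" "P * P' = fidm n" "P' * P = fidm n"
begin

lemma trace_rho_inv:
  assumes x: "x \<in> carrier G"
  shows "ftrace (\<rho> (inv x)) = ftrace (\<rho> x)"
proof -
  have "ftrace (\<rho> x) = ftrace (P' * (P * \<rho> x))"
    using fshapeD(1)[OF fshape_rho[OF x]] by (simp add: assoc_rule[OF P'(3)])
  also have "\<dots> = ftrace (ftr (\<rho> (inv x)) * P * P')"
    unfolding form_rho[OF P x] by (rule ftrace_comm)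
  also have "\<dots> = ftrace (ftr (\<rho> (inv x)))"
  proof -
    have "fshape n n (ftr (\<rho> (inv x)))" using x by (intro fshape_intros fshape_rho) simp
    then show ?thesis by (simp only: mult.assoc P' fshapeD(2))
  qed
  finally show ?thesis by simp
qed

text \<open>The uncovered part is the image of an equivariant projection \<open>\<pi>\<close>
  without \<open>G\<close>-invariants. Its character is self-dual as a difference of self-dual ones,
  so \<open>\<pi>\<close> carries a nonzero invariant alternating form, orthogonal to \<omega>;
  adding it raises the rank.\<close>

lemma antisymmetric_pair_extend:
  assumes pair: "antisymmetric_pair \<omega> \<kappa>" and ne: "\<kappa> * \<omega> \<noteq> fidm n - e0"
  obtains \<omega>' \<kappa>' s where "antisymmetric_pair \<omega>' \<kappa>'"
    "ftrace (\<kappa>' * \<omega>') = ftrace (\<kappa> * \<omega>) + of_nat s" "s > 0"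
proof -
  have \<omega>: "invariant_form \<omega>" and \<kappa>: "invariant_coform \<kappa>" and anti: "ftr \<omega> = - \<omega>" "ftr \<kappa> = - \<kappa>"
    and gi: "\<omega> * \<kappa> * \<omega> = \<omega>" "\<kappa> * \<omega> * \<kappa> = \<kappa>" and e0: "\<omega> * e0 = 0" "e0 * \<kappa> = 0"
    using pair by (simp_all add: antisymmetric_pair_def)
  have G: "subgroup (carrier G) G" by (rule subgroup_self)
  have se0: "fshape n n e0" using G by (rule fshape_avg)
  have sh: "fshape n n \<omega>" "fshape n n \<kappa>" "fshape n n (\<kappa> * \<omega>)"
    using fshape_form[OF \<omega>] fshape_coform[OF \<kappa>] antisymmetric_pair_idem(1)[OF pair] .
  have id: "fidm n * e0 = e0" "e0 * fidm n = e0" "\<omega> * fidm n = \<omega>" "fidm n * \<kappa> = \<kappa>"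
    "\<kappa> * \<omega> * fidm n = \<kappa> * \<omega>" "fidm n * (\<kappa> * \<omega>) = \<kappa> * \<omega>"
    using fshapeD[OF se0] fshapeD[OF sh(1)] fshapeD[OF sh(2)] fshapeD[OF sh(3)] by simp_all
  have ee: "e0 * e0 = e0" using G by (rule avg_idem)
  define \<pi> where "\<pi> = fidm n - e0 - \<kappa> * \<omega>"
  have s\<pi>: "fshape n n \<pi>" unfolding \<pi>_def by (intro fshape_intros fshape_fidm se0 sh)
  have \<pi>e: "\<pi> * e0 = 0" by (simp add: \<pi>_def left_diff_distrib id ee mult.assoc e0)
  have e\<pi>: "e0 * \<pi> = 0" by (simp add: \<pi>_def right_diff_distrib id ee assoc_rule[OF e0(2)])
  have \<omega>\<pi>: "\<omega> * \<pi> = 0" using gi(1) by (simp add: \<pi>_def right_diff_distrib id e0 mult.assoc)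
  have \<pi>\<kappa>: "\<pi> * \<kappa> = 0" by (simp add: \<pi>_def left_diff_distrib id e0 gi(2))
  have \<pi>\<pi>: "\<pi> * \<pi> = \<pi>"
  proof -
    have "\<pi> * \<pi> = \<pi> * fidm n - \<pi> * e0 - \<pi> * \<kappa> * \<omega>"
      unfolding \<pi>_def by (simp only: right_diff_distrib mult.assoc)
    then show ?thesis by (simp add: \<pi>e \<pi>\<kappa> fshapeD(2)[OF s\<pi>])
  qed
  have comm: "\<pi> * \<rho> x = \<rho> x * \<pi>" if x: "x \<in> carrier G" for x
    using fshapeD[OF fshape_rho[OF x]] rho_avg[OF G x] coform_form_commute[OF \<kappa> \<omega> x]
    by (simp add: \<pi>_def left_diff_distrib right_diff_distrib)
  have self_dual: "ftrace (\<rho> (inv x) * \<pi>) = ftrace (\<rho> x * \<pi>)" if x: "x \<in> carrier G" for x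
  proof -
    have "ftrace (\<rho> y * \<pi>) = ftrace (\<rho> y) - ftrace e0 - ftrace (\<rho> y * (\<kappa> * \<omega>))"
      if y: "y \<in> carrier G" for y
      using fshapeD(2)[OF fshape_rho[OF y]] rho_avg(1)[OF G y]
      by (simp add: \<pi>_def right_diff_distrib)
    moreover have "ftrace (\<rho> (inv x) * (\<kappa> * \<omega>)) = ftrace (\<rho> x * (\<kappa> * \<omega>))"
      using x by (intro trace_form_coform \<omega>) (simp_all add: anti)
    ultimately show ?thesis using x trace_rho_inv[OF x] by simp
  qed
  have "\<pi> \<noteq> 0" using ne by (auto simp: \<pi>_def algebra_simps)
  obtain Z where Z: "fshape n n Z" "ftr Z = - Z"
    "(\<Sum>x\<in>carrier G. ftr (\<rho> x * \<pi>) * Z * (\<rho> x * \<pi>)) \<noteq> 0"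
    by (rule antisymmetric_form_exists[OF odd_order s\<pi> \<pi>\<pi> \<open>\<pi> \<noteq> 0\<close> e\<pi> comm self_dual])
  define \<eta> where "\<eta> = (\<Sum>x\<in>carrier G. ftr (\<rho> x * \<pi>) * Z * (\<rho> x * \<pi>))"
  have \<eta>: "invariant_form \<eta>" unfolding \<eta>_def using Z(1) s\<pi> comm by (rule invariant_form_sum)
  have anti_\<eta>: "ftr \<eta> = - \<eta>" by (simp add: \<eta>_def Z(2) mult.assoc sum_negf)
  have \<eta>X: "\<eta> * X = 0" if "\<pi> * X = 0" for X
    by (simp add: \<eta>_def sum_distrib_right mult.assoc that)
  have \<eta>\<pi>: "\<eta> * \<pi> = \<eta>" by (simp add: \<eta>_def sum_distrib_right mult.assoc \<pi>\<pi>)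
  have \<pi>\<eta>: "ftr \<pi> * \<eta> = \<eta>" using arg_cong[OF \<eta>\<pi>, of ftr] by (simp add: anti_\<eta>)
  obtain \<kappa>1 where \<kappa>1: "invariant_coform \<kappa>1" "ftr \<kappa>1 = - \<kappa>1" "\<eta> * \<kappa>1 * \<eta> = \<eta>" "\<kappa>1 * \<eta> * \<kappa>1 = \<kappa>1"
    by (rule antisymmetric_generalized_inverse[OF \<eta> anti_\<eta>])
  \<comment> \<open>Compression by \<open>\<pi>\<close> preserves both generalized inverse
    identities, since the new form satisfies \<eta> \<pi> = \<eta> and \<pi>^T \<eta> = \<eta>, and
    it removes all cross terms with the old pair.\<close>
  define \<kappa>' where "\<kappa>' = \<pi> * \<kappa>1 * ftr \<pi>"
  have \<kappa>': "invariant_coform \<kappa>'" unfolding invariant_coform_def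
  proof (intro conjI ballI)
    show "fshape n n \<kappa>'" unfolding \<kappa>'_def
      by (rule fshape_times s\<pi> fshape_coform[OF \<kappa>1(1)] fshape_intros(6))+
    fix x assume x: "x \<in> carrier G"
    have "\<rho> x * \<kappa>' * ftr (\<rho> x) = (\<rho> x * \<pi>) * \<kappa>1 * ftr (\<rho> x * \<pi>)"
      by (simp add: \<kappa>'_def mult.assoc)
    also have "\<dots> = \<pi> * (\<rho> x * \<kappa>1 * ftr (\<rho> x)) * ftr \<pi>"
      unfolding comm[OF x, symmetric] by (simp add: mult.assoc)
    also have "\<dots> = \<kappa>'" using \<kappa>1(1) x by (simp add: \<kappa>'_def invariant_coform_def)
    finally show "\<rho> x * \<kappa>' * ftr (\<rho> x) = \<kappa>'" .
  qed
  have anti_\<kappa>': "ftr \<kappa>' = - \<kappa>'" by (simp add: \<kappa>'_def \<kappa>1(2) mult.assoc)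
  have gi': "\<eta> * \<kappa>' * \<eta> = \<eta>" "\<kappa>' * \<eta> * \<kappa>' = \<kappa>'"
  proof -
    have "\<eta> * \<kappa>' * \<eta> = \<eta> * \<pi> * \<kappa>1 * (ftr \<pi> * \<eta>)" by (simp only: \<kappa>'_def mult.assoc)
    then show "\<eta> * \<kappa>' * \<eta> = \<eta>" by (simp only: \<eta>\<pi> \<pi>\<eta> \<kappa>1(3))
    have "\<kappa>' * \<eta> * \<kappa>' = \<pi> * \<kappa>1 * (ftr \<pi> * \<eta> * \<pi>) * \<kappa>1 * ftr \<pi>" by (simp only: \<kappa>'_def mult.assoc)
    also have "\<dots> = \<pi> * (\<kappa>1 * \<eta> * \<kappa>1) * ftr \<pi>" by (simp only: \<eta>\<pi> \<pi>\<eta> mult.assoc)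
    finally show "\<kappa>' * \<eta> * \<kappa>' = \<kappa>'" by (simp only: \<kappa>1(4) \<kappa>'_def)
  qed
  have z1: "\<eta> * \<kappa> = 0" by (rule \<eta>X[OF \<pi>\<kappa>])
  have z2: "\<omega> * \<kappa>' = 0" by (simp add: \<kappa>'_def mult.assoc assoc_rule[OF \<omega>\<pi>])
  have z3: "\<kappa> * \<eta> = 0" using arg_cong[OF z1, of ftr] by (simp add: anti anti_\<eta>)
  have z4: "\<kappa>' * \<omega> = 0" using arg_cong[OF z2, of ftr] by (simp add: anti anti_\<kappa>')
  have prod: "(\<kappa> + \<kappa>') * (\<omega> + \<eta>) = \<kappa> * \<omega> + \<kappa>' * \<eta>"
    by (simp add: distrib_left distrib_right z3 z4)
  have "antisymmetric_pair (\<omega> + \<eta>) (\<kappa> + \<kappa>')"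
    unfolding antisymmetric_pair_def
  proof (intro conjI)
    show "invariant_form (\<omega> + \<eta>)" "invariant_coform (\<kappa> + \<kappa>')"
      using \<omega> \<eta> \<kappa> \<kappa>' by (simp_all add: invariant_form_add invariant_coform_add)
    show "ftr (\<omega> + \<eta>) = - (\<omega> + \<eta>)" "ftr (\<kappa> + \<kappa>') = - (\<kappa> + \<kappa>')"
      by (simp_all add: anti anti_\<eta> anti_\<kappa>')
    have "(\<omega> + \<eta>) * (\<kappa> + \<kappa>') * (\<omega> + \<eta>)
        = \<omega> * \<kappa> * \<omega> + (\<omega> * \<kappa>') * \<eta> + (\<eta> * \<kappa>) * \<omega> + \<eta> * \<kappa>' * \<eta>"
      unfolding mult.assoc prod
      by (simp only: distrib_left distrib_right mult.assoc add.assoc add.left_commute)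
    then show "(\<omega> + \<eta>) * (\<kappa> + \<kappa>') * (\<omega> + \<eta>) = \<omega> + \<eta>" by (simp add: gi gi' z1 z2)
    have "(\<kappa> + \<kappa>') * (\<omega> + \<eta>) * (\<kappa> + \<kappa>')
        = \<kappa> * \<omega> * \<kappa> + \<kappa> * (\<omega> * \<kappa>') + \<kappa>' * (\<eta> * \<kappa>) + \<kappa>' * \<eta> * \<kappa>'"
      unfolding prod by (simp only: distrib_left distrib_right mult.assoc add.assoc add.left_commute)
    then show "(\<kappa> + \<kappa>') * (\<omega> + \<eta>) * (\<kappa> + \<kappa>') = \<kappa> + \<kappa>'" by (simp add: gi gi' z1 z2)
    show "(\<omega> + \<eta>) * e0 = 0" by (simp add: distrib_right e0 \<eta>X[OF \<pi>e])
    show "e0 * (\<kappa> + \<kappa>') = 0"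
      by (simp add: distrib_left e0 \<kappa>'_def mult.assoc assoc_rule[OF e\<pi>])
  qed
  moreover obtain s where s: "ftrace (\<kappa>' * \<eta>) = of_nat s" "s = 0 \<longleftrightarrow> \<kappa>' * \<eta> = 0"
  proof -
    have "fshape n n (\<kappa>' * \<eta>)"
      by (rule fshape_times fshape_form[OF \<eta>] fshape_coform[OF \<kappa>'])+
    moreover have "\<kappa>' * \<eta> * (\<kappa>' * \<eta>) = \<kappa>' * \<eta>"
      using arg_cong[OF gi'(2), of "\<lambda>X. X * \<eta>"] by (simp only: mult.assoc)
    ultimately obtain r where "ftrace (\<kappa>' * \<eta>) = of_nat r" "r = 0 \<longleftrightarrow> \<kappa>' * \<eta> = 0"
      by (rule trace_idempotent)
    then show ?thesis by (rule that)
  qed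
  moreover have "s > 0"
  proof (rule ccontr)
    assume "\<not> s > 0"
    then have "\<kappa>' * \<eta> = 0" using s(2) by simp
    then have "\<eta> = 0" using gi'(1) by (simp add: mult.assoc)
    with Z(3) show False by (simp add: \<eta>_def)
  qed
  ultimately show ?thesis
    by (intro that[of "\<omega> + \<eta>" "\<kappa> + \<kappa>'" s]) (simp_all add: prod)
qed

text \<open>A pair of maximal rank cannot be extended. The rank is measured by the trace of
  \<open>\<kappa> * \<omega>\<close> and is at most \<open>n\<close>.\<close>

lemma antisymmetric_pair_exists:
  obtains \<omega> \<kappa> where "antisymmetric_pair \<omega> \<kappa>" "\<kappa> * \<omega> = fidm n - e0"
proof -
  define Q where "Q r \<longleftrightarrow> (\<exists>\<omega> \<kappa>. antisymmetric_pair \<omega> \<kappa> \<and> ftrace (\<kappa> * \<omega>) = of_nat r)" for r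
  have "antisymmetric_pair 0 0"
    by (simp add: antisymmetric_pair_def invariant_form_def invariant_coform_def fshape_intros)
  then have Q0: "Q 0" unfolding Q_def by (intro exI[of _ 0] conjI) simp_all
  have bound: "r \<le> n" if Q: "Q r" for r
  proof -
    obtain \<omega> \<kappa> where *: "antisymmetric_pair \<omega> \<kappa>" "ftrace (\<kappa> * \<omega>) = of_nat r"
      using Q unfolding Q_def by (elim exE conjE)
    obtain r' where "r' \<le> n" "ftrace (\<kappa> * \<omega>) = of_nat r'"
      using antisymmetric_pair_idem[OF *(1)] by (rule trace_idempotent)
    then show ?thesis using *(2) by simp
  qed
  define r where "r = (GREATEST r. Q r)"
  have "Q r" unfolding r_def using Q0 bound by (rule GreatestI_nat)
  then obtain \<omega> \<kappa> where *: "antisymmetric_pair \<omega> \<kappa>" "ftrace (\<kappa> * \<omega>) = of_nat r"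
    unfolding Q_def by (elim exE conjE)
  have "\<kappa> * \<omega> = fidm n - e0"
  proof (rule ccontr)
    assume "\<kappa> * \<omega> \<noteq> fidm n - e0"
    with *(1) obtain \<omega>' \<kappa>' s where s: "antisymmetric_pair \<omega>' \<kappa>'"
        "ftrace (\<kappa>' * \<omega>') = ftrace (\<kappa> * \<omega>) + of_nat s" "s > 0"
      by (rule antisymmetric_pair_extend)
    then have "Q (r + s)" unfolding Q_def using *(2) by (intro exI[of _ \<omega>'] exI[of _ \<kappa>'] conjI) simp_all
    then have "r + s \<le> r" unfolding r_def using bound by (rule Greatest_le_nat)
    with \<open>s > 0\<close> show False by simp
  qed
  with *(1) show ?thesis by (rule that)
qed

end

section \<open>Square classes of regulators\<close>

lemma trivial_square_class_mult:
  "trivial_square_class x \<Longrightarrow> trivial_square_class y \<Longrightarrow> trivial_square_class (x * y)"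
  unfolding trivial_square_class_def by (metis mult_eq_0_iff power_mult_distrib)

lemma trivial_square_class_powi:
  assumes "trivial_square_class x"
  shows "trivial_square_class (x powi m)"
proof -
  obtain c where c: "c \<noteq> 0" "x = c\<^sup>2" using assms unfolding trivial_square_class_def by auto
  have "x powi m = (c powi m)\<^sup>2" by (simp add: c power2_eq_square power_int_mult_distrib)
  then show ?thesis using c unfolding trivial_square_class_def by (intro exI[of _ "c powi m"]) simp
qed

lemma trivial_square_class_1: "trivial_square_class 1"
  unfolding trivial_square_class_def by (intro exI[of _ 1]) simp

lemma trivial_square_class_prod:
  "(\<And>i. i \<in> S \<Longrightarrow> trivial_square_class (f i)) \<Longrightarrow> trivial_square_class (prod f S)"
  by (induction S rule: infinite_finite_induct)
    (simp_all add: trivial_square_class_1 trivial_square_class_mult)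

lemma trivial_square_class_cancel:
  assumes "trivial_square_class (x * y)" "trivial_square_class y"
  shows "trivial_square_class x"
proof -
  obtain c d where c: "c \<noteq> 0" "x * y = c\<^sup>2" and d: "d \<noteq> 0" "y = d\<^sup>2"
    using assms unfolding trivial_square_class_def by auto
  then have "x = (c / d)\<^sup>2" by (simp add: power_divide eq_divide_eq)
  then show ?thesis using c d unfolding trivial_square_class_def by (intro exI[of _ "c / d"]) simp
qed

lemma prod_powi_const:
  fixes x :: "'a::field"
  assumes "x \<noteq> 0"
  shows "(\<Prod>i\<in>S. x powi m i) = x powi (\<Sum>i\<in>S. m i)"
  using assms by (induction S rule: infinite_finite_induct) (simp_all add: power_int_add)

section \<open>Bases of invariants as factorizations of averaging idempotents\<close>

context finite_group_rep
begin

text \<open>A basis of the \<open>H\<close>-invariants, as the columns of \<open>U\<close>, with its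
  coordinate map \<open>W\<close>. In it a form Q has Gram matrix U^T Q U, and an operator A that
  commutes with the group acts by W A U.\<close>

definition factors :: "'a set \<Rightarrow> nat \<Rightarrow> 'k fmat \<Rightarrow> 'k fmat \<Rightarrow> bool" where
  "factors H r U W \<longleftrightarrow> fshape n r U \<and> fshape r n W \<and> U * W = avg H \<and> W * U = fidm r"

lemma factors_exists:
  assumes "subgroup H G"
  obtains r U W where "factors H r U W"
  using idempotent_factorization[OF fshape_avg[OF assms] avg_idem[OF assms]]
  unfolding factors_def by metis

lemma factors_avg:
  assumes "factors H r U W"
  shows "avg H * U = U" "W * avg H = W"
proof -
  have s: "fshape n r U" "fshape r n W" "U * W = avg H" "W * U = fidm r"
    using assms by (simp_all add: factors_def)
  have "avg H * U = U * (W * U)" by (simp only: mult.assoc flip: s(3))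
  then show "avg H * U = U" using fshapeD(2)[OF s(1)] by (simp only: s(4))
  have "W * avg H = W * U * W" by (simp only: mult.assoc flip: s(3))
  then show "W * avg H = W" using fshapeD(1)[OF s(2)] by (simp only: s(4))
qed

end

context odd_self_dual_rep
begin

text \<open>\<open>W * P' * ftr W\<close> inverts the Gram matrix, because the projection to the
  \<open>G\<close>-invariants is self-adjoint for \<open>P\<close>.\<close>

lemma det_fixed_form_nonzero:
  assumes "factors (carrier G) a U W"
  shows "fdet a (ftr U * P * U) \<noteq> 0"
proof -
  have s: "fshape n a U" "fshape a n W" "U * W = e0" "W * U = fidm a"
    using assms by (simp_all add: factors_def)
  have "W * P' * ftr W * (ftr U * P * U) = W * P' * (ftr (U * W) * P) * U"
    by (simp add: mult.assoc)
  also have "\<dots> = W * P' * (P * e0) * U"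
    unfolding s(3) form_avg[OF P subgroup_self] ..
  also have "\<dots> = W * (P' * P) * (e0 * U)" by (simp only: mult.assoc)
  also have "\<dots> = fidm a"
    by (simp add: P'(3) factors_avg[OF assms] fshapeD(2)[OF s(2)] s(4))
  finally have inv: "W * P' * ftr W * (ftr U * P * U) = fidm a" .
  have "fshape a a (ftr U * P * U)"
    by (rule fshape_times s fshape_form[OF P] fshape_intros(6))+
  then have "fdet a (W * P' * ftr W) * fdet a (ftr U * P * U) = 1"
    using fdet_mult[of a "W * P' * ftr W" "ftr U * P * U"] by (simp only: inv fdet_fidm simp_thms)
  then show ?thesis by auto
qed

text \<open>On the image of \<open>avg H\<close> the form \<open>P * e0 + \<omega>\<close> is the orthogonal sum of its restriction to the
  \<open>G\<close>-invariants, which does not depend on \<open>H\<close>, and of a nondegenerate alternating form.\<close>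

lemma adapted_form_determinant:
  assumes pair: "antisymmetric_pair \<omega> \<kappa>" and \<kappa>\<omega>: "\<kappa> * \<omega> = fidm n - e0"
    and H: "subgroup H G" and UW: "factors H r U W" and UW0: "factors (carrier G) a U0 W0"
  obtains c where "even r \<longleftrightarrow> even a" "c \<noteq> 0"
    "fdet r (ftr U * (P * e0 + \<omega>) * U) = c\<^sup>2 * fdet a (ftr U0 * P * U0)"
proof -
  let ?Q = "P * e0 + \<omega>"
  have \<omega>: "invariant_form \<omega>" and \<kappa>: "invariant_coform \<kappa>" and anti: "ftr \<omega> = - \<omega>" "ftr \<kappa> = - \<kappa>"
    and e0: "\<omega> * e0 = 0"
    using pair by (simp_all add: antisymmetric_pair_def)
  define e where "e = avg H"
  \<comment> \<open>The projection onto the complement of the \<open>G\<close>-invariants inside the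
    \<open>H\<close>-invariants.\<close>
  define f where "f = e - e0"
  have se: "fshape n n e" "fshape n n e0" unfolding e_def using H subgroup_self by (auto intro: fshape_avg)
  have ee: "e * e = e" "e0 * e0 = e0" "e * e0 = e0" "e0 * e = e0"
    unfolding e_def using avg_idem[OF H] avg_idem[OF subgroup_self] avg_e0[OF H] .
  have sf: "fshape n n f" unfolding f_def by (intro fshape_intros se)
  have ff: "f * f = f" "e0 * f = 0" "f * e0 = 0"
    by (simp_all add: f_def left_diff_distrib right_diff_distrib ee)
  have f_form: "Q * f = ftr f * Q" if "invariant_form Q" for Q
    unfolding f_def e_def using form_avg[OF that H] form_avg[OF that subgroup_self]
    by (simp add: left_diff_distrib right_diff_distrib)
  obtain b U2 W2 where b: "fshape n b U2" "fshape b n W2" "U2 * W2 = f" "W2 * U2 = fidm b"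
    by (rule idempotent_factorization[OF sf ff(1)])
  have u: "fshape n r U" "fshape r n W" "U * W = e" "W * U = fidm r"
    using UW by (simp_all add: factors_def e_def)
  have u0: "fshape n a U0" "fshape a n W0" "U0 * W0 = e0" "W0 * U0 = fidm a"
    using UW0 by (simp_all add: factors_def)
  note eU = factors_avg[OF UW, folded e_def] and eU0 = factors_avg[OF UW0]
  have fU2: "f * U2 = U2" "W2 * f = W2"
    using fshapeD(2)[OF b(1)] fshapeD(1)[OF b(2)] by (simp_all add: b(4) mult.assoc flip: b(3))
      (simp add: b(4) flip: mult.assoc)
  define S :: "'k fmat" where "S = fshift a b"
  have S: "S * ftr S = fidm b" "ftr S * S = fidm (a + b) - fidm a" "S * fidm a = 0" "fidm a * ftr S = 0"
    unfolding S_def by (rule fshift_simps)+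
  have sS: "fshape b (a + b) S" unfolding S_def by (rule fshape_fshift)
  \<comment> \<open>The basis of the \<open>H\<close>-invariants adapted to this splitting:
    \<open>U0\<close> occupies the first \<open>a\<close> columns and \<open>S\<close> shifts
    \<open>U2\<close> to the last \<open>b\<close>. \<open>X\<close> is the matching coordinate
    map.\<close>
  define V where "V = U0 + U2 * S"
  define X where "X = W0 + ftr S * W2"
  have U0': "fshape n (a + b) U0" "fshape (a + b) n W0"
    using u0 by (auto intro: fshape_mono)
  have sV: "fshape n (a + b) V" "fshape (a + b) n X"
    unfolding V_def X_def by (rule fshape_intros(2,6) U0' fshape_times b sS)+
  have z: "W0 * U2 = 0" "W2 * U0 = 0" "S * W0 = 0" "U0 * ftr S = 0"
  proof -
    have "W0 * U2 = W0 * (e0 * f) * U2" by (simp only: mult.assoc fU2 assoc_rule[OF eU0(2)])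
    then show "W0 * U2 = 0" by (simp add: ff)
    have "W2 * U0 = W2 * (f * e0) * U0" by (simp only: mult.assoc eU0 assoc_rule[OF fU2(2)])
    then show "W2 * U0 = 0" by (simp add: ff)
    show "S * W0 = 0" using fshapeD(1)[OF u0(2)] S(3) by (metis mult.assoc mult_zero_left)
    show "U0 * ftr S = 0" using fshapeD(2)[OF u0(1)] S(4) by (metis mult.assoc mult_zero_right)
  qed
  have VX: "V * X = e"
  proof -
    have "V * X = U0 * W0 + (U0 * ftr S) * W2 + U2 * (S * W0) + U2 * (S * ftr S) * W2"
      unfolding V_def X_def by (simp only: distrib_left distrib_right mult.assoc add.assoc add.left_commute)
    also have "\<dots> = e0 + f" using fshapeD(2)[OF b(1)] by (simp add: z S u0 b)
    finally show ?thesis by (simp add: f_def)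
  qed
  have XV: "X * V = fidm (a + b)"
  proof -
    have "X * V = W0 * U0 + (W0 * U2) * S + ftr S * (W2 * U0) + ftr S * (W2 * U2) * S"
      unfolding V_def X_def by (simp only: distrib_left distrib_right mult.assoc add.assoc add.left_commute)
    also have "\<dots> = fidm a + ftr S * S" using fshapeD(1)[OF sS] by (simp add: z u0 b mult.assoc)
    finally show ?thesis by (simp add: S)
  qed
  have eV: "e * V = V"
  proof -
    have "e * V = V * (X * V)" by (simp only: mult.assoc flip: VX)
    then show ?thesis using fshapeD(2)[OF sV(1)] by (simp add: XV)
  qed
  \<comment> \<open>The change of basis from \<open>V\<close> to the given \<open>U\<close>, with
    inverse \<open>T'\<close>. It alters the Gram determinant by a square.\<close>
  define T where "T = W * V"
  define T' where "T' = X * U"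
  have UT: "U * T = V" unfolding T_def by (simp only: assoc_rule[OF u(3)] eV)
  have T'T: "T' * T = fidm (a + b)"
  proof -
    have "T' * T = X * (U * W) * V" by (simp only: T'_def T_def mult.assoc)
    also have "\<dots> = X * V" by (simp only: u(3) eV mult.assoc)
    finally show ?thesis by (simp only: XV)
  qed
  have TT': "T * T' = fidm r"
  proof -
    have "T * T' = W * (V * X) * U" by (simp only: T'_def T_def mult.assoc)
    also have "\<dots> = W * U" by (simp only: VX eU mult.assoc)
    finally show ?thesis by (simp only: u)
  qed
  have sT: "fshape r (a + b) T" "fshape (a + b) r T'"
    unfolding T_def T'_def by (rule fshape_times u sV)+
  have r: "r = a + b"
    using fidm_factor_le[OF TT' sT(1)] fidm_factor_le[OF T'T sT(2)] by simp
  have Q0: "?Q * U0 = P * U0"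
  proof -
    have "\<omega> * U0 = \<omega> * e0 * U0" by (simp only: mult.assoc eU0)
    then show ?thesis by (simp add: distrib_right mult.assoc eU0 e0)
  qed
  have Q2: "?Q * U2 = \<omega> * U2"
  proof -
    have "e0 * U2 = e0 * f * U2" by (simp only: mult.assoc fU2)
    then show ?thesis by (simp add: distrib_right mult.assoc ff)
  qed
  have z20: "ftr U2 * (P * U0) = 0"
  proof -
    have "ftr U2 = ftr U2 * ftr f" using arg_cong[OF fU2(1), of ftr] by simp
    then have "ftr U2 * (P * U0) = ftr U2 * (ftr f * P) * U0" by (metis mult.assoc)
    also have "\<dots> = ftr U2 * P * (f * e0) * U0"
      by (simp only: f_form[OF P, symmetric] mult.assoc eU0)
    finally show ?thesis by (simp add: ff)
  qed
  have z02: "ftr U0 * (\<omega> * U2) = 0"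
  proof -
    have "\<omega> * U0 = \<omega> * e0 * U0" by (simp only: mult.assoc eU0)
    then have "\<omega> * U0 = 0" by (simp add: e0)
    from arg_cong[OF this, of ftr] have "ftr U0 * \<omega> = 0" by (simp add: anti)
    then show ?thesis by (simp add: assoc_rule)
  qed
  define B where "B = ftr U2 * \<omega> * U2"
  have "ftr T * (ftr U * ?Q * U) * T = ftr (U * T) * (?Q * (U * T))" by (simp add: mult.assoc)
  also have "\<dots> = ftr V * (?Q * V)" by (simp only: UT)
  also have "?Q * V = P * U0 + \<omega> * U2 * S"
    unfolding V_def distrib_left by (simp only: Q0 assoc_rule[OF Q2])
  also have "ftr V * \<dots> = ftr U0 * (P * U0) + (ftr U0 * (\<omega> * U2)) * S
      + ftr S * (ftr U2 * (P * U0)) + ftr S * (ftr U2 * (\<omega> * U2)) * S"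
    unfolding V_def by (simp add: distrib_left distrib_right mult.assoc add.assoc add.left_commute)
  also have "\<dots> = ftr U0 * P * U0 + ftr S * B * S"
    by (simp add: z20 z02 B_def mult.assoc)
  finally have VQV: "ftr T * (ftr U * ?Q * U) * T = ftr U0 * P * U0 + ftr S * B * S" .
  have sB: "fshape b b B" unfolding B_def
    by (rule fshape_times b fshape_form[OF \<omega>] fshape_intros(6))+
  have aB: "ftr B = - B" by (simp add: B_def anti mult.assoc)
  \<comment> \<open>\<open>\<kappa>\<close> inverts \<open>\<omega>\<close> outside the
    \<open>G\<close>-invariants, so its compression inverts the alternating block \<open>B\<close>.
    Hence \<open>b\<close> is even and det B is a square.\<close>
  have invB: "W2 * \<kappa> * ftr W2 * B = fidm b"
  proof -
    have "W2 * \<kappa> * ftr W2 * B = W2 * \<kappa> * (ftr (U2 * W2) * \<omega>) * U2"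
      by (simp add: B_def mult.assoc)
    also have "\<dots> = W2 * (\<kappa> * \<omega>) * f * U2"
      by (simp only: b(3) f_form[OF \<omega>, symmetric] mult.assoc)
    also have "\<dots> = W2 * ((fidm n - e0) * f) * U2" by (simp only: \<kappa>\<omega> mult.assoc)
    also have "(fidm n - e0) * f = f" using fshapeD(1)[OF sf] by (simp add: left_diff_distrib ff)
    also have "W2 * f * U2 = fidm b" by (simp add: fU2 b(4))
    finally show ?thesis .
  qed
  obtain d where d: "even b" "d \<noteq> 0" "fdet b B = d\<^sup>2"
    by (rule fdet_antisymmetric[OF sB aB invB])
  have s0: "fshape a a (ftr U0 * P * U0)"
    by (rule fshape_times u0 fshape_form[OF P] fshape_intros(6))+
  have sT': "fshape r r T" "fshape r r (ftr T)" "fshape r r T'"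
    using sT r fshape_intros(6)[OF sT(1)] by simp_all
  have "fdet r T * fdet r T' = 1" using fdet_mult[of r T T'] sT' by (simp add: TT')
  then have nz: "fdet r T \<noteq> 0" by auto
  have "fdet r T * (fdet r (ftr U * ?Q * U) * fdet r T) = fdet r (ftr T * (ftr U * ?Q * U) * T)"
  proof -
    have "fdet r (ftr T * M * T) = fdet r T * (fdet r M * fdet r T)" for M
      using sT' by (simp add: fdet_mult fdet_ftr mult.assoc)
    then show ?thesis by (rule sym)
  qed
  also have "\<dots> = fdet a (ftr U0 * P * U0) * d\<^sup>2"
    unfolding VQV r S_def fdet_block_diag[OF s0] d(3) ..
  finally have "fdet r (ftr U * ?Q * U) = (d / fdet r T)\<^sup>2 * fdet a (ftr U0 * P * U0)"
    using nz by (simp add: field_simps power2_eq_square)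
  moreover have "d / fdet r T \<noteq> 0" using d nz by simp
  moreover have "even r \<longleftrightarrow> even a" using d r by simp
  ultimately show ?thesis by (intro that)
qed

text \<open>The trace of \<open>L\<close> on the \<open>H\<close>-invariants is the mean over
  \<open>H\<close> of tr(L \<rho>(h)), and x -> tr(L \<rho>(x)) is a class function because
  \<open>L\<close> commutes with the representation.\<close>

lemma sum_traces_relation:
  assumes rel: "G_relation G \<Theta>" and fac: "\<And>i. i < length \<Theta> \<Longrightarrow> factors (fst (\<Theta> ! i)) (r i) (U i) (W i)"
    and L: "\<And>x. x \<in> carrier G \<Longrightarrow> L * \<rho> x = \<rho> x * L"
  shows "(\<Sum>i<length \<Theta>. of_int (snd (\<Theta> ! i)) * ftrace (W i * L * U i)) = 0"
proof -
  have "ftrace (W i * L * U i) = (\<Sum>h\<in>fst (\<Theta> ! i). ftrace (L * \<rho> h)) / of_nat (card (fst (\<Theta> ! i)))"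
    if i: "i < length \<Theta>" for i
  proof -
    have "ftrace (W i * L * U i) = ftrace (L * (U i * W i))"
      using ftrace_comm[of "W i" "L * U i"] by (simp only: mult.assoc)
    also have "U i * W i = avg (fst (\<Theta> ! i))" using fac[OF i] by (simp add: factors_def)
    finally show ?thesis by (simp add: avg_def sum_distrib_left sum_divide_distrib)
  qed
  moreover have "ftrace (L * \<rho> (a \<otimes> x \<otimes> inv a)) = ftrace (L * \<rho> x)"
    if "a \<in> carrier G" "x \<in> carrier G" for a x
  proof -
    have "L * \<rho> (a \<otimes> x \<otimes> inv a) = \<rho> a * (L * \<rho> x * \<rho> (inv a))"
      using that by (simp add: rho_mult assoc_rule[OF L] mult.assoc)
    also have "ftrace \<dots> = ftrace (L * \<rho> x * (\<rho> (inv a) * \<rho> a))"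
      by (subst ftrace_comm) (simp only: mult.assoc)
    finally show ?thesis
      using that fshapeD(2)[OF fshape_rho] by (simp add: rho_inv mult.assoc)
  qed
  ultimately show ?thesis
    using G_relation_class_function[OF rel finite_carrier, of "\<lambda>x. ftrace (L * \<rho> x)"] by simp
qed

text \<open>The constant class function 1 has mean 1 over every subgroup.\<close>

lemma sum_relation_coefficients:
  assumes rel: "G_relation G \<Theta>"
  shows "(\<Sum>i<length \<Theta>. snd (\<Theta> ! i)) = 0"
proof -
  have "(\<Sum>i<length \<Theta>. of_int (snd (\<Theta> ! i)) *
      ((\<Sum>h\<in>fst (\<Theta> ! i). 1) / of_nat (card (fst (\<Theta> ! i))))) = (0 :: 'k)"
    by (rule G_relation_class_function[OF rel finite_carrier]) simp
  moreover have "of_nat (card (fst (\<Theta> ! i))) \<noteq> (0 :: 'k)" if "i < length \<Theta>" for i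
    using rel that by (intro card_subgroup_nonzero) (simp add: G_relation_def)
  then have "(\<Sum>i<length \<Theta>. of_int (snd (\<Theta> ! i)) *
      ((\<Sum>h\<in>fst (\<Theta> ! i). 1) / of_nat (card (fst (\<Theta> ! i)))))
      = (\<Sum>i<length \<Theta>. of_int (snd (\<Theta> ! i)) :: 'k)"
    by (intro sum.cong refl) (simp del: of_nat_eq_0_iff)
  ultimately have "(\<Sum>i<length \<Theta>. of_int (snd (\<Theta> ! i))) = (0 :: 'k)" by simp
  then have "of_int (\<Sum>i<length \<Theta>. snd (\<Theta> ! i)) = (0 :: 'k)" by simp
  then show ?thesis by (simp only: of_int_eq_0_iff)
qed

text \<open>All powers of \<open>A - 1\<close> commute with \<open>G\<close>, so their weighted
  traces cancel, and this determines the weighted product of determinants. Subtracting the identity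
  matches the form 1 + C of \<open>prod_fdet_powi_eq_1\<close>.\<close>

lemma prod_commuting_determinants:
  assumes rel: "G_relation G \<Theta>" and fac: "\<And>i. i < length \<Theta> \<Longrightarrow> factors (fst (\<Theta> ! i)) (r i) (U i) (W i)"
    and A: "fshape n n A" "\<And>x. x \<in> carrier G \<Longrightarrow> A * \<rho> x = \<rho> x * A"
    and nz: "\<And>i. i < length \<Theta> \<Longrightarrow> fdet (r i) (W i * A * U i) \<noteq> 0"
  shows "(\<Prod>i<length \<Theta>. fdet (r i) (W i * A * U i) powi snd (\<Theta> ! i)) = 1"
proof -
  define L where "L = A - fidm n"
  have sL: "fshape n n L" unfolding L_def by (intro fshape_intros fshape_fidm A)
  have L: "L * \<rho> x = \<rho> x * L" if "x \<in> carrier G" for x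
    using A(2)[OF that] fshapeD[OF fshape_rho[OF that]]
    by (simp add: L_def left_diff_distrib right_diff_distrib)
  have Lk: "fpow n L k * \<rho> x = \<rho> x * fpow n L k" if x: "x \<in> carrier G" for x k
  proof (induction k)
    case 0
    then show ?case using fshapeD[OF fshape_rho[OF x]] by simp
  next
    case (Suc k)
    have "fpow n L (Suc k) * \<rho> x = L * (\<rho> x * fpow n L k)" by (simp add: mult.assoc Suc)
    also have "\<dots> = \<rho> x * fpow n L (Suc k)" by (simp add: assoc_rule[OF L[OF x]] mult.assoc)
    finally show ?case .
  qed
  define C where "C i = W i * L * U i" for i
  have s: "fshape n (r i) (U i)" "fshape (r i) n (W i)" "U i * W i = avg (fst (\<Theta> ! i))" "W i * U i = fidm (r i)"
    "subgroup (fst (\<Theta> ! i)) G" if "i < length \<Theta>" for i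
    using fac[OF that] rel that by (simp_all add: factors_def G_relation_def)
  have sC: "fshape (r i) (r i) (C i)" if "i < length \<Theta>" for i
    unfolding C_def by (rule s[OF that] fshape_times sL)+
  have CA: "fidm (r i) + C i = W i * A * U i" if "i < length \<Theta>" for i
    using s[OF that] fshapeD(2)[OF s(2)[OF that]]
    by (simp add: C_def L_def left_diff_distrib right_diff_distrib)
  \<comment> \<open>Restriction to the invariants is multiplicative here: the product
    \<open>U i * W i\<close> between two factors is an averaging idempotent, which commutes with
    \<open>L\<close> and is absorbed by \<open>U i\<close>.\<close>
  have pow: "fpow (r i) (C i) (Suc k) = W i * fpow n L (Suc k) * U i" if i: "i < length \<Theta>" for i k
  proof (induction k)
    case 0
    then show ?case using fshapeD(2)[OF sC[OF i]] fshapeD(2)[OF sL] by (simp add: C_def)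
  next
    case (Suc k)
    have "fpow (r i) (C i) (Suc (Suc k)) = C i * (W i * fpow n L (Suc k) * U i)"
      using Suc by simp
    also have "\<dots> = W i * L * (avg (fst (\<Theta> ! i)) * fpow n L (Suc k)) * U i"
      by (simp only: C_def mult.assoc flip: s(3)[OF i])
    also have "avg (fst (\<Theta> ! i)) * fpow n L (Suc k) = fpow n L (Suc k) * avg (fst (\<Theta> ! i))"
      using avg_commute[OF s(5)[OF i] Lk] by (rule sym)
    also have "W i * L * (fpow n L (Suc k) * avg (fst (\<Theta> ! i))) * U i
        = W i * (L * fpow n L (Suc k)) * (avg (fst (\<Theta> ! i)) * U i)" by (simp only: mult.assoc)
    also have "avg (fst (\<Theta> ! i)) * U i = U i" by (rule factors_avg(1)[OF fac[OF i]])
    finally show ?case by (simp only: fpow.simps)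
  qed
  have "(\<Prod>i\<in>{..<length \<Theta>}. fdet (r i) (fidm (r i) + C i) powi snd (\<Theta> ! i)) = 1"
  proof (rule prod_fdet_powi_eq_1)
    fix k
    have "(\<Sum>i<length \<Theta>. of_int (snd (\<Theta> ! i)) * ftrace (W i * fpow n L (Suc k) * U i)) = 0"
      using Lk by (intro sum_traces_relation[OF rel fac])
    then show "(\<Sum>i<length \<Theta>. of_int (snd (\<Theta> ! i)) * ftrace (fpow (r i) (C i) (Suc k))) = 0"
      using pow by simp
  qed (use sC CA nz in simp_all)
  then show ?thesis using CA by simp
qed

text \<open>The form \<open>P\<close> is exchanged for \<open>Q\<close>, which equals
  \<open>P\<close> on the \<open>G\<close>-invariants and is alternating on the complement. The
  operator \<open>A\<close> that relates them contributes a weighted product equal to 1.\<close>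

lemma regulator_square_class:
  assumes rel: "G_relation G \<Theta>" and fac: "\<And>i. i < length \<Theta> \<Longrightarrow> factors (fst (\<Theta> ! i)) (r i) (U i) (W i)"
    and a: "ftrace e0 = of_nat a"
  shows "trivial_square_class (\<Prod>i<length \<Theta>. fdet (r i) (ftr (U i) * P * U i) powi snd (\<Theta> ! i))"
    and "i < length \<Theta> \<Longrightarrow> even (r i) \<longleftrightarrow> even a"
proof -
  obtain \<omega> \<kappa> where pair: "antisymmetric_pair \<omega> \<kappa>" "\<kappa> * \<omega> = fidm n - e0"
    by (rule antisymmetric_pair_exists)
  have \<omega>: "invariant_form \<omega>" using pair(1) by (simp add: antisymmetric_pair_def)
  obtain b U0 W0 where U0: "factors (carrier G) b U0 W0" by (rule factors_exists[OF subgroup_self])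
  have "ftrace e0 = of_nat b"
    using U0 ftrace_comm[of U0 W0] by (simp add: factors_def)
  then have b: "b = a" using a by simp
  define D0 where "D0 = fdet b (ftr U0 * P * U0)"
  have D0: "D0 \<noteq> 0" unfolding D0_def by (rule det_fixed_form_nonzero[OF U0])
  define Q where "Q = P * e0 + \<omega>"
  have sub: "subgroup (fst (\<Theta> ! i)) G" if "i < length \<Theta>" for i
    using rel that by (simp add: G_relation_def)
  have ex: "\<exists>c. (even (r i) \<longleftrightarrow> even b) \<and> c \<noteq> 0 \<and> fdet (r i) (ftr (U i) * Q * U i) = c\<^sup>2 * D0"
    if i: "i < length \<Theta>" for i
    unfolding Q_def D0_def by (rule adapted_form_determinant[OF pair sub[OF i] fac[OF i] U0]) (intro exI conjI)
  then show "even (r i) \<longleftrightarrow> even a" if "i < length \<Theta>" for i using that b by simp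
  obtain c where c: "\<And>i. i < length \<Theta> \<Longrightarrow> c i \<noteq> 0"
    "\<And>i. i < length \<Theta> \<Longrightarrow> fdet (r i) (ftr (U i) * Q * U i) = (c i)\<^sup>2 * D0"
    using ex by metis
  define A where "A = P' * Q"
  have sQ: "fshape n n Q" unfolding Q_def
    by (rule fshape_intros(2) fshape_times fshape_form[OF P] fshape_form[OF \<omega>] fshape_avg subgroup_self)+
  have sA: "fshape n n A" unfolding A_def by (rule fshape_times P' sQ)+
  have PA: "P * A = Q" using fshapeD(1)[OF sQ] by (simp add: A_def assoc_rule[OF P'(2)])
  have A_rho: "A * \<rho> x = \<rho> x * A" if x: "x \<in> carrier G" for x
  proof -
    have "Q * \<rho> x = ftr (\<rho> (inv x)) * Q"
    proof -
      have "ftr (\<rho> (inv x)) * Q = (ftr (\<rho> (inv x)) * P) * e0 + ftr (\<rho> (inv x)) * \<omega>"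
        by (simp only: Q_def distrib_left mult.assoc)
      also have "\<dots> = P * (\<rho> x * e0) + \<omega> * \<rho> x"
        by (simp only: form_rho[OF P x] form_rho[OF \<omega> x] flip: mult.assoc)
      also have "\<dots> = Q * \<rho> x"
        by (simp only: Q_def rho_avg[OF subgroup_self x] distrib_right mult.assoc)
      finally show ?thesis ..
    qed
    then have "A * \<rho> x = P' * (ftr (\<rho> (inv x)) * (P * P')) * Q"
      using fshapeD(1)[OF sQ] by (simp add: A_def mult.assoc P'(2))
    also have "\<dots> = P' * (P * \<rho> x) * (P' * Q)"
      unfolding form_rho[OF P x] by (simp only: mult.assoc)
    also have "\<dots> = \<rho> x * A"
      using fshapeD(1)[OF fshape_rho[OF x]] by (simp add: A_def assoc_rule[OF P'(3)])
    finally show ?thesis .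
  qed
  \<comment> \<open>\<open>A\<close> maps the \<open>H\<close>-invariants to themselves, so
    \<open>A * U i\<close> equals \<open>U i\<close> times its matrix there.\<close>
  have split: "fdet (r i) (ftr (U i) * Q * U i)
      = fdet (r i) (ftr (U i) * P * U i) * fdet (r i) (W i * A * U i)" if i: "i < length \<Theta>" for i
  proof -
    have s: "fshape n (r i) (U i)" "fshape (r i) n (W i)" "U i * W i = avg (fst (\<Theta> ! i))"
      using fac[OF i] by (simp_all add: factors_def)
    have "A * U i = A * avg (fst (\<Theta> ! i)) * U i"
      by (simp only: mult.assoc factors_avg(1)[OF fac[OF i]])
    also have "\<dots> = avg (fst (\<Theta> ! i)) * A * U i"
      using avg_commute[OF sub[OF i] A_rho] by (rule arg_cong)
    also have "\<dots> = U i * (W i * A * U i)" by (simp only: mult.assoc flip: s(3))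
    finally have "ftr (U i) * Q * U i = ftr (U i) * P * U i * (W i * A * U i)"
      unfolding PA[symmetric] by (simp only: mult.assoc)
    moreover have "fshape (r i) (r i) (ftr (U i) * P * U i)"
      by (rule fshape_times s fshape_form[OF P] fshape_intros(6))+
    ultimately show ?thesis by (simp add: fdet_mult)
  qed
  have nz: "fdet (r i) (W i * A * U i) \<noteq> 0" if "i < length \<Theta>" for i
    using split[OF that] c[OF that] D0 by auto
  have "(\<Prod>i<length \<Theta>. fdet (r i) (ftr (U i) * P * U i) powi snd (\<Theta> ! i))
      = (\<Prod>i<length \<Theta>. fdet (r i) (ftr (U i) * P * U i) powi snd (\<Theta> ! i))
        * (\<Prod>i<length \<Theta>. fdet (r i) (W i * A * U i) powi snd (\<Theta> ! i))"
    using prod_commuting_determinants[OF rel fac sA A_rho nz] by simp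
  also have "\<dots> = (\<Prod>i<length \<Theta>. (c i)\<^sup>2 powi snd (\<Theta> ! i) * D0 powi snd (\<Theta> ! i))"
    using split c(2) by (simp flip: prod.distrib power_int_mult_distrib)
  \<comment> \<open>The determinant \<open>D0\<close> on the \<open>G\<close>-invariants is the same
    for every subgroup, and its total exponent, the sum of the coefficients, is 0.\<close>
  also have "\<dots> = (\<Prod>i<length \<Theta>. (c i)\<^sup>2 powi snd (\<Theta> ! i))"
    by (simp add: prod.distrib prod_powi_const[OF D0] sum_relation_coefficients[OF rel])
  finally have eq: "(\<Prod>i<length \<Theta>. fdet (r i) (ftr (U i) * P * U i) powi snd (\<Theta> ! i)) = \<dots>" .
  have "trivial_square_class ((c i)\<^sup>2)" if "i < length \<Theta>" for i
    using c(1)[OF that] unfolding trivial_square_class_def by (intro exI[of _ "c i"]) simp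
  then show "trivial_square_class (\<Prod>i<length \<Theta>. fdet (r i) (ftr (U i) * P * U i) powi snd (\<Theta> ! i))"
    unfolding eq by (intro trivial_square_class_prod trivial_square_class_powi) simp
qed

text \<open>The exponents \<open>r i\<close> of the scalars all have the parity of \<open>a\<close>,
  the dimension of the \<open>G\<close>-invariants. Modulo squares the scaling thus disappears or
  leaves each scalar once.\<close>

lemma scaled_regulator_square_class:
  fixes \<Theta> :: "('a set \<times> int) list"
  assumes rel: "G_relation G \<Theta>" and fac: "\<And>i. i < length \<Theta> \<Longrightarrow> factors (fst (\<Theta> ! i)) (r i) (U i) (W i)"
    and a: "ftrace e0 = of_nat a"
  defines "c \<equiv> \<lambda>i. 1 / of_nat (card (fst (\<Theta> ! i))) :: 'k"
  defines "D \<equiv> \<Prod>i<length \<Theta>. (c i ^ r i * fdet (r i) (ftr (U i) * P * U i)) powi snd (\<Theta> ! i)"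
  shows "even a \<Longrightarrow> trivial_square_class D"
    and "odd a \<Longrightarrow> trivial_square_class (D * (\<Prod>i<length \<Theta>. c i powi snd (\<Theta> ! i)))"
proof -
  let ?E = "\<Prod>i<length \<Theta>. fdet (r i) (ftr (U i) * P * U i) powi snd (\<Theta> ! i)"
  have E: "trivial_square_class ?E" by (rule regulator_square_class(1)[OF rel fac a])
  have r: "even (r i) \<longleftrightarrow> even a" if "i < length \<Theta>" for i
    using regulator_square_class(2)[OF rel fac a that] .
  have c: "c i \<noteq> 0" if "i < length \<Theta>" for i
    using rel that card_subgroup_nonzero[where 'k = 'k] by (simp add: c_def G_relation_def)
  have even_pow: "trivial_square_class (c i ^ m)" if "i < length \<Theta>" "even m" for i m
    using c[OF that(1)] that(2) unfolding trivial_square_class_def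
    by (intro exI[of _ "c i ^ (m div 2)"]) (simp flip: power_mult)
  have D: "D = (\<Prod>i<length \<Theta>. (c i ^ r i) powi snd (\<Theta> ! i)) * ?E"
    by (simp add: D_def power_int_mult_distrib prod.distrib)
  {
    assume "even a"
    then have "trivial_square_class (\<Prod>i<length \<Theta>. (c i ^ r i) powi snd (\<Theta> ! i))"
      using r by (intro trivial_square_class_prod trivial_square_class_powi even_pow) simp_all
    then show "trivial_square_class D" unfolding D using E by (rule trivial_square_class_mult)
  next
    assume "odd a"
    then have "trivial_square_class (\<Prod>i<length \<Theta>. (c i ^ Suc (r i)) powi snd (\<Theta> ! i))"
      using r by (intro trivial_square_class_prod trivial_square_class_powi even_pow) simp_all
    then have "trivial_square_class ((\<Prod>i<length \<Theta>. (c i ^ Suc (r i)) powi snd (\<Theta> ! i)) * ?E)"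
      using E by (rule trivial_square_class_mult)
    then show "trivial_square_class (D * (\<Prod>i<length \<Theta>. c i powi snd (\<Theta> ! i)))"
      by (simp add: D power_int_mult_distrib prod.distrib ac_simps)
  }
qed

end

section \<open>The regular representation\<close>

text \<open>For the left regular representation with the standard pairing, the indicator vectors of the
  right cosets of \<open>H\<close> are an orthogonal basis of the \<open>H\<close>-invariants, each of norm \<open>|H|\<close>, so that
  all Gram determinants of the scaled pairings are 1.\<close>

lemma (in finite_group) prod_card_square_class:
  assumes odd: "odd (order G)" and rel: "G_relation G \<Theta>"
  shows "trivial_square_class (\<Prod>i<length \<Theta>. (1 / of_nat (card (fst (\<Theta> ! i))) :: 'k::field_char_0) powi snd (\<Theta> ! i))"
proof -
  define N where "N = order G"
  obtain h where h: "bij_betw h {..<N} (carrier G)"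
    using ex_bij_betw_nat_finite[OF finite_carrier] by (auto simp: N_def order_def lessThan_atLeast0)
  have hG: "h i \<in> carrier G" if "i < N" for i using h that by (auto simp: bij_betw_def)
  have h_inj: "h i = h j \<longleftrightarrow> i = j" if "i < N" "j < N" for i j
    using h that by (auto simp: bij_betw_def inj_on_def)
  have sum_h: "(\<Sum>k<N. f (h k)) = (\<Sum>x\<in>carrier G. f x)" for f :: "'a \<Rightarrow> 'k"
    by (rule sum.reindex_bij_betw[OF h])
  \<comment> \<open>The permutation matrix of left multiplication by \<open>x\<close>, with group
    elements numbered by \<open>h\<close>.\<close>
  define \<rho> :: "'a \<Rightarrow> 'k fmat" where "\<rho> x = fmat_of N N (\<lambda>i j. if h i = x \<otimes> h j then 1 else 0)" for x
  have s\<rho>: "fshape N N (\<rho> x)" for x by (simp add: \<rho>_def)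
  have mult: "\<rho> (x \<otimes> y) = \<rho> x * \<rho> y" if xy: "x \<in> carrier G" "y \<in> carrier G" for x y
  proof (rule fmat_eqI)
    fix i j
    show "entry (\<rho> (x \<otimes> y)) i j = entry (\<rho> x * \<rho> y) i j"
    proof (cases "i < N \<and> j < N")
      case True
      have "entry (\<rho> x * \<rho> y) i j
          = (\<Sum>k<N. (if h i = x \<otimes> h k then 1 else 0) * (if h k = y \<otimes> h j then 1 else 0))"
        unfolding entry_times[OF s\<rho>] using True by (simp add: \<rho>_def)
      also have "\<dots> = (\<Sum>z\<in>carrier G. (if h i = x \<otimes> z then 1 else 0) * (if z = y \<otimes> h j then 1 else 0))"
        by (rule sum_h)
      also have "\<dots> = (\<Sum>z\<in>carrier G. if z = y \<otimes> h j then if h i = x \<otimes> z then 1 else 0 else 0)"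
        by (intro sum.cong refl) simp
      also have "\<dots> = (if h i = x \<otimes> (y \<otimes> h j) then 1 else 0)"
        using finite_carrier xy True hG by simp
      also have "\<dots> = entry (\<rho> (x \<otimes> y)) i j"
        using True xy hG by (simp add: \<rho>_def m_assoc)
      finally show ?thesis ..
    next
      case False
      then show ?thesis using s\<rho>[of "x \<otimes> y"] fshape_times[OF s\<rho>[of x] s\<rho>[of y]] by (auto simp: fshape_def)
    qed
  qed
  have one: "\<rho> \<one> = fidm N"
    by (rule fmat_eqI) (auto simp: \<rho>_def hG h_inj)
  have orth: "ftr (\<rho> x) * fidm N * \<rho> x = fidm N" if x: "x \<in> carrier G" for x
  proof -
    have "entry (ftr (\<rho> x) * \<rho> x) i j = entry (fidm N) i j" for i j
    proof (cases "i < N \<and> j < N")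
      case True
      have "entry (ftr (\<rho> x) * \<rho> x) i j
          = (\<Sum>k<N. (if h k = x \<otimes> h i then 1 else 0) * (if h k = x \<otimes> h j then 1 else 0))"
        unfolding entry_times2[OF s\<rho>] using True by (simp add: \<rho>_def)
      also have "\<dots> = (\<Sum>z\<in>carrier G. (if z = x \<otimes> h i then 1 else 0) * (if z = x \<otimes> h j then 1 else 0))"
        by (rule sum_h)
      also have "\<dots> = (\<Sum>z\<in>carrier G. if z = x \<otimes> h i then if i = j then 1 else 0 else 0)"
        using True x hG h_inj by (intro sum.cong refl) simp
      also have "\<dots> = entry (fidm N) i j"
        using finite_carrier x True hG by simp
      finally show ?thesis .
    next
      case False
      have "fshape N N (ftr (\<rho> x) * \<rho> x)" by (rule fshape_times fshape_intros(6) s\<rho>)+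
      then show ?thesis using False by (auto simp: fshape_def)
    qed
    then have "ftr (\<rho> x) * \<rho> x = fidm N" by (rule fmat_eqI)
    then show ?thesis using fshapeD(1)[OF s\<rho>] by (simp add: mult.assoc)
  qed
  interpret R: odd_self_dual_rep G N \<rho> "fidm N" "fidm N"
  proof unfold_locales
    show "finite_group_rep.invariant_form G N \<rho> (fidm N)"
    proof -
      interpret finite_group_rep G N \<rho> by unfold_locales (use one mult in simp_all)
      show ?thesis by (simp add: invariant_form_def orth)
    qed
  qed (use one mult odd in simp_all)
  have trace: "ftrace (\<rho> x) = (if x = \<one> then of_nat N else 0)" if x: "x \<in> carrier G" for x
  proof -
    have "ftrace (\<rho> x) = (\<Sum>i<N. if h i = x \<otimes> h i then 1 else 0)"
      unfolding ftrace_eq[OF s\<rho>] by (simp add: \<rho>_def)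
    also have "\<dots> = (\<Sum>i<N. if x = \<one> then 1 else 0)"
      using x hG by (intro sum.cong refl) (simp add: r_cancel_one')
    finally show ?thesis by simp
  qed
  \<comment> \<open>Only the identity has nonzero trace, namely |G|, so the invariants have
    dimension 1; the odd case of the general formula applies.\<close>
  have a: "ftrace (R.avg (carrier G)) = of_nat 1"
  proof -
    have "(\<Sum>x\<in>carrier G. ftrace (\<rho> x)) = (\<Sum>x\<in>carrier G. if x = \<one> then of_nat N else 0)"
      by (rule sum.cong[OF refl]) (rule trace)
    also have "\<dots> = of_nat N" using finite_carrier by simp
    finally show ?thesis
      using order_nonzero[where 'k = 'k] by (simp add: R.avg_def N_def order_def)
  qed
  have ex: "\<exists>r U W. R.factors H r U W \<and> ftr U * fidm N * U = fscale (of_nat (card H)) (fidm r)"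
    if H: "subgroup H G" for H
  proof -
    interpret H: subgroup H G by fact
    define r where "r = card (rcosets H)"
    have fin: "finite (rcosets H)" using finite_carrier by (simp add: RCOSETS_def)
    obtain q where q: "bij_betw q {..<r} (rcosets H)"
      using ex_bij_betw_nat_finite[OF fin] by (auto simp: r_def lessThan_atLeast0)
    have qc: "q j \<in> rcosets H" if "j < r" for j using q that by (auto simp: bij_betw_def)
    have q_sub: "q j \<subseteq> carrier G" if "j < r" for j
      using H.rcosets_carrier[OF is_group qc[OF that]] .
    have card_q: "card (q j) = card H" if "j < r" for j
      using card_rcosets_equal[OF qc[OF that] H.subset] by simp
    have card0: "of_nat (card H) \<noteq> (0 :: 'k)" using H by (rule card_subgroup_nonzero)
    define U :: "'k fmat" where "U = fmat_of N r (\<lambda>i j. if h i \<in> q j then 1 else 0)"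
    define W where "W = fscale (1 / of_nat (card H)) (ftr U)"
    have sU: "fshape N r U" by (simp add: U_def)
    have sW: "fshape r N W" unfolding W_def by (intro fshape_intros sU)
    have UU: "ftr U * U = fscale (of_nat (card H)) (fidm r)"
    proof (rule fmat_eqI)
      fix j l
      show "entry (ftr U * U) j l = entry (fscale (of_nat (card H)) (fidm r)) j l"
      proof (cases "j < r \<and> l < r")
        case True
        have "entry (ftr U * U) j l = (\<Sum>k<N. (if h k \<in> q j then 1 else 0) * (if h k \<in> q l then 1 else 0))"
          unfolding entry_times2[OF sU] using True by (simp add: U_def)
        also have "\<dots> = (\<Sum>z\<in>carrier G. (if z \<in> q j then 1 else 0) * (if z \<in> q l then 1 else 0))"
          by (rule sum_h)
        also have "\<dots> = (\<Sum>z\<in>carrier G. if z \<in> q j \<inter> q l then 1 else 0)"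
          by (intro sum.cong refl) simp
        also have "\<dots> = of_nat (card (carrier G \<inter> (q j \<inter> q l)))"
          using finite_carrier by (simp add: sum.If_cases flip: Int_def)
        also have "carrier G \<inter> (q j \<inter> q l) = (if j = l then q j else {})"
        proof (cases "j = l")
          case True
          then show ?thesis using q_sub[of j] \<open>j < r \<and> l < r\<close> by auto
        next
          case False
          then have "q j \<noteq> q l" using q \<open>j < r \<and> l < r\<close> by (auto simp: bij_betw_def inj_on_def)
          then have "q j \<inter> q l = {}"
            using rcos_disjoint[OF H] qc \<open>j < r \<and> l < r\<close> by (auto simp: pairwise_def disjnt_def)
          then show ?thesis using False by simp
        qed
        finally show ?thesis using True card_q by simp
      next
        case False
        have "fshape r r (ftr U * U)" by (rule fshape_times fshape_intros(6) sU)+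
        then show ?thesis using False by (auto simp: fshape_def)
      qed
    qed
    have WU: "W * U = fidm r" using card0 by (simp add: W_def UU)
    have hU: "\<rho> y * U = U" if y: "y \<in> H" for y
    proof (rule fmat_eqI)
      fix i j
      show "entry (\<rho> y * U) i j = entry U i j"
      proof (cases "i < N \<and> j < r")
        case True
        have yG: "y \<in> carrier G" using y by simp
        have "entry (\<rho> y * U) i j = (\<Sum>k<N. (if h i = y \<otimes> h k then 1 else 0) * (if h k \<in> q j then 1 else 0))"
          unfolding entry_times[OF s\<rho>] using True by (simp add: \<rho>_def U_def)
        also have "\<dots> = (\<Sum>z\<in>carrier G. (if h i = y \<otimes> z then 1 else 0) * (if z \<in> q j then 1 else 0))"
          by (rule sum_h)
        also have "\<dots> = (\<Sum>z\<in>carrier G. if z = inv y \<otimes> h i then if inv y \<otimes> h i \<in> q j then 1 else 0 else 0)"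
        proof (rule sum.cong[OF refl])
          fix z assume z: "z \<in> carrier G"
          have "h i = y \<otimes> z \<longleftrightarrow> z = inv y \<otimes> h i"
            using inv_solve_left[OF z yG hG[of i]] True by auto
          then show "(if h i = y \<otimes> z then 1 else 0) * (if z \<in> q j then 1 else 0)
              = (if z = inv y \<otimes> h i then if inv y \<otimes> h i \<in> q j then 1 else 0 else (0 :: 'k))"
            by simp
        qed
        also have "\<dots> = (if inv y \<otimes> h i \<in> q j then 1 else 0)"
          using finite_carrier yG hG True by simp
        \<comment> \<open>Left multiplication by elements of \<open>H\<close> preserves the right
          cosets of \<open>H\<close>.\<close>
        also have "inv y \<otimes> h i \<in> q j \<longleftrightarrow> h i \<in> q j"
        proof -
          obtain b where b: "b \<in> carrier G" "q j = H #> b" using qc[of j] True by (auto simp: RCOSETS_def)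
          have closed: "x \<otimes> g \<in> H #> b" if g: "g \<in> H #> b" and x: "x \<in> H" for x g
          proof -
            obtain k where k: "k \<in> H" "g = k \<otimes> b" using g by (auto simp: r_coset_def)
            have "x \<otimes> g = (x \<otimes> k) \<otimes> b" using b x k by (simp add: m_assoc)
            moreover have "x \<otimes> k \<in> H" using x k by simp
            ultimately show ?thesis unfolding r_coset_def by blast
          qed
          have "y \<otimes> (inv y \<otimes> h i) = h i" using yG hG True by (simp flip: m_assoc)
          then show ?thesis
            unfolding b(2) using closed[of "inv y \<otimes> h i" y] closed[of "h i" "inv y"] y by auto
        qed
        finally show ?thesis using True by (simp add: U_def)
      next
        case False
        have "fshape N r (\<rho> y * U)" by (rule fshape_times s\<rho> sU)+
        then show ?thesis using False sU by (auto simp: fshape_def)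
      qed
    qed
    have avgU: "R.avg H * U = U" by (rule R.avg_absorb[OF H hU])
    have savg: "fshape N N (R.avg H)" by (rule R.fshape_avg[OF H])
    have sym: "ftr (R.avg H) = R.avg H"
      using R.form_avg[OF R.P H] fshapeD[OF savg] fshapeD(2)[OF fshape_intros(6)[OF savg]] by simp
    \<comment> \<open>\<open>U * W\<close> projects onto the span of the indicator vectors, inside
      the \<open>H\<close>-invariants. The defect is idempotent with trace |G|/|H| minus the number
      of cosets, which is 0; thus the indicators span all invariants.\<close>
    define E where "E = R.avg H - U * W"
    have symUW: "ftr (U * W) = U * W" by (simp add: W_def)
    have aUW: "R.avg H * (U * W) = U * W" by (rule assoc_rule[OF avgU])
    have UWa: "U * W * R.avg H = U * W" using arg_cong[OF aUW, of ftr] by (simp only: ftr_times[of "R.avg H"] symUW sym)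
    have UWUW: "U * W * (U * W) = U * W"
    proof -
      have "U * W * (U * W) = U * (W * U) * W" by (simp only: mult.assoc)
      then show ?thesis using fshapeD(2)[OF sU] by (simp only: WU)
    qed
    have EE: "E * E = E"
      by (simp only: E_def left_diff_distrib right_diff_distrib aUW UWa UWUW R.avg_idem[OF H]) simp
    have sE: "fshape N N E" unfolding E_def by (rule fshape_intros(3) savg fshape_times sU sW)+
    have "ftrace (R.avg H) = of_nat N / of_nat (card H)"
    proof -
      have "(\<Sum>x\<in>H. ftrace (\<rho> x)) = (\<Sum>x\<in>H. if x = \<one> then of_nat N else 0)"
        by (rule sum.cong[OF refl]) (simp add: trace)
      also have "\<dots> = of_nat N"
        using finite_subset[OF H.subset finite_carrier] by simp
      finally show ?thesis by (simp add: R.avg_def)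
    qed
    moreover have "ftrace (U * W) = of_nat r" using ftrace_comm[of U W] by (simp add: WU)
    moreover have "(of_nat N :: 'k) = of_nat r * of_nat (card H)"
      using lagrange[OF H] by (simp add: N_def r_def flip: of_nat_mult)
    ultimately have "ftrace E = 0" using card0 by (simp add: E_def)
    then have "E = 0" using trace_idempotent[OF sE EE] by (metis of_nat_eq_0_iff)
    then have "R.factors H r U W" unfolding R.factors_def using sU sW WU by (simp add: E_def)
    moreover have "ftr U * fidm N * U = fscale (of_nat (card H)) (fidm r)"
      using UU fshapeD(1)[OF sU] by (simp add: mult.assoc)
    ultimately show ?thesis by (intro exI conjI)
  qed
  have sub: "subgroup (fst (\<Theta> ! i)) G" if "i < length \<Theta>" for i
    using rel that by (simp add: G_relation_def)
  obtain r U W where rUW: "\<And>i. i < length \<Theta> \<Longrightarrow> R.factors (fst (\<Theta> ! i)) (r i) (U i) (W i)"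
    "\<And>i. i < length \<Theta> \<Longrightarrow> ftr (U i) * fidm N * U i = fscale (of_nat (card (fst (\<Theta> ! i)))) (fidm (r i))"
    using ex[OF sub] by metis
  have "(1 / of_nat (card (fst (\<Theta> ! i)))) ^ r i * fdet (r i) (ftr (U i) * fidm N * U i) = 1"
    if "i < length \<Theta>" for i
    using card_subgroup_nonzero[OF sub[OF that], where 'k = 'k]
    by (simp add: rUW(2)[OF that] fdet_fscale power_divide)
  \<comment> \<open>The scaled regulator is 1, so in the odd case only the product of the scalars
    remains in the formula.\<close>
  then show ?thesis
    using R.scaled_regulator_square_class(2)[OF rel rUW(1) a] by simp
qed

section \<open>Coordinates\<close>

text \<open>Translates vectors indexed by a finite type into columns indexed by numbers;
  \<open>u\<close> is meant to enumerate the index type.\<close>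

definition fmat_of_cols :: "(nat \<Rightarrow> 'n) \<Rightarrow> nat \<Rightarrow> (nat \<Rightarrow> 'k::field ^'n) \<Rightarrow> 'k fmat" where
  "fmat_of_cols u r f = fmat_of CARD('n::finite) r (\<lambda>i j. vec_nth (f j) (u i))"

definition fmat_of_pairing :: "(nat \<Rightarrow> 'n) \<Rightarrow> ('k::field ^'n \<Rightarrow> 'k^'n \<Rightarrow> 'k) \<Rightarrow> 'k fmat" where
  "fmat_of_pairing u \<beta> = fmat_of CARD('n::finite) CARD('n) (\<lambda>i j. \<beta> (axis (u i) 1) (axis (u j) 1))"

lemma bilinear_pairing_sum:
  assumes "bilinear_pairing \<beta>" "finite S"
  shows "\<beta> (\<Sum>a\<in>S. c a *s g a) w = (\<Sum>a\<in>S. c a * \<beta> (g a) w)"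
    and "\<beta> w (\<Sum>a\<in>S. c a *s g a) = (\<Sum>a\<in>S. c a * \<beta> w (g a))"
proof -
  have l: "\<beta> (a *s u + b *s v) w = a * \<beta> u w + b * \<beta> v w" for a b u v w
    using assms(1) unfolding bilinear_pairing_def by blast
  have r: "\<beta> w (a *s u + b *s v) = a * \<beta> w u + b * \<beta> w v" for a b u v w
    using assms(1) unfolding bilinear_pairing_def by blast
  have zero: "\<beta> 0 w = 0" "\<beta> w 0 = 0" for w
    using l[of 0 0 0 0 w] r[of w 0 0 0 0] by simp_all
  have add: "\<beta> (a *s u + v) w = a * \<beta> u w + \<beta> v w" "\<beta> w (a *s u + v) = a * \<beta> w u + \<beta> w v" for a u v w
    using l[of a u 1 v w] r[of w a u 1 v] by simp_all
  show "\<beta> (\<Sum>a\<in>S. c a *s g a) w = (\<Sum>a\<in>S. c a * \<beta> (g a) w)"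
    using assms(2) by (induction S rule: finite_induct) (simp_all add: zero add)
  show "\<beta> w (\<Sum>a\<in>S. c a *s g a) = (\<Sum>a\<in>S. c a * \<beta> w (g a))"
    using assms(2) by (induction S rule: finite_induct) (simp_all add: zero add)
qed

lemma bilinear_pairing_expand:
  fixes \<beta> :: "'k::field ^'n::finite \<Rightarrow> 'k^'n \<Rightarrow> 'k"
  assumes "bilinear_pairing \<beta>"
  shows "\<beta> v w = (\<Sum>a\<in>UNIV. vec_nth v a * (\<Sum>b\<in>UNIV. \<beta> (axis a 1) (axis b 1) * vec_nth w b))"
proof -
  have 1: "\<beta> v w = (\<Sum>a\<in>UNIV. vec_nth v a * \<beta> (axis a 1) w)" for v
    using bilinear_pairing_sum(1)[OF assms finite, of "vec_nth v" "\<lambda>a. axis a 1" UNIV w]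
    by (simp only: basis_expansion)
  have 2: "\<beta> x w = (\<Sum>b\<in>UNIV. \<beta> x (axis b 1) * vec_nth w b)" for x
    using bilinear_pairing_sum(2)[OF assms finite, of x "vec_nth w" "\<lambda>a. axis a 1" UNIV]
    by (simp only: basis_expansion mult.commute)
  show ?thesis by (subst 1, subst 2) (rule refl)
qed

section \<open>Gram matrices and basis lists in coordinates\<close>

locale vec_enum =
  fixes u :: "nat \<Rightarrow> 'n::finite"
  assumes enum: "bij_betw u {..<CARD('n)} UNIV"
begin

lemma sum_enum: "(\<Sum>k<CARD('n). f (u k)) = (\<Sum>a\<in>UNIV. f a)"
  by (rule sum.reindex_bij_betw[OF enum])

lemma enum_inj: "i < CARD('n) \<Longrightarrow> j < CARD('n) \<Longrightarrow> u i = u j \<longleftrightarrow> i = j"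
  using enum by (auto simp: bij_betw_def inj_on_def)

lemma enum_surj: obtains i where "i < CARD('n)" "u i = a"
  using enum by (metis UNIV_I bij_betw_def imageE lessThan_iff)

lemma fshape_cols: "fshape CARD('n) r (fmat_of_cols u r f)"
  by (simp add: fmat_of_cols_def)

lemma fshape_pairing: "fshape CARD('n) CARD('n) (fmat_of_pairing u \<beta>)"
  by (simp add: fmat_of_pairing_def)

lemma cols_eqI: "(\<And>j. j < r \<Longrightarrow> f j = g j) \<Longrightarrow> fmat_of_cols u r f = fmat_of_cols u r g"
  by (rule fmat_eqI) (simp add: fmat_of_cols_def)

lemma cols_eqD:
  assumes "fmat_of_cols u r f = fmat_of_cols u r g" "j < r"
  shows "f j = g j"
proof (rule vec_eq_iff[THEN iffD2], rule allI)
  fix a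
  obtain i where i: "i < CARD('n)" "u i = a" by (rule enum_surj)
  have "entry (fmat_of_cols u r f) i j = entry (fmat_of_cols u r g) i j" by (simp only: assms(1))
  then show "vec_nth (f j) a = vec_nth (g j) a" using i assms(2) by (simp add: fmat_of_cols_def)
qed

lemma cols_exist:
  assumes "fshape CARD('n) r A"
  obtains f where "A = fmat_of_cols u r f"
proof
  define v where "v j = vec_lambda (\<lambda>a. entry A (inv_into {..<CARD('n)} u a) j)" for j
  show "A = fmat_of_cols u r v"
  proof (rule fmat_eqI)
    fix i j
    have "inv_into {..<CARD('n)} u (u i) = i" if "i < CARD('n)"
      using enum that by (intro inv_into_f_f) (auto simp: bij_betw_def)
    then show "entry A i j = entry (fmat_of_cols u r v) i j"
      using assms by (auto simp: fmat_of_cols_def v_def fshape_def)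
  qed
qed

lemma gram_cols:
  assumes "bilinear_pairing \<beta>" "i < r" "j < s"
  shows "entry (ftr (fmat_of_cols u r f) * fmat_of_pairing u \<beta> * fmat_of_cols u s g) i j = \<beta> (f i) (g j)"
proof -
  have "entry (ftr (fmat_of_cols u r f) * (fmat_of_pairing u \<beta> * fmat_of_cols u s g)) i j
      = (\<Sum>k<CARD('n). entry (fmat_of_cols u r f) k i * entry (fmat_of_pairing u \<beta> * fmat_of_cols u s g) k j)"
    using entry_times[OF fshape_intros(6)[OF fshape_cols[of r f]]] by simp
  also have "\<dots> = (\<Sum>k<CARD('n). vec_nth (f i) (u k) *
      (\<Sum>l<CARD('n). \<beta> (axis (u k) 1) (axis (u l) 1) * vec_nth (g j) (u l)))"
    unfolding entry_times[OF fshape_pairing] using assms(2,3)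
    by (intro sum.cong refl) (simp add: fmat_of_cols_def fmat_of_pairing_def)
  also have "\<dots> = (\<Sum>k<CARD('n). vec_nth (f i) (u k) *
      (\<Sum>b\<in>UNIV. \<beta> (axis (u k) 1) (axis b 1) * vec_nth (g j) b))"
    by (intro sum.cong refl arg_cong2[of _ _ _ _ "(*)"]) (rule sum_enum)
  also have "\<dots> = (\<Sum>a\<in>UNIV. vec_nth (f i) a *
      (\<Sum>b\<in>UNIV. \<beta> (axis a 1) (axis b 1) * vec_nth (g j) b))"
    by (rule sum_enum)
  also have "\<dots> = \<beta> (f i) (g j)" by (rule bilinear_pairing_expand[OF assms(1), symmetric])
  finally show ?thesis by (simp add: mult.assoc)
qed

lemma cols_matrix_times:
  "fmat_of_cols u CARD('n) (\<lambda>j. A *v axis (u j) 1) * fmat_of_cols u r f = fmat_of_cols u r (\<lambda>j. A *v f j)"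
proof (rule fmat_eqI)
  fix i j
  have A: "vec_nth (A *v axis b 1) a = vec_nth (vec_nth A a) b" for a b
    by (simp add: matrix_vector_mult_def axis_def if_distrib[of "\<lambda>x. _ * x"] cong: if_cong)
  show "entry (fmat_of_cols u CARD('n) (\<lambda>j. A *v axis (u j) 1) * fmat_of_cols u r f) i j
      = entry (fmat_of_cols u r (\<lambda>j. A *v f j)) i j"
  proof (cases "i < CARD('n) \<and> j < r")
    case True
    then have "entry (fmat_of_cols u CARD('n) (\<lambda>j. A *v axis (u j) 1) * fmat_of_cols u r f) i j
        = (\<Sum>k<CARD('n). vec_nth (vec_nth A (u i)) (u k) * vec_nth (f j) (u k))"
      unfolding entry_times[OF fshape_cols] by (simp add: fmat_of_cols_def A)
    also have "\<dots> = (\<Sum>b\<in>UNIV. vec_nth (vec_nth A (u i)) b * vec_nth (f j) b)" by (rule sum_enum)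
    finally show ?thesis using True by (simp add: fmat_of_cols_def matrix_vector_mult_def)
  next
    case False
    then show ?thesis
      using fshape_times[OF fshape_cols[of "CARD('n)"] fshape_cols[of r f]] fshape_cols[of r]
      unfolding fshape_def by (metis not_le)
  qed
qed

lemma cols_id: "fmat_of_cols u CARD('n) (\<lambda>j. axis (u j) 1) = fidm CARD('n)"
  by (rule fmat_eqI) (auto simp: fmat_of_cols_def axis_def enum_inj)

lemma cols_times:
  fixes f :: "nat \<Rightarrow> 'k::field ^'n"
  assumes "fshape r s M"
  shows "fmat_of_cols u r f * M = fmat_of_cols u s (\<lambda>j. \<Sum>l<r. entry M l j *s f l)"
proof (rule fmat_eqI)
  fix i j
  show "entry (fmat_of_cols u r f * M) i j = entry (fmat_of_cols u s (\<lambda>j. \<Sum>l<r. entry M l j *s f l)) i j"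
    unfolding entry_times[OF fshape_cols] using assms
    by (auto simp: fmat_of_cols_def fshape_def mult.commute)
qed

text \<open>For a generalized inverse P' the rows of 1 - P P' pair to 0 with every vector and vanish
  by nondegeneracy in the left argument. The other side follows because the matrices are
  square.\<close>

lemma pairing_right_inverse:
  fixes \<beta> :: "'k::field_char_0 ^'n \<Rightarrow> 'k^'n \<Rightarrow> 'k"
  assumes bil: "bilinear_pairing \<beta>" and nd: "nondegenerate \<beta>"
  obtains P' where "fshape CARD('n) CARD('n) P'" "fmat_of_pairing u \<beta> * P' = fidm CARD('n)"
    "P' * fmat_of_pairing u \<beta> = fidm CARD('n)"
proof -
  let ?P = "fmat_of_pairing u \<beta>" and ?n = "CARD('n)"
  obtain k X Y where XY: "fshape k ?n X" "fshape ?n k Y" "?P * Y * X * ?P = ?P"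
    by (rule rank_factorization[OF fshape_pairing])
  define P' where "P' = Y * X"
  have s: "fshape ?n ?n P'" unfolding P'_def using XY(2,1) by (rule fshape_times)
  define E where "E = fidm ?n - ?P * P'"
  have sE: "fshape ?n ?n E"
    unfolding E_def by (rule fshape_intros(3) fshape_fidm fshape_times fshape_pairing s)+
  have EP: "E * ?P = 0"
    using XY(3) fshapeD(1)[OF fshape_pairing] by (simp add: E_def P'_def left_diff_distrib mult.assoc)
  obtain v where v: "ftr E = fmat_of_cols u ?n v"
    by (rule cols_exist[OF fshape_intros(6)[OF sE]])
  have E: "E = ftr (fmat_of_cols u ?n v)" using arg_cong[OF v, of ftr] by simp
  have "v i = 0" if i: "i < ?n" for i
  proof -
    have "\<beta> (v i) w = 0" for w
    proof -
      have "\<beta> (v i) w = entry (E * ?P * fmat_of_cols u 1 (\<lambda>_. w)) i 0"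
        unfolding E using i by (intro gram_cols[OF bil, symmetric]) simp_all
      then show ?thesis by (simp add: EP)
    qed
    then show ?thesis using nd unfolding nondegenerate_def by blast
  qed
  then have "fmat_of_cols u ?n v = fmat_of_cols u ?n (\<lambda>_. 0)" by (rule cols_eqI)
  also have "\<dots> = 0" by (rule fmat_eqI) (simp add: fmat_of_cols_def)
  finally have "E = 0" by (simp add: E)
  then have "?P * P' = fidm ?n" by (simp add: E_def)
  then show ?thesis
    using that[OF s] left_inverse_imp_right_inverse[OF s fshape_pairing] by blast
qed

text \<open>The columns of \<open>e\<close> lie in the span of the list, which gives
  \<open>W\<close> with U W = e. As \<open>e\<close> fixes U, the columns of W U - 1 are linear
  relations between independent vectors and vanish.\<close>

lemma basis_list_factorization:
  fixes bs :: "('k::field ^'n) list"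
  assumes basis: "is_basis_list V bs" and e: "fshape CARD('n) CARD('n) e"
    and im: "\<forall>f. e = fmat_of_cols u CARD('n) f \<longrightarrow> (\<forall>j<CARD('n). f j \<in> V)"
    and fixed: "e * fmat_of_cols u (length bs) ((!) bs) = fmat_of_cols u (length bs) ((!) bs)"
  obtains W where "fshape (length bs) CARD('n) W" "fmat_of_cols u (length bs) ((!) bs) * W = e"
    "W * fmat_of_cols u (length bs) ((!) bs) = fidm (length bs)"
proof -
  let ?r = "length bs" and ?n = "CARD('n)"
  let ?U = "fmat_of_cols u ?r ((!) bs)"
  have bs: "distinct bs" "vec.independent (set bs)" "vec.span (set bs) = V"
    using basis by (simp_all add: is_basis_list_def)
  have nth: "bij_betw ((!) bs) {..<?r} (set bs)" using bs(1) by (rule bij_betw_nth) simp_all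
  obtain f where f: "e = fmat_of_cols u ?n f" by (rule cols_exist[OF e])
  have "\<exists>c. f j = (\<Sum>l<?r. c l *s bs ! l)" if j: "j < ?n" for j
  proof -
    have "f j \<in> vec.span (set bs)" using im f j bs(3) by simp
    then obtain c where "f j = (\<Sum>x\<in>set bs. c x *s x)"
      unfolding vec.span_finite[OF finite_set] by blast
    also have "\<dots> = (\<Sum>l<?r. c (bs ! l) *s bs ! l)"
      by (rule sum.reindex_bij_betw[OF nth, symmetric])
    finally show ?thesis by (rule exI[of _ "\<lambda>l. c (bs ! l)"])
  qed
  then obtain c where c: "\<And>j. j < ?n \<Longrightarrow> f j = (\<Sum>l<?r. c j l *s bs ! l)" by metis
  define W where "W = fmat_of ?r ?n (\<lambda>l j. c j l)"
  have sW: "fshape ?r ?n W" by (simp add: W_def)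
  have UW: "?U * W = e"
    unfolding cols_times[OF sW] f using c by (intro cols_eqI) (simp add: W_def)
  define M where "M = W * ?U - fidm ?r"
  have sM: "fshape ?r ?r M"
    unfolding M_def by (rule fshape_intros(3) fshape_fidm fshape_times sW fshape_cols)+
  have "?U * M = 0"
    using fixed fshapeD(2)[OF fshape_cols[of ?r "(!) bs"]]
    by (simp add: M_def right_diff_distrib UW flip: mult.assoc)
  then have UM: "fmat_of_cols u ?r (\<lambda>j. \<Sum>l<?r. entry M l j *s bs ! l) = fmat_of_cols u ?r (\<lambda>_. 0)"
    unfolding cols_times[OF sM] by (simp add: fmat_of_cols_def fmat_eq_iff)
  have "entry M l j = 0" if "l < ?r" "j < ?r" for l j
  proof -
    define g where "g x = entry M (inv_into {..<?r} ((!) bs) x) j" for x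
    have g: "g (bs ! k) = entry M k j" if "k < ?r" for k
      unfolding g_def using nth that by (subst inv_into_f_f) (auto simp: bij_betw_def)
    have "(\<Sum>x\<in>set bs. g x *s x) = (\<Sum>k<?r. g (bs ! k) *s bs ! k)"
      by (rule sum.reindex_bij_betw[OF nth, symmetric])
    also have "\<dots> = (\<Sum>k<?r. entry M k j *s bs ! k)" using g by (intro sum.cong) simp_all
    also have "\<dots> = 0" by (rule cols_eqD[OF UM \<open>j < ?r\<close>])
    finally have "g (bs ! l) = 0"
      using vec.independentD[OF bs(2) finite_set subset_refl] that(1) by simp
    then show ?thesis using g[OF that(1)] by simp
  qed
  then have "entry M l j = entry 0 l j" for l j
    using sM by (cases "l < ?r \<and> j < ?r") (auto simp: fshape_def)
  then have "M = 0" by (rule fmat_eqI)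
  then show ?thesis using that[OF sW UW] by (simp add: M_def)
qed

end

section \<open>Transfer of the regulator to matrices\<close>

theorem theorem2p28:
  fixes G :: "('g, 'b) monoid_scheme"
    and \<Theta> :: "('g set \<times> int) list"
    and \<rho> :: "'g \<Rightarrow> 'k::field_char_0 ^'n^'n"
    and \<beta> :: "'k ^'n \<Rightarrow> 'k^'n \<Rightarrow> 'k"
    and bs :: "nat \<Rightarrow> ('k^'n) list"
  assumes "group G" and "finite (carrier G)" and "odd (order G)"
    and "G_relation G \<Theta>"
    and "is_rep G \<rho>" and "self_dual G \<rho>"
    and "bilinear_pairing \<beta>" and "nondegenerate \<beta>" and "G_invariant_pairing G \<rho> \<beta>"
    and "\<forall>i<length \<Theta>. is_basis_list (invariants \<rho> (fst (\<Theta> ! i))) (bs i)"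
  shows "trivial_square_class (reg_product \<beta> \<Theta> bs)"
proof -
  note bil = \<open>bilinear_pairing \<beta>\<close> and rel = \<open>G_relation G \<Theta>\<close>
  let ?n = "CARD('n)"
  obtain u :: "nat \<Rightarrow> 'n" where u: "bij_betw u {..<?n} UNIV"
    using ex_bij_betw_nat_finite[of "UNIV :: 'n set"] by (auto simp: lessThan_atLeast0)
  interpret vec_enum u by unfold_locales (rule u)
  define R where "R x = fmat_of_cols u ?n (\<lambda>j. \<rho> x *v axis (u j) 1)" for x
  let ?P = "fmat_of_pairing u \<beta>"
  have R_cols: "R x * fmat_of_cols u r f = fmat_of_cols u r (\<lambda>j. \<rho> x *v f j)" for x r f
    unfolding R_def by (rule cols_matrix_times)
  have one: "R \<one>\<^bsub>G\<^esub> = fidm ?n"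
    using \<open>is_rep G \<rho>\<close> by (simp add: R_def is_rep_def cols_id)
  have mult: "R (x \<otimes>\<^bsub>G\<^esub> y) = R x * R y" if "x \<in> carrier G" "y \<in> carrier G" for x y
    using \<open>is_rep G \<rho>\<close> that unfolding R_def[of y] R_cols
    by (simp add: R_def is_rep_def matrix_vector_mul_assoc)
  interpret rep: finite_group_rep G ?n R
    using \<open>group G\<close> \<open>finite (carrier G)\<close> one mult
    by (intro finite_group_rep.intro finite_group.intro finite_group_axioms.intro
        finite_group_rep_axioms.intro)
  have P: "rep.invariant_form ?P"
    unfolding rep.invariant_form_def
  proof (intro conjI ballI fshape_pairing)
    fix x assume x: "x \<in> carrier G"
    show "ftr (R x) * ?P * R x = ?P"
    proof (rule fmat_eqI)
      fix i j
      have s: "fshape ?n ?n (ftr (R x) * ?P * R x)"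
        unfolding R_def by (rule fshape_times fshape_intros(6) fshape_cols fshape_pairing)+
      show "entry (ftr (R x) * ?P * R x) i j = entry ?P i j"
      proof (cases "i < ?n \<and> j < ?n")
        case True
        then have "entry (ftr (R x) * ?P * R x) i j
            = \<beta> (\<rho> x *v axis (u i) 1) (\<rho> x *v axis (u j) 1)"
          unfolding R_def by (intro gram_cols[OF bil]) simp_all
        also have "\<dots> = \<beta> (axis (u i) 1) (axis (u j) 1)"
          using \<open>G_invariant_pairing G \<rho> \<beta>\<close> x by (simp add: G_invariant_pairing_def)
        finally show ?thesis using True by (simp add: fmat_of_pairing_def)
      next
        case False
        then show ?thesis using s fshape_pairing[of \<beta>] by (auto simp: fshape_def)
      qed
    qed
  qed
  obtain P' where P': "fshape ?n ?n P'" "?P * P' = fidm ?n" "P' * ?P = fidm ?n"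
    by (rule pairing_right_inverse[OF bil \<open>nondegenerate \<beta>\<close>])
  interpret rep: odd_self_dual_rep G ?n R ?P P'
    using \<open>odd (order G)\<close> P P' by unfold_locales
  define r where "r i = length (bs i)" for i
  \<comment> \<open>The given bases themselves serve as columns, so that the Gram determinants of
    the statement are those of the matrix results.\<close>
  define U where "U i = fmat_of_cols u (r i) ((!) (bs i))" for i
  have "\<exists>W. rep.factors (fst (\<Theta> ! i)) (r i) (U i) W" if i: "i < length \<Theta>" for i
  proof -
    let ?H = "fst (\<Theta> ! i)"
    have H: "subgroup ?H G" using rel i by (simp add: G_relation_def)
    have basis: "is_basis_list (invariants \<rho> ?H) (bs i)" using assms(10) i by blast
    have sub: "set (bs i) \<subseteq> invariants \<rho> ?H"
      using basis vec.span_superset[of "set (bs i)"] by (simp add: is_basis_list_def)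
    have "\<rho> h *v (bs i ! j) = bs i ! j" if h: "h \<in> ?H" "j < r i" for h j
    proof -
      have "bs i ! j \<in> set (bs i)" using h(2) by (intro nth_mem) (simp add: r_def)
      then have "bs i ! j \<in> invariants \<rho> ?H" using sub by (rule rev_subsetD)
      then show ?thesis using h(1) by (simp add: invariants_def)
    qed
    then have "R h * U i = U i" if "h \<in> ?H" for h
      unfolding U_def R_cols using that by (intro cols_eqI) simp
    then have fixed: "rep.avg ?H * U i = U i" by (rule rep.avg_absorb[OF H])
    have im: "f j \<in> invariants \<rho> ?H" if f: "rep.avg ?H = fmat_of_cols u ?n f" and j: "j < ?n" for f j
      unfolding invariants_def
    proof (intro CollectI ballI)
      fix h assume h: "h \<in> ?H"
      have "fmat_of_cols u ?n (\<lambda>j. \<rho> h *v f j) = fmat_of_cols u ?n f"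
        using rep.rho_avg(1)[OF H h] unfolding f R_cols .
      then show "\<rho> h *v f j = f j" using j by (rule cols_eqD)
    qed
    have im': "\<forall>f. rep.avg ?H = fmat_of_cols u ?n f \<longrightarrow> (\<forall>j<?n. f j \<in> invariants \<rho> ?H)"
      using im by (intro allI impI)
    obtain W where "fshape (r i) ?n W" "U i * W = rep.avg ?H" "W * U i = fidm (r i)"
      unfolding U_def r_def
      by (rule basis_list_factorization[OF basis rep.fshape_avg[OF H] im' fixed[unfolded U_def r_def]])
    then show ?thesis unfolding rep.factors_def U_def using fshape_cols by (intro exI[of _ W]) simp
  qed
  then obtain W where W: "\<And>i. i < length \<Theta> \<Longrightarrow> rep.factors (fst (\<Theta> ! i)) (r i) (U i) (W i)"
    by metis
  define c :: "nat \<Rightarrow> 'k" where "c i = 1 / of_nat (card (fst (\<Theta> ! i)))" for i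
  have "gram_det (\<lambda>v w. \<beta> v w / of_nat (card (fst (\<Theta> ! i)))) (bs i)
      = c i ^ r i * fdet (r i) (ftr (U i) * ?P * U i)" for i
  proof -
    have "gram_det (\<lambda>v w. \<beta> v w / of_nat (card (fst (\<Theta> ! i)))) (bs i)
        = det_fun (r i) (\<lambda>k l. c i * entry (ftr (U i) * ?P * U i) k l)"
      unfolding gram_det_def r_def[symmetric]
    proof (rule det_fun_cong)
      fix k l assume "k < r i" "l < r i"
      then show "\<beta> (bs i ! k) (bs i ! l) / of_nat (card (fst (\<Theta> ! i)))
          = c i * entry (ftr (U i) * ?P * U i) k l"
        unfolding U_def by (simp only: gram_cols[OF bil]) (simp add: c_def)
    qed
    then show ?thesis by (simp only: det_fun_scale fdet_def)
  qed
  then have D: "reg_product \<beta> \<Theta> bs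
      = (\<Prod>i<length \<Theta>. (c i ^ r i * fdet (r i) (ftr (U i) * ?P * U i)) powi snd (\<Theta> ! i))"
    by (simp only: reg_product_def)
  have C: "trivial_square_class (\<Prod>i<length \<Theta>. c i powi snd (\<Theta> ! i))"
    unfolding c_def using \<open>odd (order G)\<close> rel by (rule rep.prod_card_square_class)
  \<comment> \<open>\<open>a\<close> is the dimension of the \<open>G\<close>-invariants; its parity
    decides whether the scalars 1/|H_i| contribute modulo squares.\<close>
  obtain a where a: "ftrace (rep.avg (carrier G)) = of_nat a"
    using trace_idempotent[OF rep.fshape_avg rep.avg_idem] rep.subgroup_self by metis
  show ?thesis
  proof (cases "even a")
    case True
    then show ?thesis
      using rep.scaled_regulator_square_class(1)[OF rel W a] unfolding D c_def by blast
  next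
    case False
    then have "trivial_square_class (reg_product \<beta> \<Theta> bs * (\<Prod>i<length \<Theta>. c i powi snd (\<Theta> ! i)))"
      using rep.scaled_regulator_square_class(2)[OF rel W a] unfolding D c_def by blast
    then show ?thesis using C by (rule trivial_square_class_cancel)
  qed
qed

end
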